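(* For every positive integer $n$, the $\mathfrak{sp}(4)$ clasp $g_n$ of weight $(0,n)$ satisfies, with $Q=g_{n-1}\otimes\mathrm{id}_2\in\mathrm{Hom}(2^n,2^n)$, $$g_n=Q+\frac{[2n-1][2n-2]}{[2n+1][2n]}\;Q\circ(\mathrm{id}_{2^{n-2}}\otimes U^{(2)})\circ Q+\frac{[2n-2]}{[2n][2][2]}\;Q\circ(\mathrm{id}_{2^{n-2}}\otimes X^{(2)})\circ Q,$$ where $U^{(2)}$ and $X^{(2)}$ are the cup-cap web and the tetravalent vertex on two type 2 strands (the last two terms are absent for $n=1$).
   Context: Ground field $K=\mathbb{C}(q^{1/2})$; $[n]=\frac{q^{n/2}-q^{-n/2}}{q^{1/2}-q^{-1/2}}$. Webs. An $\mathfrak{sp}(4)$ web in a rectangle is an unoriented planar graph (possibly with closed loops without vertices), up to isotopy, with edges of two types, type 1 (single) and type 2 (double), whose interior vertices are trivalent with two type 1 edges and one type 2 edge, and whose univalent vertices lie on the bottom and top sides. For words $s,t$ in the letters $1,2$, $\mathrm{Hom}(s,t)$ is the $K$-vector space spanned by webs whose bottom (top) endpoints have types $s$ (resp. $t$), left to right, modulo the local relations: a type 1 loop equals $-\frac{[6][2]}{[3]}$; a type 2 loop equals $\frac{[6][5]}{[3][2]}$; a type 2 edge ending at a vertex whose two type 1 half-edges form a loop bounding an empty disc equals $0$; a bigon of two type 1 edges with two type 2 legs equals $-[2]^2$ times a type 2 strand; a triangle of type 1 edges with three type 2 legs equals $0$; and, for four type 1 boundary points (top-left, top-right, bottom-left,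 bottom-right), $$I-J=U-V,$$ where $I$ joins the two top points at one vertex and the two bottom points at another vertex, connected by a vertical type 2 edge; $J$ joins the two left points at one vertex and the two right points at another, connected by a horizontal type 2 edge; $U$ joins the top two points by an arc and the bottom two points by an arc; $V$ consists of two vertical strands. Composition stacks diagrams (the left factor on top), $\otimes$ is juxtaposition. The web $U^{(2)}\in\mathrm{Hom}(22,22)$ is a type 2 arc joining the two top points together with a type 2 arc joining the two bottom points. The tetravalent vertex $X^{(2)}\in\mathrm{Hom}(22,22)$ is the square of four type 1 edges with one type 2 leg attached at each of its four corners. Clasps. The weight of a word with $a$ letters $1$ and $b$ letters $2$ is $(a,b)$, meaning $a\lambda_1+b\lambda_2$ (fundamental weights of $\mathfrak{sp}(4)$, $\dim V_{\lambda_1}=4$, $\dim V_{\lambda_2}=5$). The partial order is generated by $(a,b)\succ(a-2,b+1)$ and $(a,b)\succ(a+2,b-2)$. The clasp of a word $s$ is the unique nonzero idempotent $P_s\in\mathrm{Hom}(s,s)$ such that $w\circ P_s=0$ for $w\in\mathrm{Hom}(s,t)$ and $P_s\circ w'=0$ for $w'\in\mathrm{Hom}(t,s)$ whenever the weight of $t$ is strictly less than that of $s$. Here $g_n=P_{2^n}$ ($g_0$ empty). *)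

theory Defs
  imports
    "HOL-Library.Multiset"
    "HOL-Library.Poly_Mapping"
    "HOL-Computational_Algebra.Polynomial"
    "HOL-Computational_Algebra.Fraction_Field"
begin

section \<open>The ground field\<close>

text \<open>The indeterminate of the polynomial ring is the square root of q.\<close>

type_synonym scalar = "complex poly fract"

definition q_half :: scalar
  where "q_half = Fract [:0, 1:] 1"

definition qint :: "int \<Rightarrow> scalar"
  where "qint n = (q_half powi n - q_half powi (- n)) / (q_half powi 1 - q_half powi (- 1))"


section \<open>Planar diagrams in general position\<close>

text \<open>
  A web is represented by a drawing in general position with respect to the height function of
  the rectangle: horizontal lines cut it into slices, each of which consists of vertical strands
  and one critical event.  An event is a local minimum (\<open>Cup\<close>) or a local maximum (\<open>Cap\<close>) of an
  edge, or an interior vertex.  \<open>Vertex a b\<close> is a vertex whose legs leaving downwards have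
  types \<open>a\<close> and whose legs leaving upwards have types \<open>b\<close>, both read from left to right.
\<close>

datatype strand = Single | Double

type_synonym word = "strand list"

datatype event = Cup strand | Cap strand | Vertex word word

fun event_bot :: "event \<Rightarrow> word" where
  "event_bot (Cup x) = []"
| "event_bot (Cap x) = [x, x]"
| "event_bot (Vertex a b) = a"

fun event_top :: "event \<Rightarrow> word" where
  "event_top (Cup x) = [x, x]"
| "event_top (Cap x) = []"
| "event_top (Vertex a b) = b"

fun event_ok :: "event \<Rightarrow> bool" where
  "event_ok (Vertex a b) \<longleftrightarrow> mset (a @ b) = {#Single, Single, Double#}"
| "event_ok _ \<longleftrightarrow> True"

text \<open>
  The slice \<open>(u, e, v)\<close> is the event \<open>e\<close> with vertical strands of types \<open>u\<close> to its left and \<open>v\<close>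
  to its right.  Lists of slices are read from the bottom of the rectangle to the top.
\<close>

type_synonym slice = "word \<times> event \<times> word"

inductive is_diagram :: "word \<Rightarrow> slice list \<Rightarrow> word \<Rightarrow> bool" where
  Nil: "is_diagram s [] s"
| Cons: "event_ok e \<Longrightarrow> is_diagram (u @ event_top e @ v) D t
    \<Longrightarrow> is_diagram (u @ event_bot e @ v) ((u, e, v) # D) t"

typedef diagram = "{(s, D, t). is_diagram s D t}"
  by (auto intro: is_diagram.Nil)

definition bot_word :: "diagram \<Rightarrow> word"
  where "bot_word A = fst (Rep_diagram A)"

definition slices :: "diagram \<Rightarrow> slice list"
  where "slices A = fst (snd (Rep_diagram A))"

definition top_word :: "diagram \<Rightarrow> word"
  where "top_word A = snd (snd (Rep_diagram A))"

text \<open>To be used only if \<open>is_diagram s D t\<close>.\<close>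

definition diagram :: "word \<Rightarrow> slice list \<Rightarrow> word \<Rightarrow> diagram"
  where "diagram s D t = Abs_diagram (s, D, t)"

definition widen :: "word \<Rightarrow> word \<Rightarrow> slice list \<Rightarrow> slice list"
  where "widen u v D = map (\<lambda>(a, e, b). (u @ a, e, b @ v)) D"

text \<open>
  \<open>stack A B\<close> puts \<open>A\<close> on top of \<open>B\<close>; it is meaningful only if \<open>bot_word A = top_word B\<close>.
  In \<open>juxtapose A B\<close> the diagram \<open>A\<close> is on the left; its events are drawn below those of \<open>B\<close>.
\<close>

definition stack :: "diagram \<Rightarrow> diagram \<Rightarrow> diagram"
  where "stack A B = diagram (bot_word B) (slices B @ slices A) (top_word A)"

definition juxtapose :: "diagram \<Rightarrow> diagram \<Rightarrow> diagram"
  where "juxtapose A B = diagram (bot_word A @ bot_word B)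
    (widen [] (bot_word B) (slices A) @ widen (top_word A) [] (slices B))
    (top_word A @ top_word B)"

lemma is_diagram_slices: "is_diagram (bot_word A) (slices A) (top_word A)"
  using Rep_diagram[of A] by (auto simp: bot_word_def slices_def top_word_def)

lemma diagram_sel:
  assumes "is_diagram s D t"
  shows "bot_word (diagram s D t) = s" "slices (diagram s D t) = D" "top_word (diagram s D t) = t"
  using assms by (simp_all add: bot_word_def slices_def top_word_def diagram_def Abs_diagram_inverse)

lemma is_diagram_append:
  "is_diagram s D t \<Longrightarrow> is_diagram t E r \<Longrightarrow> is_diagram s (D @ E) r"
  by (induction rule: is_diagram.induct) (auto intro: is_diagram.intros)

lemma is_diagram_widen:
  "is_diagram s D t \<Longrightarrow> is_diagram (u @ s @ v) (widen u v D) (u @ t @ v)"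
proof (induction rule: is_diagram.induct)
  case (Nil s)
  then show ?case by (simp add: widen_def is_diagram.Nil)
next
  case (Cons e a b D t)
  then show ?case
    using is_diagram.Cons[of e "u @ a" "b @ v" "widen u v D" "u @ t @ v"] by (simp add: widen_def)
qed

lemma is_diagram_stack:
  "bot_word A = top_word B \<Longrightarrow> is_diagram (bot_word B) (slices B @ slices A) (top_word A)"
  using is_diagram_append is_diagram_slices by metis

lemma is_diagram_juxtapose:
  "is_diagram (bot_word A @ bot_word B)
    (widen [] (bot_word B) (slices A) @ widen (top_word A) [] (slices B))
    (top_word A @ top_word B)"
  using is_diagram_append is_diagram_widen[OF is_diagram_slices[of A], of "[]" "bot_word B"]
    is_diagram_widen[OF is_diagram_slices[of B], of "top_word A" "[]"] by auto


section \<open>Formal linear combinations of diagrams\<close>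

type_synonym lincomb = "diagram \<Rightarrow>\<^sub>0 scalar"

definition dg :: "word \<Rightarrow> slice list \<Rightarrow> word \<Rightarrow> lincomb"
  where "dg s D t = Poly_Mapping.single (diagram s D t) 1"

definition lc_scale :: "scalar \<Rightarrow> lincomb \<Rightarrow> lincomb"
  where "lc_scale c = Poly_Mapping.map ((*) c)"

definition bilinear_ext :: "(diagram \<Rightarrow> diagram \<Rightarrow> scalar \<Rightarrow> lincomb) \<Rightarrow> lincomb \<Rightarrow> lincomb \<Rightarrow> lincomb"
  where "bilinear_ext F f g =
    (\<Sum>A\<in>Poly_Mapping.keys f. \<Sum>B\<in>Poly_Mapping.keys g.
      F A B (Poly_Mapping.lookup f A * Poly_Mapping.lookup g B))"

text \<open>As in a category algebra, the composite of two diagrams that do not match is zero.\<close>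

definition lc_comp :: "lincomb \<Rightarrow> lincomb \<Rightarrow> lincomb"
  where "lc_comp = bilinear_ext (\<lambda>A B c.
    if bot_word A = top_word B then Poly_Mapping.single (stack A B) c else 0)"

definition lc_tensor :: "lincomb \<Rightarrow> lincomb \<Rightarrow> lincomb"
  where "lc_tensor = bilinear_ext (\<lambda>A B c. Poly_Mapping.single (juxtapose A B) c)"

lemma lookup_lc_scale [simp]: "Poly_Mapping.lookup (lc_scale c f) A = c * Poly_Mapping.lookup f A"
  by (simp add: lc_scale_def Poly_Mapping.map.rep_eq when_def)

lemma lc_scale_simps:
  "lc_scale c (f + g) = lc_scale c f + lc_scale c g"
  "lc_scale c (f - g) = lc_scale c f - lc_scale c g"
  "lc_scale (c + d) f = lc_scale c f + lc_scale d f"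
  "lc_scale c (lc_scale d f) = lc_scale (c * d) f"
  "lc_scale 1 f = f"
  "lc_scale (- 1) f = - f"
  by (auto intro!: poly_mapping_eqI simp: lookup_add lookup_minus algebra_simps)

lemma bilinear_ext_superset:
  assumes F0: "\<And>A B. F A B 0 = 0"
    and S: "finite S" "Poly_Mapping.keys f \<subseteq> S" and T: "finite T" "Poly_Mapping.keys g \<subseteq> T"
  shows "bilinear_ext F f g =
    (\<Sum>A\<in>S. \<Sum>B\<in>T. F A B (Poly_Mapping.lookup f A * Poly_Mapping.lookup g B))"
proof -
  have "bilinear_ext F f g = (\<Sum>A\<in>Poly_Mapping.keys f. \<Sum>B\<in>T.
      F A B (Poly_Mapping.lookup f A * Poly_Mapping.lookup g B))"
    unfolding bilinear_ext_def
    by (intro sum.cong refl sum.mono_neutral_left) (use T F0 in \<open>auto simp: in_keys_iff\<close>)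
  also have "\<dots> = (\<Sum>A\<in>S. \<Sum>B\<in>T. F A B (Poly_Mapping.lookup f A * Poly_Mapping.lookup g B))"
    by (intro sum.mono_neutral_left) (use S F0 in \<open>auto simp: in_keys_iff\<close>)
  finally show ?thesis .
qed

lemma bilinear_ext_diff:
  assumes F0: "\<And>A B. F A B 0 = 0" and Fd: "\<And>A B c d. F A B (c - d) = F A B c - F A B d"
  shows "bilinear_ext F (f - f') g = bilinear_ext F f g - bilinear_ext F f' g"
    and "bilinear_ext F f (g - g') = bilinear_ext F f g - bilinear_ext F f g'"
proof -
  let ?S = "Poly_Mapping.keys f \<union> Poly_Mapping.keys f'"
  let ?T = "Poly_Mapping.keys g \<union> Poly_Mapping.keys g'"
  have S: "finite ?S" "Poly_Mapping.keys f \<subseteq> ?S" "Poly_Mapping.keys f' \<subseteq> ?S"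
      "Poly_Mapping.keys (f - f') \<subseteq> ?S"
    and T: "finite ?T" "Poly_Mapping.keys g \<subseteq> ?T" "Poly_Mapping.keys g' \<subseteq> ?T"
      "Poly_Mapping.keys (g - g') \<subseteq> ?T"
    by (auto simp: in_keys_iff lookup_minus)
  note ext = bilinear_ext_superset[where F = F, OF F0]
  show "bilinear_ext F (f - f') g = bilinear_ext F f g - bilinear_ext F f' g"
    by (simp add: ext[OF S(1,2) T(1,2)] ext[OF S(1,3) T(1,2)] ext[OF S(1,4) T(1,2)]
        lookup_minus left_diff_distrib Fd sum_subtractf)
  show "bilinear_ext F f (g - g') = bilinear_ext F f g - bilinear_ext F f g'"
    by (simp add: ext[OF S(1,2) T(1,2)] ext[OF S(1,2) T(1,3)] ext[OF S(1,2) T(1,4)]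
        lookup_minus right_diff_distrib Fd sum_subtractf)
qed

lemma lc_comp_diff:
  "lc_comp (f - f') g = lc_comp f g - lc_comp f' g"
  "lc_comp f (g - g') = lc_comp f g - lc_comp f g'"
  unfolding lc_comp_def by (rule bilinear_ext_diff; simp add: single_diff)+

lemma lc_tensor_diff:
  "lc_tensor (f - f') g = lc_tensor f g - lc_tensor f' g"
  "lc_tensor f (g - g') = lc_tensor f g - lc_tensor f g'"
  unfolding lc_tensor_def by (rule bilinear_ext_diff; simp add: single_diff)+


section \<open>Isotopy and the local relations\<close>

text \<open>
  Two diagrams in general position are drawings of isotopic webs iff they are connected by
  the following local moves: exchange of the heights of two events that lie side by side,
  creation or cancellation of a local minimum and an adjacent local maximum of an edge, and
  turning the outermost leg of a vertex on either side from the downward to the upward direction.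
  \<open>isotopy_move s D E t\<close> relates diagrams \<open>D\<close> and \<open>E\<close> with bottom word \<open>s\<close> and top word \<open>t\<close>.
\<close>

inductive isotopy_move :: "word \<Rightarrow> slice list \<Rightarrow> slice list \<Rightarrow> word \<Rightarrow> bool" where
  exchange: "event_ok e \<Longrightarrow> event_ok f \<Longrightarrow>
    isotopy_move (event_bot e @ m @ event_bot f)
      [([], e, m @ event_bot f), (event_top e @ m, f, [])]
      [(event_bot e @ m, f, []), ([], e, m @ event_top f)]
      (event_top e @ m @ event_top f)"
| zigzag_right: "isotopy_move [x] [([x], Cup x, []), ([], Cap x, [x])] [] [x]"
| zigzag_left: "isotopy_move [x] [([], Cup x, [x]), ([x], Cap x, [])] [] [x]"
| turn_right: "event_ok (Vertex (a @ [x]) b) \<Longrightarrow>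
    isotopy_move a [(a, Cup x, []), ([], Vertex (a @ [x]) b, [x])] [([], Vertex a (b @ [x]), [])]
      (b @ [x])"
| turn_left: "event_ok (Vertex (x # a) b) \<Longrightarrow>
    isotopy_move a [([], Cup x, a), ([x], Vertex (x # a) b, [])] [([], Vertex a (x # b), [])]
      (x # b)"

abbreviation merge :: event where "merge \<equiv> Vertex [Single, Single] [Double]"
abbreviation split :: event where "split \<equiv> Vertex [Double] [Single, Single]"

definition web_I :: lincomb where
  "web_I = dg [Single, Single] [([], merge, []), ([], split, [])] [Single, Single]"

definition web_J :: lincomb where
  "web_J = dg [Single, Single]
    [([], Vertex [Single] [Single, Double], [Single]),
     ([Single], Vertex [Double, Single] [Single], [])] [Single, Single]"

definition web_U :: lincomb where
  "web_U = dg [Single, Single] [([], Cap Single, []), ([], Cup Single, [])] [Single, Single]"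

definition web_V :: lincomb where
  "web_V = dg [Single, Single] [] [Single, Single]"

text \<open>The elements of \<open>relator\<close> are the linear combinations that are set to zero.\<close>

inductive_set relator :: "lincomb set" where
  isotopy: "isotopy_move s D E t \<Longrightarrow> dg s D t - dg s E t \<in> relator"
| loop1: "dg [] [([], Cup Single, []), ([], Cap Single, [])] []
    - lc_scale (- (qint 6 * qint 2 / qint 3)) (dg [] [] []) \<in> relator"
| loop2: "dg [] [([], Cup Double, []), ([], Cap Double, [])] []
    - lc_scale (qint 6 * qint 5 / (qint 3 * qint 2)) (dg [] [] []) \<in> relator"
| monogon: "dg [Double] [([], split, []), ([], Cap Single, [])] [] \<in> relator"
| bigon: "dg [Double] [([], split, []), ([], merge, [])] [Double]
    - lc_scale (- ((qint 2)^2)) (dg [Double] [] [Double]) \<in> relator"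
| triangle: "dg [Double]
    [([], split, []), ([Single], Cup Single, [Single]),
     ([], merge, [Single, Single]), ([Double], merge, [])] [Double, Double] \<in> relator"
| square: "(web_I - web_J) - (web_U - web_V) \<in> relator"

text \<open>Applying relators locally, inside arbitrary webs, gives the tensor ideal they generate.\<close>

inductive_set null :: "lincomb set" where
  relator: "f \<in> relator \<Longrightarrow> f \<in> null"
| zero: "0 \<in> null"
| add: "f \<in> null \<Longrightarrow> g \<in> null \<Longrightarrow> f + g \<in> null"
| scale: "f \<in> null \<Longrightarrow> lc_scale c f \<in> null"
| comp_left: "f \<in> null \<Longrightarrow> lc_comp g f \<in> null"
| comp_right: "f \<in> null \<Longrightarrow> lc_comp f g \<in> null"
| tensor_left: "f \<in> null \<Longrightarrow> lc_tensor g f \<in> null"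
| tensor_right: "f \<in> null \<Longrightarrow> lc_tensor f g \<in> null"

lemma null_uminus: "f \<in> null \<Longrightarrow> - f \<in> null"
  using null.scale[of f "- 1"] by (simp add: lc_scale_simps)

lemma null_diff: "f \<in> null \<Longrightarrow> g \<in> null \<Longrightarrow> f - g \<in> null"
  using null.add[of f "- g"] null_uminus by simp


section \<open>Morphisms\<close>

text \<open>The type \<open>mor\<close> is the direct sum of all the spaces \<open>Hom s t\<close>.\<close>

quotient_type mor = lincomb / "\<lambda>f g. f - g \<in> null"
proof (rule equivpI)
  show "reflp (\<lambda>f g. f - g \<in> null)"
    by (simp add: reflp_def null.zero)
  show "symp (\<lambda>f g. f - g \<in> null)"
    by (rule sympI) (metis minus_diff_eq null_uminus)
  show "transp (\<lambda>f g. f - g \<in> null)"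
  proof (rule transpI)
    fix f g h :: lincomb assume "f - g \<in> null" "g - h \<in> null"
    from null.add[OF this] show "f - h \<in> null" by simp
  qed
qed

instantiation mor :: ab_group_add
begin

lift_definition zero_mor :: mor is 0 .

lift_definition plus_mor :: "mor \<Rightarrow> mor \<Rightarrow> mor" is "(+)"
  using null.add by (metis add_diff_add)

lift_definition uminus_mor :: "mor \<Rightarrow> mor" is uminus
  by (metis minus_diff_minus null_uminus)

lift_definition minus_mor :: "mor \<Rightarrow> mor \<Rightarrow> mor" is "(-)"
proof -
  fix f f' g g' :: lincomb assume "f - f' \<in> null" "g - g' \<in> null"
  from null_diff[OF this] show "f - g - (f' - g') \<in> null" by (simp add: algebra_simps)
qed

instance
  by standard (transfer; simp add: algebra_simps null.zero)+

end

lift_definition scale_mor :: "scalar \<Rightarrow> mor \<Rightarrow> mor"  (infixr "*\<^sub>K" 75) is lc_scale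
  by (metis lc_scale_simps(2) null.scale)

text \<open>Composition; the left factor is on top.\<close>

lift_definition comp_mor :: "mor \<Rightarrow> mor \<Rightarrow> mor"  (infixl "\<circ>\<^sub>w" 80) is lc_comp
proof -
  fix f f' g g' :: lincomb assume "f - f' \<in> null" "g - g' \<in> null"
  then have "lc_comp (f - f') g + lc_comp f' (g - g') \<in> null"
    by (intro null.add null.comp_left null.comp_right)
  then show "lc_comp f g - lc_comp f' g' \<in> null" by (simp add: lc_comp_diff)
qed

lift_definition tensor_mor :: "mor \<Rightarrow> mor \<Rightarrow> mor"  (infixl "\<otimes>\<^sub>w" 85) is lc_tensor
proof -
  fix f f' g g' :: lincomb assume "f - f' \<in> null" "g - g' \<in> null"
  then have "lc_tensor (f - f') g + lc_tensor f' (g - g') \<in> null"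
    by (intro null.add null.tensor_left null.tensor_right)
  then show "lc_tensor f g - lc_tensor f' g' \<in> null" by (simp add: lc_tensor_diff)
qed

lemma vector_space_mor: "vector_space (*\<^sub>K)"
  by standard (transfer; simp add: lc_scale_simps null.zero)+

lift_definition web :: "word \<Rightarrow> slice list \<Rightarrow> word \<Rightarrow> mor" is dg .

definition Hom :: "word \<Rightarrow> word \<Rightarrow> mor set"
  where "Hom s t = module.span (*\<^sub>K) {web s D t | D. is_diagram s D t}"

definition id_web :: "word \<Rightarrow> mor"
  where "id_web s = web s [] s"

definition U2 :: mor
  where "U2 = web [Double, Double] [([], Cap Double, []), ([], Cup Double, [])] [Double, Double]"

text \<open>
  Bottom to top: the two lower corners of the square, its lower edge, its upper edge, and its
  two upper corners; the two outer single strands are its vertical edges.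
\<close>

definition X2 :: mor
  where "X2 = web [Double, Double]
    [([], split, [Double]), ([Single, Single], split, []),
     ([Single], Cap Single, [Single]), ([Single], Cup Single, [Single]),
     ([], merge, [Single, Single]), ([Double], merge, [])] [Double, Double]"

lemma is_diagram_local_webs:
  "is_diagram [Double, Double] [([], Cap Double, []), ([], Cup Double, [])] [Double, Double]"
  "is_diagram [Double, Double]
    [([], split, [Double]), ([Single, Single], split, []),
     ([Single], Cap Single, [Single]), ([Single], Cup Single, [Single]),
     ([], merge, [Single, Single]), ([Double], merge, [])] [Double, Double]"
  "is_diagram [Single, Single] [([], merge, []), ([], split, [])] [Single, Single]"
  "is_diagram [Single, Single]
    [([], Vertex [Single] [Single, Double], [Single]),
     ([Single], Vertex [Double, Single] [Single], [])] [Single, Single]"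
  "is_diagram [Double]
    [([], split, []), ([Single], Cup Single, [Single]),
     ([], merge, [Single, Single]), ([Double], merge, [])] [Double, Double]"
  "is_diagram [Double] [([], split, []), ([], Cap Single, [])] []"
  "is_diagram [Double] [([], split, []), ([], merge, [])] [Double]"
  by (subst is_diagram.simps, simp)+

lemma isotopy_move_is_diagram:
  "isotopy_move s D E t \<Longrightarrow> is_diagram s D t \<and> is_diagram s E t"
  by (induction rule: isotopy_move.induct)
     (simp_all add: is_diagram.simps[of _ "_ # _"] is_diagram.simps[of _ "[]"])


section \<open>Clasps\<close>

text \<open>
  Weights have integer coordinates, since the order is generated on the whole weight lattice:
  a chain between two dominant weights may pass through weights that are not dominant.
\<close>

type_synonym weight = "int \<times> int"

definition word_weight :: "word \<Rightarrow> weight"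
  where "word_weight s = (int (count_list s Single), int (count_list s Double))"

inductive weight_less :: "weight \<Rightarrow> weight \<Rightarrow> bool"  (infix "\<prec>" 50) where
  step1: "(a - 2, b + 1) \<prec> (a, b)"
| step2: "(a + 2, b - 2) \<prec> (a, b)"
| trans: "x \<prec> y \<Longrightarrow> y \<prec> z \<Longrightarrow> x \<prec> z"

definition is_clasp :: "word \<Rightarrow> mor \<Rightarrow> bool"
  where "is_clasp s P \<longleftrightarrow> P \<in> Hom s s \<and> P \<noteq> 0 \<and> P \<circ>\<^sub>w P = P \<and>
    (\<forall>t. word_weight t \<prec> word_weight s \<longrightarrow>
      (\<forall>w \<in> Hom s t. w \<circ>\<^sub>w P = 0) \<and> (\<forall>w \<in> Hom t s. P \<circ>\<^sub>w w = 0))"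

end

theory Submission
  imports Defs
begin

text \<open>
  Splitting every double strand turns a web into a web on single strands, where cups, caps and the
  web I generate everything; modulo caps, \<open>- I / [2]\<close> satisfies the Temperley-Lieb relations.

  Define \<open>G\<close> by the recursion. It is a combination of the identity with webs that factor through lower
  weights, and by induction it is killed by every cap of two adjacent strands: for the last position,
  expanding \<open>G\<close> twice leaves a computation on three double strands whose three coefficients vanish
  because of the linear recurrences between quantum integers. Written on single strands, \<open>G\<close> then
  behaves like the half-diagram of n adjacent cups in the Temperley-Lieb algebra on 2n points, so that
  \<open>f \<circ> G\<close> is a multiple of \<open>G\<close> for every endomorphism \<open>f\<close>. For a clasp \<open>P\<close> this gives
  \<open>P = P \<circ> G = c G\<close>, and \<open>c = 1\<close> since both are idempotent.
\<close>

section \<open>The linear monoidal category of webs\<close>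

text \<open>No basis of a Hom space is used. The obstacle is that webs in an endomorphism may run
  through arbitrarily long words, so their action on \<open>G\<close> cannot be read off from a
  spanning set. A closure property replaces the basis: the span of what cups and operators I produce
  from \<open>G\<close> on single strands is stable under caps. Since cups only add strands,
  elements of this span with fewer strands than \<open>G\<close> are zero; hence caps kill all
  elements with as many strands as \<open>G\<close>, and there the Temperley-Lieb relations hold
  exactly. Stability cannot be proved for adjacent caps alone, because the square relation trades a
  cap beside an I for a cap behind another I. The induction therefore treats caps between any two
  strands. The constants come from the cap across the middle of two split double strands, through
  which both correction terms factor. Applied to the recursion it leaves multiples of three webs,
  and the constants make these multiples vanish. That \<open>G\<close> is nonzero is inferred from
  the given clasp \<open>P\<close>.\<close>

interpretation mor: vector_space "(*\<^sub>K)"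
  by (rule vector_space_mor)

lemma diagram_eqI:
  assumes "bot_word A = bot_word B" "slices A = slices B" "top_word A = top_word B"
  shows "A = B"
proof -
  have "Rep_diagram A = Rep_diagram B"
    using assms unfolding bot_word_def slices_def top_word_def by (auto simp: prod_eq_iff)
  then show ?thesis by (simp add: Rep_diagram_inject)
qed

lemma diagram_surj: "diagram (bot_word A) (slices A) (top_word A) = A"
  by (simp add: diagram_eqI diagram_sel is_diagram_slices)

lemma widen_simps [simp]:
  "widen u v [] = []"
  "widen u v ((a, e, b) # D) = (u @ a, e, b @ v) # widen u v D"
  "widen u v (D @ E) = widen u v D @ widen u v E"
  by (simp_all add: widen_def)

lemma widen_widen [simp]: "widen u v (widen u' v' D) = widen (u @ u') (v' @ v) D"
  by (induction D) (auto simp: widen_def)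

lemma widen_Nil_Nil [simp]: "widen [] [] D = D"
  by (induction D) auto

lemma bilinear_ext_scale:
  assumes F0: "\<And>A B. F A B 0 = 0" and Fs: "\<And>A B c d. F A B (c * d) = lc_scale c (F A B d)"
  shows "bilinear_ext F (lc_scale c f) g = lc_scale c (bilinear_ext F f g)"
    and "bilinear_ext F f (lc_scale c g) = lc_scale c (bilinear_ext F f g)"
proof -
  have *: "lc_scale c (\<Sum>A\<in>S. h A) = (\<Sum>A\<in>S. lc_scale c (h A))" for h and S :: "diagram set"
    by (induction S rule: infinite_finite_induct) (auto simp: lc_scale_simps intro!: poly_mapping_eqI)
  have K: "Poly_Mapping.keys (lc_scale c h) \<subseteq> Poly_Mapping.keys h" for h
    by (auto simp: in_keys_iff)
  note ext = bilinear_ext_superset[where F = F, OF F0]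
  show "bilinear_ext F (lc_scale c f) g = lc_scale c (bilinear_ext F f g)"
    by (simp add: ext[OF finite_keys K finite_keys subset_refl] bilinear_ext_def[of F f g] * Fs[symmetric] ac_simps)
  show "bilinear_ext F f (lc_scale c g) = lc_scale c (bilinear_ext F f g)"
    by (simp add: ext[OF finite_keys subset_refl finite_keys K] bilinear_ext_def[of F f g] * Fs[symmetric] ac_simps)
qed

lemma lc_scale_single: "lc_scale c (Poly_Mapping.single A d) = Poly_Mapping.single A (c * d)"
  by (rule poly_mapping_eqI) (simp add: lookup_single when_def)

lemma lc_comp_scale:
  "lc_comp (lc_scale c f) g = lc_scale c (lc_comp f g)"
  "lc_comp f (lc_scale c g) = lc_scale c (lc_comp f g)"
  unfolding lc_comp_def
  by (rule bilinear_ext_scale; auto simp: lc_scale_single intro!: poly_mapping_eqI)+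

lemma lc_tensor_scale:
  "lc_tensor (lc_scale c f) g = lc_scale c (lc_tensor f g)"
  "lc_tensor f (lc_scale c g) = lc_scale c (lc_tensor f g)"
  unfolding lc_tensor_def
  by (rule bilinear_ext_scale; auto simp: lc_scale_single intro!: poly_mapping_eqI)+

lemma comp_diff_left: "(x - y) \<circ>\<^sub>w z = x \<circ>\<^sub>w z - y \<circ>\<^sub>w z"
  by transfer (simp add: lc_comp_diff null.zero)

lemma comp_diff_right: "z \<circ>\<^sub>w (x - y) = z \<circ>\<^sub>w x - z \<circ>\<^sub>w y"
  by transfer (simp add: lc_comp_diff null.zero)

lemma tensor_diff_left: "(x - y) \<otimes>\<^sub>w z = x \<otimes>\<^sub>w z - y \<otimes>\<^sub>w z"
  by transfer (simp add: lc_tensor_diff null.zero)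

lemma tensor_diff_right: "z \<otimes>\<^sub>w (x - y) = z \<otimes>\<^sub>w x - z \<otimes>\<^sub>w y"
  by transfer (simp add: lc_tensor_diff null.zero)

lemma comp_scale_left [simp]: "(c *\<^sub>K x) \<circ>\<^sub>w y = c *\<^sub>K (x \<circ>\<^sub>w y)"
  by transfer (simp add: lc_comp_scale null.zero)

lemma comp_scale_right [simp]: "x \<circ>\<^sub>w (c *\<^sub>K y) = c *\<^sub>K (x \<circ>\<^sub>w y)"
  by transfer (simp add: lc_comp_scale null.zero)

lemma tensor_scale_left [simp]: "(c *\<^sub>K x) \<otimes>\<^sub>w y = c *\<^sub>K (x \<otimes>\<^sub>w y)"
  by transfer (simp add: lc_tensor_scale null.zero)

lemma tensor_scale_right [simp]: "x \<otimes>\<^sub>w (c *\<^sub>K y) = c *\<^sub>K (x \<otimes>\<^sub>w y)"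
  by transfer (simp add: lc_tensor_scale null.zero)

lemma comp_zero [simp]: "0 \<circ>\<^sub>w x = 0" "x \<circ>\<^sub>w 0 = 0"
  using comp_diff_left[of 0 0 x] comp_diff_right[of x 0 0] by simp_all

lemma tensor_zero [simp]: "0 \<otimes>\<^sub>w x = 0" "x \<otimes>\<^sub>w 0 = 0"
  using tensor_diff_left[of 0 0 x] tensor_diff_right[of x 0 0] by simp_all

lemma comp_minus [simp]: "(- x) \<circ>\<^sub>w y = - (x \<circ>\<^sub>w y)" "x \<circ>\<^sub>w (- y) = - (x \<circ>\<^sub>w y)"
  using comp_diff_left[of 0 x y] comp_diff_right[of x 0 y] by simp_all

lemma tensor_minus [simp]: "(- x) \<otimes>\<^sub>w y = - (x \<otimes>\<^sub>w y)" "x \<otimes>\<^sub>w (- y) = - (x \<otimes>\<^sub>w y)"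
  using tensor_diff_left[of 0 x y] tensor_diff_right[of x 0 y] by simp_all

lemma comp_add_left: "(x + y) \<circ>\<^sub>w z = x \<circ>\<^sub>w z + y \<circ>\<^sub>w z"
  using comp_diff_left[of x "- y" z] by simp

lemma comp_add_right: "z \<circ>\<^sub>w (x + y) = z \<circ>\<^sub>w x + z \<circ>\<^sub>w y"
  using comp_diff_right[of z x "- y"] by simp

lemma tensor_add_left: "(x + y) \<otimes>\<^sub>w z = x \<otimes>\<^sub>w z + y \<otimes>\<^sub>w z"
  using tensor_diff_left[of x "- y" z] by simp

lemma tensor_add_right: "z \<otimes>\<^sub>w (x + y) = z \<otimes>\<^sub>w x + z \<otimes>\<^sub>w y"
  using tensor_diff_right[of z x "- y"] by simp

lemmas comp_linear = comp_diff_left comp_diff_right comp_add_left comp_add_right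
lemmas tensor_linear = tensor_diff_left tensor_diff_right tensor_add_left tensor_add_right

section \<open>Operations on single diagrams and the category laws\<close>

lemma bilinear_ext_single:
  assumes "\<And>A B. F A B 0 = 0"
  shows "bilinear_ext F (Poly_Mapping.single A a) (Poly_Mapping.single B b) = F A B (a * b)"
proof -
  have "bilinear_ext F (Poly_Mapping.single A a) (Poly_Mapping.single B b)
    = (\<Sum>A'\<in>{A}. \<Sum>B'\<in>{B}. F A' B' (Poly_Mapping.lookup (Poly_Mapping.single A a) A' *
        Poly_Mapping.lookup (Poly_Mapping.single B b) B'))"
    by (rule bilinear_ext_superset) (auto simp: assms)
  then show ?thesis by simp
qed

lemma web_comp:
  assumes "is_diagram s D t" "is_diagram t E r"
  shows "web t E r \<circ>\<^sub>w web s D t = web s (D @ E) r"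
proof -
  have "lc_comp (dg t E r) (dg s D t) = dg s (D @ E) r"
    using assms
    by (simp add: lc_comp_def dg_def bilinear_ext_single diagram_sel stack_def)
  then show ?thesis by (simp add: web.abs_eq comp_mor.abs_eq zero_mor.abs_eq)
qed

lemma web_comp_mismatch:
  assumes "is_diagram s D t" "is_diagram t' E r" "t \<noteq> t'"
  shows "web t' E r \<circ>\<^sub>w web s D t = 0"
proof -
  have "lc_comp (dg t' E r) (dg s D t) = 0"
    using assms by (simp add: lc_comp_def dg_def bilinear_ext_single diagram_sel)
  then show ?thesis by (simp add: web.abs_eq comp_mor.abs_eq zero_mor.abs_eq)
qed

lemma web_tensor:
  assumes "is_diagram s D t" "is_diagram s' E t'"
  shows "web s D t \<otimes>\<^sub>w web s' E t' = web (s @ s') (widen [] s' D @ widen t [] E) (t @ t')"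
proof -
  have "lc_tensor (dg s D t) (dg s' E t') = dg (s @ s') (widen [] s' D @ widen t [] E) (t @ t')"
    using assms
    by (simp add: lc_tensor_def dg_def bilinear_ext_single diagram_sel juxtapose_def)
  then show ?thesis by (simp add: web.abs_eq tensor_mor.abs_eq)
qed

lemma sum_monomials:
  "(\<Sum>A\<in>Poly_Mapping.keys f. Poly_Mapping.single A (Poly_Mapping.lookup f A)) = f"
  by (rule poly_mapping_eqI)
    (simp add: lookup_sum lookup_single when_def in_keys_iff)

text \<open>Mismatched diagrams compose to zero, so composition is total and associativity needs no
  typing assumption: such laws are checked on diagrams and extended linearly by this rule.\<close>

lemma mor_induct [case_names web add scale]:
  assumes web: "\<And>s D t. is_diagram s D t \<Longrightarrow> P (web s D t)"
    and add: "\<And>x y. P x \<Longrightarrow> P y \<Longrightarrow> P (x + y)"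
    and scale: "\<And>c x. P x \<Longrightarrow> P (c *\<^sub>K x)"
  shows "P x"
proof -
  have z: "P 0"
    using scale[of "web [] [] []" 0] web[of "[]" "[]" "[]"] is_diagram.Nil by simp
  have *: "P (abs_mor f)" for f
  proof -
    have s: "P (abs_mor (Poly_Mapping.single A c))" for A c
    proof -
      have "abs_mor (Poly_Mapping.single A c) = c *\<^sub>K web (bot_word A) (slices A) (top_word A)"
        by (simp add: scale_mor.abs_eq web.abs_eq dg_def diagram_surj lc_scale_single)
      then show ?thesis using scale web is_diagram_slices by simp
    qed
    have "finite S \<Longrightarrow> P (abs_mor (\<Sum>A\<in>S. Poly_Mapping.single A (Poly_Mapping.lookup f A)))" for S
      by (induction S rule: finite_induct)
        (use z s add in \<open>auto simp: plus_mor.abs_eq[symmetric] zero_mor.abs_eq[symmetric]\<close>)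
    then show ?thesis
      by (metis finite_keys sum_monomials)
  qed
  show ?thesis using *[of "rep_mor x"] by (simp add: Quotient_abs_rep[OF Quotient_mor])
qed

lemma wcomp_assoc: "(x \<circ>\<^sub>w y) \<circ>\<^sub>w z = x \<circ>\<^sub>w (y \<circ>\<^sub>w z)"
proof (induction x rule: mor_induct)
  case (web s D t)
  note x = this
  show ?case
  proof (induction y rule: mor_induct)
    case (web s' D' t')
    note y = this
    show ?case
    proof (induction z rule: mor_induct)
      case (web s'' D'' t'')
      note z = this
      show ?case
      proof (cases "t' = s"; cases "t'' = s'")
        assume "t' = s" "t'' = s'"
        then show ?thesis
          using x y z is_diagram_append[of s'' D'' s' D' s] is_diagram_append[of s' D' s D t]
          by (simp add: web_comp)
      next
        assume "t' = s" "t'' \<noteq> s'"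
        then show ?thesis
          using x y z is_diagram_append[of s' D' s D t] by (simp add: web_comp web_comp_mismatch)
      next
        assume "t' \<noteq> s" "t'' = s'"
        then show ?thesis
          using x y z is_diagram_append[of s'' D'' s' D' t'] by (simp add: web_comp web_comp_mismatch)
      next
        assume "t' \<noteq> s" "t'' \<noteq> s'"
        then show ?thesis
          using x y z by (simp add: web_comp_mismatch)
      qed
    qed (simp_all add: comp_linear)
  qed (simp_all add: comp_linear)
qed (simp_all add: comp_linear)

lemma wtensor_assoc: "(x \<otimes>\<^sub>w y) \<otimes>\<^sub>w z = x \<otimes>\<^sub>w (y \<otimes>\<^sub>w z)"
proof (induction x rule: mor_induct)
  case (web s D t)
  note x = this
  show ?case
  proof (induction y rule: mor_induct)
    case (web s' D' t')
    note y = this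
    show ?case
    proof (induction z rule: mor_induct)
      case (web s'' D'' t'')
      note z = this
      have *: "is_diagram (a @ b) (widen [] b D @ widen c [] E) (c @ d)"
        if "is_diagram a D c" "is_diagram b E d" for a b c d D E
        using is_diagram_append[OF is_diagram_widen[OF that(1), of "[]" b]]
          is_diagram_widen[OF that(2), of c "[]"] by simp
      show ?case
        using x y z by (simp add: web_tensor *)
    qed (simp_all add: tensor_linear)
  qed (simp_all add: tensor_linear)
qed (simp_all add: tensor_linear)

definition ev :: "event \<Rightarrow> mor"
  where "ev e = web (event_bot e) [([], e, [])] (event_top e)"

lemma is_diagram_single: "event_ok e \<Longrightarrow> is_diagram (u @ event_bot e @ v) [(u, e, v)] (u @ event_top e @ v)"
  by (intro is_diagram.intros)

lemma id_web_tensor [simp]: "id_web u \<otimes>\<^sub>w id_web v = id_web (u @ v)"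
  by (simp add: id_web_def web_tensor is_diagram.Nil)

lemma id_web_Nil_tensor [simp]: "id_web [] \<otimes>\<^sub>w x = x" "x \<otimes>\<^sub>w id_web [] = x"
  by (induction x rule: mor_induct)
    (simp_all add: id_web_def web_tensor is_diagram.Nil tensor_linear)

lemma id_web_tensor_web:
  assumes "is_diagram s D t"
  shows "id_web u \<otimes>\<^sub>w web s D t \<otimes>\<^sub>w id_web v = web (u @ s @ v) (widen u v D) (u @ t @ v)"
  using is_diagram_widen[OF assms, of u "[]"] assms
  by (simp add: id_web_def web_tensor is_diagram.Nil)

lemma web_Cons:
  assumes "event_ok e" "is_diagram (u @ event_top e @ v) D t"
  shows "web (u @ event_bot e @ v) ((u, e, v) # D) t =
    web (u @ event_top e @ v) D t \<circ>\<^sub>w (id_web u \<otimes>\<^sub>w ev e \<otimes>\<^sub>w id_web v)"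
  using is_diagram_single[OF assms(1), of u v] is_diagram_single[OF assms(1), of "[]" "[]"] assms
  by (simp add: ev_def id_web_tensor_web web_comp)

section \<open>Typed morphisms and the interchange law\<close>

lemma Hom_web: "is_diagram s D t \<Longrightarrow> web s D t \<in> Hom s t"
  unfolding Hom_def by (rule mor.span_base) blast

lemma Hom_subspace: "mor.subspace (Hom s t)"
  unfolding Hom_def by (rule mor.subspace_span)

lemma Hom_closed:
  "0 \<in> Hom s t"
  "x \<in> Hom s t \<Longrightarrow> y \<in> Hom s t \<Longrightarrow> x + y \<in> Hom s t"
  "x \<in> Hom s t \<Longrightarrow> y \<in> Hom s t \<Longrightarrow> x - y \<in> Hom s t"
  "x \<in> Hom s t \<Longrightarrow> - x \<in> Hom s t"
  "x \<in> Hom s t \<Longrightarrow> c *\<^sub>K x \<in> Hom s t"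
  using Hom_subspace[of s t]
  by (simp_all add: mor.subspace_0 mor.subspace_add mor.subspace_diff mor.subspace_neg mor.subspace_scale)

lemma Hom_induct [consumes 1, case_names zero web add scale]:
  assumes "x \<in> Hom s t" "P 0" "\<And>D. is_diagram s D t \<Longrightarrow> P (web s D t)"
    "\<And>x y. P x \<Longrightarrow> P y \<Longrightarrow> P (x + y)" "\<And>c x. P x \<Longrightarrow> P (c *\<^sub>K x)"
  shows "P x"
  using assms(1) unfolding Hom_def
  by (induction rule: mor.span_induct) (use assms in \<open>auto simp: mor.subspace_def\<close>)

lemma Hom_ev: "event_ok e \<Longrightarrow> ev e \<in> Hom (event_bot e) (event_top e)"
  using is_diagram_single[of e "[]" "[]"] by (simp add: ev_def Hom_web)

lemma Hom_id [simp]: "id_web s \<in> Hom s s"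
  by (simp add: id_web_def Hom_web is_diagram.Nil)

lemma Hom_comp: "x \<in> Hom t r \<Longrightarrow> y \<in> Hom s t \<Longrightarrow> x \<circ>\<^sub>w y \<in> Hom s r"
proof (induction rule: Hom_induct)
  case (web D)
  show ?case
    using \<open>y \<in> Hom s t\<close>
    by (induction rule: Hom_induct)
      (use web in \<open>auto simp: comp_linear Hom_closed web_comp intro!: Hom_web is_diagram_append\<close>)
qed (simp_all add: comp_linear Hom_closed)

lemma is_diagram_tensor:
  assumes "is_diagram s D t" "is_diagram s' E t'"
  shows "is_diagram (s @ s') (widen [] s' D @ widen t [] E) (t @ t')"
  using is_diagram_append[OF is_diagram_widen[OF assms(1), of "[]" s']]
    is_diagram_widen[OF assms(2), of t "[]"] by simp

lemma Hom_tensor: "x \<in> Hom s t \<Longrightarrow> y \<in> Hom s' t' \<Longrightarrow> x \<otimes>\<^sub>w y \<in> Hom (s @ s') (t @ t')"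
proof (induction rule: Hom_induct)
  case (web D)
  show ?case
    using \<open>y \<in> Hom s' t'\<close>
    by (induction rule: Hom_induct)
      (use web in \<open>auto simp: tensor_linear Hom_closed web_tensor intro!: Hom_web is_diagram_tensor\<close>)
qed (simp_all add: tensor_linear Hom_closed)

lemma id_comp: "x \<in> Hom s t \<Longrightarrow> id_web t \<circ>\<^sub>w x = x"
  by (induction rule: Hom_induct) (simp_all add: comp_linear id_web_def web_comp is_diagram.Nil)

lemma comp_id: "x \<in> Hom s t \<Longrightarrow> x \<circ>\<^sub>w id_web s = x"
  by (induction rule: Hom_induct) (simp_all add: comp_linear id_web_def web_comp is_diagram.Nil)

lemma comp_tensor_id: "(x \<circ>\<^sub>w y) \<otimes>\<^sub>w id_web v = (x \<otimes>\<^sub>w id_web v) \<circ>\<^sub>w (y \<otimes>\<^sub>w id_web v)"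
proof (induction x rule: mor_induct)
  case (web s D t)
  note x = this
  show ?case
  proof (induction y rule: mor_induct)
    case (web s' D' t')
    show ?case
      using x web is_diagram_append[of s' D' s D t] is_diagram_widen[OF x, of "[]" v]
        is_diagram_widen[OF web, of "[]" v]
      by (cases "t' = s") (auto simp: id_web_def web_tensor web_comp web_comp_mismatch is_diagram.Nil)
  qed (simp_all add: comp_linear tensor_linear)
qed (simp_all add: comp_linear tensor_linear)

lemma id_tensor_comp: "id_web u \<otimes>\<^sub>w (x \<circ>\<^sub>w y) = (id_web u \<otimes>\<^sub>w x) \<circ>\<^sub>w (id_web u \<otimes>\<^sub>w y)"
proof (induction x rule: mor_induct)
  case (web s D t)
  note x = this
  show ?case
  proof (induction y rule: mor_induct)
    case (web s' D' t')
    show ?case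
      using x web is_diagram_append[of s' D' s D t] is_diagram_widen[OF x, of u "[]"]
        is_diagram_widen[OF web, of u "[]"]
      by (cases "t' = s") (auto simp: id_web_def web_tensor web_comp web_comp_mismatch is_diagram.Nil)
  qed (simp_all add: comp_linear tensor_linear)
qed (simp_all add: comp_linear tensor_linear)

lemma comp_tensor: "id_web u \<otimes>\<^sub>w (x \<circ>\<^sub>w y) \<otimes>\<^sub>w id_web v =
    (id_web u \<otimes>\<^sub>w x \<otimes>\<^sub>w id_web v) \<circ>\<^sub>w (id_web u \<otimes>\<^sub>w y \<otimes>\<^sub>w id_web v)"
  by (simp add: id_tensor_comp comp_tensor_id)

lemma tensor_eq_comp:
  assumes "x \<in> Hom s t" "y \<in> Hom s' t'"
  shows "x \<otimes>\<^sub>w y = (id_web t \<otimes>\<^sub>w y) \<circ>\<^sub>w (x \<otimes>\<^sub>w id_web s')"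
  using assms(1)
proof (induction rule: Hom_induct)
  case (web D)
  show ?case
    using assms(2)
  proof (induction rule: Hom_induct)
    case (web E)
    then show ?case
      using \<open>is_diagram s D t\<close> is_diagram_widen[of s D t "[]" s'] is_diagram_widen[of s' E t' t "[]"]
      by (simp add: id_web_def web_tensor web_comp is_diagram.Nil)
  qed (simp_all add: comp_linear tensor_linear)
qed (simp_all add: comp_linear tensor_linear)

lemma web_eqI_null: "dg s D t - dg s E t \<in> null \<Longrightarrow> web s D t = web s E t"
  by (simp add: web.abs_eq mor.abs_eq_iff)

lemma web_isotopy: "isotopy_move s D E t \<Longrightarrow> web s D t = web s E t"
  by (intro web_eqI_null null.relator relator.isotopy)

lemma exchange_ev:
  assumes "event_ok e" "event_ok f"
  shows "(id_web (event_top e @ m) \<otimes>\<^sub>w ev f) \<circ>\<^sub>w (ev e \<otimes>\<^sub>w id_web (m @ event_bot f)) =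
    (ev e \<otimes>\<^sub>w id_web (m @ event_top f)) \<circ>\<^sub>w (id_web (event_bot e @ m) \<otimes>\<^sub>w ev f)"
  using is_diagram_single[OF assms(1), of "[]" "m @ event_bot f"]
    is_diagram_single[OF assms(1), of "[]" "m @ event_top f"]
    is_diagram_single[OF assms(2), of "event_top e @ m" "[]"]
    is_diagram_single[OF assms(2), of "event_bot e @ m" "[]"]
    is_diagram_single[OF assms(1), of "[]" "[]"] is_diagram_single[OF assms(2), of "[]" "[]"]
    web_isotopy[OF isotopy_move.exchange[OF assms, of m]]
  by (simp add: id_web_def ev_def web_tensor is_diagram.Nil web_comp)

lemma exchange_slice:
  assumes "event_ok e" "event_ok f"
  shows "(id_web (a @ event_top e @ b) \<otimes>\<^sub>w (id_web c \<otimes>\<^sub>w ev f \<otimes>\<^sub>w id_web d)) \<circ>\<^sub>w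
      ((id_web a \<otimes>\<^sub>w ev e \<otimes>\<^sub>w id_web b) \<otimes>\<^sub>w id_web (c @ event_bot f @ d)) =
    ((id_web a \<otimes>\<^sub>w ev e \<otimes>\<^sub>w id_web b) \<otimes>\<^sub>w id_web (c @ event_top f @ d)) \<circ>\<^sub>w
      (id_web (a @ event_bot e @ b) \<otimes>\<^sub>w (id_web c \<otimes>\<^sub>w ev f \<otimes>\<^sub>w id_web d))"
proof -
  have *: "id_web (u @ v) = id_web u \<otimes>\<^sub>w id_web v" for u v by simp
  have "id_web a \<otimes>\<^sub>w ((id_web (event_top e @ b @ c) \<otimes>\<^sub>w ev f) \<circ>\<^sub>w
        (ev e \<otimes>\<^sub>w id_web ((b @ c) @ event_bot f))) \<otimes>\<^sub>w id_web d =
    id_web a \<otimes>\<^sub>w ((ev e \<otimes>\<^sub>w id_web ((b @ c) @ event_top f)) \<circ>\<^sub>w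
        (id_web (event_bot e @ b @ c) \<otimes>\<^sub>w ev f)) \<otimes>\<^sub>w id_web d"
    using exchange_ev[OF assms, of "b @ c"] by simp
  then show ?thesis
    by (simp add: comp_tensor_id id_tensor_comp * wtensor_assoc del: id_web_tensor)
qed

text \<open>The relators exchange the heights of two events only. One slice is moved past a whole
  diagram by induction on that diagram, then a diagram past a diagram by induction on the other one;
  linearity does the rest.\<close>

lemma exchange:
  assumes "x \<in> Hom s t" "y \<in> Hom s' t'"
  shows "(id_web t \<otimes>\<^sub>w y) \<circ>\<^sub>w (x \<otimes>\<^sub>w id_web s') = (x \<otimes>\<^sub>w id_web t') \<circ>\<^sub>w (id_web s \<otimes>\<^sub>w y)"
proof -
  have slice: "(id_web t \<otimes>\<^sub>w (id_web c \<otimes>\<^sub>w ev f \<otimes>\<^sub>w id_web d)) \<circ>\<^sub>w (web s D t \<otimes>\<^sub>w id_web (c @ event_bot f @ d)) =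
      (web s D t \<otimes>\<^sub>w id_web (c @ event_top f @ d)) \<circ>\<^sub>w (id_web s \<otimes>\<^sub>w (id_web c \<otimes>\<^sub>w ev f \<otimes>\<^sub>w id_web d))"
    if "is_diagram s D t" "event_ok f" for s D t f c d
    using that(1)
  proof (induction rule: is_diagram.induct)
    case (Nil s)
    have "id_web (c @ event_top f @ d) \<circ>\<^sub>w (id_web c \<otimes>\<^sub>w ev f \<otimes>\<^sub>w id_web d) = id_web c \<otimes>\<^sub>w ev f \<otimes>\<^sub>w id_web d"
      "(id_web c \<otimes>\<^sub>w ev f \<otimes>\<^sub>w id_web d) \<circ>\<^sub>w id_web (c @ event_bot f @ d) = id_web c \<otimes>\<^sub>w ev f \<otimes>\<^sub>w id_web d"
      using Hom_tensor[OF Hom_tensor[OF Hom_id Hom_ev[OF that(2)]] Hom_id, of c d]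
      by (simp_all add: id_comp comp_id)
    then show ?case
      by (simp add: id_web_def[symmetric] id_tensor_comp[symmetric] del: id_web_tensor)
  next
    case (Cons e u v D t)
    let ?F = "id_web c \<otimes>\<^sub>w ev f \<otimes>\<^sub>w id_web d"
    let ?E = "id_web u \<otimes>\<^sub>w ev e \<otimes>\<^sub>w id_web v"
    let ?b = "c @ event_bot f @ d" and ?t = "c @ event_top f @ d"
    let ?D = "web (u @ event_top e @ v) D t"
    have "(id_web t \<otimes>\<^sub>w ?F) \<circ>\<^sub>w ((?D \<circ>\<^sub>w ?E) \<otimes>\<^sub>w id_web ?b) =
      ((id_web t \<otimes>\<^sub>w ?F) \<circ>\<^sub>w (?D \<otimes>\<^sub>w id_web ?b)) \<circ>\<^sub>w (?E \<otimes>\<^sub>w id_web ?b)"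
      by (simp add: comp_tensor_id wcomp_assoc)
    also have "\<dots> = (?D \<otimes>\<^sub>w id_web ?t) \<circ>\<^sub>w ((id_web (u @ event_top e @ v) \<otimes>\<^sub>w ?F) \<circ>\<^sub>w (?E \<otimes>\<^sub>w id_web ?b))"
      by (simp only: Cons.IH wcomp_assoc)
    also have "\<dots> = (?D \<otimes>\<^sub>w id_web ?t) \<circ>\<^sub>w ((?E \<otimes>\<^sub>w id_web ?t) \<circ>\<^sub>w (id_web (u @ event_bot e @ v) \<otimes>\<^sub>w ?F))"
      by (simp only: exchange_slice[OF Cons(1) that(2)])
    also have "\<dots> = ((?D \<circ>\<^sub>w ?E) \<otimes>\<^sub>w id_web ?t) \<circ>\<^sub>w (id_web (u @ event_bot e @ v) \<otimes>\<^sub>w ?F)"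
      by (simp only: comp_tensor_id wcomp_assoc)
    finally show ?case by (simp only: web_Cons[OF Cons(1,2)])
  qed
  have webs: "(id_web t \<otimes>\<^sub>w web s' E t') \<circ>\<^sub>w (web s D t \<otimes>\<^sub>w id_web s') =
      (web s D t \<otimes>\<^sub>w id_web t') \<circ>\<^sub>w (id_web s \<otimes>\<^sub>w web s' E t')"
    if D: "is_diagram s D t" and "is_diagram s' E t'" for s D t s' E t'
    using that(2)
  proof (induction rule: is_diagram.induct)
    case (Nil s')
    have "web s D t \<otimes>\<^sub>w id_web s' \<in> Hom (s @ s') (t @ s')"
      by (intro Hom_tensor Hom_web D Hom_id)
    then show ?case by (simp add: id_web_def[symmetric] id_comp comp_id)
  next
    case (Cons f c d E t')
    let ?F = "id_web c \<otimes>\<^sub>w ev f \<otimes>\<^sub>w id_web d"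
    let ?b = "c @ event_bot f @ d" and ?t = "c @ event_top f @ d"
    let ?E = "web ?t E t'" and ?D = "web s D t"
    have "(id_web t \<otimes>\<^sub>w (?E \<circ>\<^sub>w ?F)) \<circ>\<^sub>w (?D \<otimes>\<^sub>w id_web ?b) =
      (id_web t \<otimes>\<^sub>w ?E) \<circ>\<^sub>w ((id_web t \<otimes>\<^sub>w ?F) \<circ>\<^sub>w (?D \<otimes>\<^sub>w id_web ?b))"
      by (simp only: id_tensor_comp wcomp_assoc)
    also have "\<dots> = ((id_web t \<otimes>\<^sub>w ?E) \<circ>\<^sub>w (?D \<otimes>\<^sub>w id_web ?t)) \<circ>\<^sub>w (id_web s \<otimes>\<^sub>w ?F)"
      by (simp only: slice[OF D Cons(1)] wcomp_assoc)
    also have "\<dots> = (?D \<otimes>\<^sub>w id_web t') \<circ>\<^sub>w (id_web s \<otimes>\<^sub>w (?E \<circ>\<^sub>w ?F))"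
      by (simp only: Cons.IH id_tensor_comp wcomp_assoc)
    finally show ?case by (simp only: web_Cons[OF Cons(1,2)])
  qed
  show ?thesis
    using assms(1)
  proof (induction rule: Hom_induct)
    case (web D)
    show ?case
      using assms(2) by (induction rule: Hom_induct) (simp_all add: comp_linear tensor_linear webs web)
  qed (simp_all add: comp_linear tensor_linear)
qed

lemma interchange:
  assumes "a \<in> Hom t r" "b \<in> Hom t' r'" "c \<in> Hom s t" "d \<in> Hom s' t'"
  shows "(a \<otimes>\<^sub>w b) \<circ>\<^sub>w (c \<otimes>\<^sub>w d) = (a \<circ>\<^sub>w c) \<otimes>\<^sub>w (b \<circ>\<^sub>w d)"
proof -
  have "(a \<otimes>\<^sub>w b) \<circ>\<^sub>w (c \<otimes>\<^sub>w d) =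
      (id_web r \<otimes>\<^sub>w b) \<circ>\<^sub>w ((a \<otimes>\<^sub>w id_web t') \<circ>\<^sub>w (id_web t \<otimes>\<^sub>w d)) \<circ>\<^sub>w (c \<otimes>\<^sub>w id_web s')"
    by (simp only: tensor_eq_comp[OF assms(1,2)] tensor_eq_comp[OF assms(3,4)] wcomp_assoc)
  also have "\<dots> = (id_web r \<otimes>\<^sub>w (b \<circ>\<^sub>w d)) \<circ>\<^sub>w ((a \<circ>\<^sub>w c) \<otimes>\<^sub>w id_web s')"
    by (simp only: exchange[OF assms(1,4), symmetric] wcomp_assoc id_tensor_comp comp_tensor_id)
  also have "\<dots> = (a \<circ>\<^sub>w c) \<otimes>\<^sub>w (b \<circ>\<^sub>w d)"
    using assms by (intro tensor_eq_comp[symmetric] Hom_comp)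
  finally show ?thesis .
qed

section \<open>Turning vertices\<close>

definition pad :: "word \<Rightarrow> mor \<Rightarrow> word \<Rightarrow> mor"
  where "pad u x v = id_web u \<otimes>\<^sub>w x \<otimes>\<^sub>w id_web v"

lemma pad_comp: "pad u (x \<circ>\<^sub>w y) v = pad u x v \<circ>\<^sub>w pad u y v"
  by (simp add: pad_def comp_tensor)

lemma pad_pad [simp]: "pad u (pad u' x v') v = pad (u @ u') x (v' @ v)"
  by (simp add: pad_def wtensor_assoc) (simp add: wtensor_assoc[symmetric])

lemma pad_Nil [simp]: "pad [] x [] = x"
  by (simp add: pad_def)

lemma pad_id [simp]: "pad u (id_web w) v = id_web (u @ w @ v)"
  by (simp add: pad_def)

lemma pad_linear:
  "pad u (x + y) v = pad u x v + pad u y v" "pad u (x - y) v = pad u x v - pad u y v"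
  "pad u (- x) v = - pad u x v" "pad u (c *\<^sub>K x) v = c *\<^sub>K pad u x v" "pad u 0 v = 0"
  by (simp_all add: pad_def tensor_linear)

lemma Hom_pad: "x \<in> Hom s t \<Longrightarrow> pad u x v \<in> Hom (u @ s @ v) (u @ t @ v)"
  using Hom_tensor[OF Hom_tensor[OF Hom_id], of x s t] by (simp add: pad_def)

lemma pad_commute:
  assumes "x \<in> Hom a b" "y \<in> Hom c d"
  shows "pad u x (m @ d @ v) \<circ>\<^sub>w pad (u @ a @ m) y v = pad (u @ b @ m) y v \<circ>\<^sub>w pad u x (m @ c @ v)"
proof -
  have *: "pad u x (m @ w @ v) = pad u (pad [] x (m @ w)) v" for w by simp
  have "pad [] x (m @ d) \<circ>\<^sub>w pad (a @ m) y [] = pad (b @ m) y [] \<circ>\<^sub>w pad [] x (m @ c)"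
    using exchange[OF Hom_tensor[OF assms(1) Hom_id] assms(2), of m] by (simp add: pad_def wtensor_assoc)
  then have "pad u (pad [] x (m @ d) \<circ>\<^sub>w pad (a @ m) y []) v = pad u (pad (b @ m) y [] \<circ>\<^sub>w pad [] x (m @ c)) v"
    by simp
  then show ?thesis by (simp add: pad_comp)
qed

abbreviation cupe :: "strand \<Rightarrow> mor" where "cupe x \<equiv> ev (Cup x)"
abbreviation cape :: "strand \<Rightarrow> mor" where "cape x \<equiv> ev (Cap x)"
abbreviation vert :: "word \<Rightarrow> word \<Rightarrow> mor" where "vert a b \<equiv> ev (Vertex a b)"
abbreviation mrg :: mor where "mrg \<equiv> ev merge"
abbreviation spl :: mor where "spl \<equiv> ev split"

lemma Hom_cupe: "cupe x \<in> Hom [] [x, x]" using Hom_ev[of "Cup x"] by simp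
lemma Hom_cape: "cape x \<in> Hom [x, x] []" using Hom_ev[of "Cap x"] by simp
lemma Hom_vert: "mset (a @ b) = {#Single, Single, Double#} \<Longrightarrow> vert a b \<in> Hom a b"
  using Hom_ev[of "Vertex a b"] by simp
lemma Hom_mrg: "mrg \<in> Hom [Single, Single] [Double]" by (rule Hom_vert) simp
lemma Hom_spl: "spl \<in> Hom [Double] [Single, Single]" by (rule Hom_vert) simp

lemma web_single: "event_ok e \<Longrightarrow> web (u @ event_bot e @ v) [(u, e, v)] (u @ event_top e @ v) = pad u (ev e) v"
  using is_diagram_single[of e "[]" "[]"] by (simp add: pad_def ev_def id_web_tensor_web)

lemma web_slice:
  assumes "event_ok e" "is_diagram (u @ event_top e @ v) D t"
  shows "web (u @ event_bot e @ v) ((u, e, v) # D) t = web (u @ event_top e @ v) D t \<circ>\<^sub>w pad u (ev e) v"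
  using web_Cons[OF assms] by (simp add: pad_def)

text \<open>The value on the empty list is irrelevant.\<close>

fun eval_slices :: "slice list \<Rightarrow> mor" where
  "eval_slices [] = 0"
| "eval_slices [(u, e, v)] = pad u (ev e) v"
| "eval_slices ((u, e, v) # D) = eval_slices D \<circ>\<^sub>w pad u (ev e) v"

lemma web_eval: "is_diagram s D t \<Longrightarrow> D \<noteq> [] \<Longrightarrow> web s D t = eval_slices D"
proof (induction rule: is_diagram.induct)
  case (Cons e u v D t)
  show ?case
  proof (cases D)
    case Nil
    with Cons(2) have "t = u @ event_top e @ v" by (simp add: is_diagram.simps[of _ "[]"])
    then show ?thesis using Nil web_single[OF Cons(1)] by simp
  next
    case D: (Cons x D')
    then have "web (u @ event_top e @ v) D t = eval_slices D" using Cons.IH by simp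
    then show ?thesis using D web_slice[OF Cons(1,2)] by simp
  qed
qed simp

lemma isotopy_eval:
  assumes "isotopy_move s D E t" "D \<noteq> []" "E \<noteq> []"
  shows "eval_slices D = eval_slices E"
  using web_isotopy[OF assms(1)] isotopy_move_is_diagram[OF assms(1)] web_eval assms by metis

lemma isotopy_eval_id:
  assumes "isotopy_move s D [] s" "D \<noteq> []"
  shows "eval_slices D = id_web s"
  using web_isotopy[OF assms(1)] isotopy_move_is_diagram[OF assms(1)] web_eval[of s D s] assms
  by (simp add: id_web_def)

lemma zigzag_right: "pad [] (cape x) [x] \<circ>\<^sub>w pad [x] (cupe x) [] = id_web [x]"
  using isotopy_eval_id[OF isotopy_move.zigzag_right[of x]] by simp

lemma zigzag_left: "pad [x] (cape x) [] \<circ>\<^sub>w pad [] (cupe x) [x] = id_web [x]"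
  using isotopy_eval_id[OF isotopy_move.zigzag_left[of x]] by simp

lemma turn_right:
  assumes "mset (a @ [x] @ b) = {#Single, Single, Double#}"
  shows "pad [] (vert (a @ [x]) b) [x] \<circ>\<^sub>w pad a (cupe x) [] = vert a (b @ [x])"
  using isotopy_eval[OF isotopy_move.turn_right[of a x b]] assms by simp

lemma turn_left:
  assumes "mset (a @ [x] @ b) = {#Single, Single, Double#}"
  shows "pad [x] (vert (x # a) b) [] \<circ>\<^sub>w pad [] (cupe x) a = vert a (x # b)"
  using isotopy_eval[OF isotopy_move.turn_left[of x a b]] assms by simp

text \<open>The isotopy move turns a downward leg upwards. The inverse comes from a zigzag: capping
  the turned leg straightens the cup that turned it.\<close>

lemma unturn_right:
  assumes "mset (a @ [x] @ b) = {#Single, Single, Double#}"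
  shows "pad b (cape x) [] \<circ>\<^sub>w pad [] (vert a (b @ [x])) [x] = vert (a @ [x]) b"
proof -
  have V: "vert (a @ [x]) b \<in> Hom (a @ [x]) b" using assms by (intro Hom_vert) simp
  have "pad b (cape x) [] \<circ>\<^sub>w pad [] (vert a (b @ [x])) [x] =
    (pad b (cape x) [] \<circ>\<^sub>w pad [] (vert (a @ [x]) b) [x, x]) \<circ>\<^sub>w pad a (cupe x) [x]"
    by (simp add: turn_right[OF assms, symmetric] pad_comp wcomp_assoc)
  also have "\<dots> = vert (a @ [x]) b \<circ>\<^sub>w (pad (a @ [x]) (cape x) [] \<circ>\<^sub>w pad a (cupe x) [x])"
    using pad_commute[OF V Hom_cape[of x], of "[]" "[]" "[]"] by (simp add: wcomp_assoc[symmetric])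
  also have "pad (a @ [x]) (cape x) [] \<circ>\<^sub>w pad a (cupe x) [x] = pad a (id_web [x]) []"
    unfolding zigzag_left[symmetric] pad_comp by simp
  finally show ?thesis using comp_id[OF V] by simp
qed

lemma unturn_left:
  assumes "mset (a @ [x] @ b) = {#Single, Single, Double#}"
  shows "pad [] (cape x) b \<circ>\<^sub>w pad [x] (vert a (x # b)) [] = vert (x # a) b"
proof -
  have V: "vert (x # a) b \<in> Hom (x # a) b" using assms by (intro Hom_vert) simp
  have "pad [] (cape x) b \<circ>\<^sub>w pad [x] (vert a (x # b)) [] =
    (pad [] (cape x) b \<circ>\<^sub>w pad [x, x] (vert (x # a) b) []) \<circ>\<^sub>w pad [x] (cupe x) a"
    by (simp add: turn_left[OF assms, symmetric] pad_comp wcomp_assoc)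
  also have "\<dots> = vert (x # a) b \<circ>\<^sub>w (pad [] (cape x) (x # a) \<circ>\<^sub>w pad [x] (cupe x) a)"
    using pad_commute[OF Hom_cape[of x] V, of "[]" "[]" "[]"] by (simp add: wcomp_assoc[symmetric])
  also have "pad [] (cape x) (x # a) \<circ>\<^sub>w pad [x] (cupe x) a = pad [] (id_web [x]) a"
    unfolding zigzag_right[symmetric] pad_comp by simp
  finally show ?thesis using comp_id[OF V] by simp
qed

section \<open>The local relations as equations between composites\<close>

definition B :: scalar where "B = (qint 2)^2"
definition \<delta> :: scalar where "\<delta> = - (qint 6 * qint 2 / qint 3)"
text \<open>The scalar by which I acts when one strand on its side is closed by a neighbouring cup
  and cap: the square relation leaves a straight strand minus a loop.\<close>

definition \<kappa> :: scalar where "\<kappa> = 1 - \<delta>"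

lemma web_relator:
  "dg s D t - lc_scale c (dg s E t) \<in> relator \<Longrightarrow> web s D t = c *\<^sub>K web s E t"
  by (simp add: web.abs_eq scale_mor.abs_eq mor.abs_eq_iff null.relator)

lemma web_relator_zero: "dg s D t \<in> relator \<Longrightarrow> web s D t = 0"
  by (simp add: web.abs_eq zero_mor.abs_eq mor.abs_eq_iff null.relator)

lemma is_diagram_loops:
  "is_diagram [] [([], Cup x, []), ([], Cap x, [])] []"
  by (simp add: is_diagram.simps[of _ "_ # _"] is_diagram.simps[of _ "[]"])

lemma loop1: "cape Single \<circ>\<^sub>w cupe Single = \<delta> *\<^sub>K id_web []"
  using web_relator[OF relator.loop1] by (simp add: web_eval is_diagram_loops id_web_def \<delta>_def)

lemma monogon: "cape Single \<circ>\<^sub>w spl = 0"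
  using web_relator_zero[OF relator.monogon] by (simp add: web_eval is_diagram_local_webs)

lemma bigon: "mrg \<circ>\<^sub>w spl = - (B *\<^sub>K id_web [Double])"
  using web_relator[OF relator.bigon] by (simp add: web_eval is_diagram_local_webs id_web_def B_def)

lemma triangle: "pad [Double] mrg [] \<circ>\<^sub>w pad [] mrg [Single, Single] \<circ>\<^sub>w
    pad [Single] (cupe Single) [Single] \<circ>\<^sub>w spl = 0"
  using web_relator_zero[OF relator.triangle] by (simp add: web_eval is_diagram_local_webs)

definition II :: mor where "II = spl \<circ>\<^sub>w mrg"

abbreviation v12 :: mor where "v12 \<equiv> vert [Single] [Single, Double]"
abbreviation v21 :: mor where "v21 \<equiv> vert [Double, Single] [Single]"

lemma square:
  "pad [Single] v21 [] \<circ>\<^sub>w pad [] v12 [Single] =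
    II - cupe Single \<circ>\<^sub>w cape Single + id_web [Single, Single]"
proof -
  have U: "is_diagram [Single, Single] [([], Cap Single, []), ([], Cup Single, [])] [Single, Single]"
    by (simp add: is_diagram.simps[of _ "_ # _"] is_diagram.simps[of _ "[]"])
  have "abs_mor web_I - abs_mor web_J = abs_mor web_U - abs_mor web_V"
    using null.relator[OF relator.square] by (simp add: minus_mor.abs_eq mor.abs_eq_iff)
  moreover have "abs_mor web_I = II"
    "abs_mor web_J = pad [Single] v21 [] \<circ>\<^sub>w pad [] v12 [Single]"
    "abs_mor web_U = cupe Single \<circ>\<^sub>w cape Single" "abs_mor web_V = id_web [Single, Single]"
    by (simp_all add: web_I_def web_J_def web_U_def web_V_def web.abs_eq[symmetric] id_web_def
        web_eval is_diagram_local_webs U II_def)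
  ultimately show ?thesis by (simp add: algebra_simps)
qed

abbreviation ncaps :: mor where "ncaps \<equiv> cape Single \<circ>\<^sub>w pad [Single] (cape Single) [Single]"
abbreviation ncups :: mor where "ncups \<equiv> pad [Single] (cupe Single) [Single] \<circ>\<^sub>w cupe Single"

text \<open>Both sides are the vertex with all three legs pointing down. The left side reaches it
  from a merge by turning the double leg, the right side from a split by turning the two single
  legs. The next three lemmas are its reflections.\<close>

lemma cap_double_left: "cape Double \<circ>\<^sub>w pad [] mrg [Double] = ncaps \<circ>\<^sub>w pad [Single, Single] spl []"
proof -
  have "cape Double \<circ>\<^sub>w pad [] mrg [Double] = vert [Single, Single, Double] []"
    using unturn_right[of "[Single, Single]" Double "[]"] by simp
  moreover have "pad [] (cape Single) [Single] \<circ>\<^sub>w pad [Single] spl [] = vert [Single, Double] [Single]"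
    "cape Single \<circ>\<^sub>w pad [Single] (vert [Single, Double] [Single]) [] = vert [Single, Single, Double] []"
    using unturn_left[of "[Double]" Single "[Single]"] unturn_left[of "[Single, Double]" Single "[]"]
    by simp_all
  ultimately have "cape Double \<circ>\<^sub>w pad [] mrg [Double] =
    cape Single \<circ>\<^sub>w pad [Single] (pad [] (cape Single) [Single] \<circ>\<^sub>w pad [Single] spl []) []"
    by (simp only:)
  then show ?thesis by (simp add: pad_comp wcomp_assoc)
qed

lemma cap_double_right: "cape Double \<circ>\<^sub>w pad [Double] mrg [] = ncaps \<circ>\<^sub>w pad [] spl [Single, Single]"
proof -
  have "cape Double \<circ>\<^sub>w pad [Double] mrg [] = vert [Double, Single, Single] []"
    using unturn_left[of "[Single, Single]" Double "[]"] by simp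
  moreover have "pad [Single] (cape Single) [] \<circ>\<^sub>w pad [] spl [Single] = vert [Double, Single] [Single]"
    "cape Single \<circ>\<^sub>w pad [] (vert [Double, Single] [Single]) [Single] = vert [Double, Single, Single] []"
    using unturn_right[of "[Double]" Single "[Single]"] unturn_right[of "[Double, Single]" Single "[]"]
    by simp_all
  ultimately have "cape Double \<circ>\<^sub>w pad [Double] mrg [] =
    cape Single \<circ>\<^sub>w pad [] (pad [Single] (cape Single) [] \<circ>\<^sub>w pad [] spl [Single]) [Single]"
    by (simp only:)
  then show ?thesis by (simp add: pad_comp wcomp_assoc)
qed

lemma cup_double_left: "pad [] spl [Double] \<circ>\<^sub>w cupe Double = pad [Single, Single] mrg [] \<circ>\<^sub>w ncups"
proof -
  have "pad [] spl [Double] \<circ>\<^sub>w cupe Double = vert [] [Single, Single, Double]"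
    using turn_right[of "[]" Double "[Single, Single]"] by simp
  moreover have "pad [Single] mrg [] \<circ>\<^sub>w pad [] (cupe Single) [Single] = vert [Single] [Single, Double]"
    "pad [Single] (vert [Single] [Single, Double]) [] \<circ>\<^sub>w cupe Single = vert [] [Single, Single, Double]"
    using turn_left[of "[Single]" Single "[Double]"] turn_left[of "[]" Single "[Single, Double]"]
    by simp_all
  ultimately have "pad [] spl [Double] \<circ>\<^sub>w cupe Double =
    pad [Single] (pad [Single] mrg [] \<circ>\<^sub>w pad [] (cupe Single) [Single]) [] \<circ>\<^sub>w cupe Single"
    by (simp only:)
  then show ?thesis by (simp add: pad_comp wcomp_assoc)
qed

lemma cup_double_right: "pad [Double] spl [] \<circ>\<^sub>w cupe Double = pad [] mrg [Single, Single] \<circ>\<^sub>w ncups"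
proof -
  have "pad [Double] spl [] \<circ>\<^sub>w cupe Double = vert [] [Double, Single, Single]"
    using turn_left[of "[]" Double "[Single, Single]"] by simp
  moreover have "pad [] mrg [Single] \<circ>\<^sub>w pad [Single] (cupe Single) [] = vert [Single] [Double, Single]"
    "pad [] (vert [Single] [Double, Single]) [Single] \<circ>\<^sub>w cupe Single = vert [] [Double, Single, Single]"
    using turn_right[of "[Single]" Single "[Double]"] turn_right[of "[]" Single "[Double, Single]"]
    by simp_all
  ultimately have "pad [Double] spl [] \<circ>\<^sub>w cupe Double =
    pad [] (pad [] mrg [Single] \<circ>\<^sub>w pad [Single] (cupe Single) []) [Single] \<circ>\<^sub>w cupe Single"
    by (simp only:)
  then show ?thesis by (simp add: pad_comp wcomp_assoc)
qed

lemma comp_eq_assoc: "x \<circ>\<^sub>w y = z \<Longrightarrow> x \<circ>\<^sub>w (y \<circ>\<^sub>w w) = z \<circ>\<^sub>w w"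
  by (simp add: wcomp_assoc[symmetric])

text \<open>The monogon relation turned upside down. On a double cup the split becomes a merge on
  nested single cups, and the cap then joins the nested cups into one by a zigzag.\<close>

lemma monogon': "mrg \<circ>\<^sub>w cupe Single = 0"
proof -
  have 1: "pad [Double] (cape Single) [] \<circ>\<^sub>w pad [] mrg [Single, Single] = mrg \<circ>\<^sub>w pad [Single, Single] (cape Single) []"
    using pad_commute[OF Hom_mrg Hom_cape[of Single], of "[]" "[]" "[]"] by simp
  have 2: "pad [Single, Single] (cape Single) [] \<circ>\<^sub>w pad [Single] (cupe Single) [Single] = id_web [Single, Single]"
    using arg_cong[OF zigzag_left[of Single], of "\<lambda>x. pad [Single] x []"] by (simp add: pad_comp)
  have "0 = pad [Double] (cape Single \<circ>\<^sub>w spl) [] \<circ>\<^sub>w cupe Double"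
    by (simp add: monogon pad_linear)
  also have "\<dots> = pad [Double] (cape Single) [] \<circ>\<^sub>w (pad [] mrg [Single, Single] \<circ>\<^sub>w ncups)"
    by (simp only: pad_comp wcomp_assoc cup_double_right)
  also have "\<dots> = mrg \<circ>\<^sub>w (id_web [Single, Single] \<circ>\<^sub>w cupe Single)"
    by (simp add: wcomp_assoc 1[THEN comp_eq_assoc] 2[THEN comp_eq_assoc])
  finally show ?thesis by (simp add: id_comp[OF Hom_cupe])
qed

text \<open>The triangle with its upper left leg bent down by a double cap.
  \<open>cap_double_right\<close> trades the bent leg for nested single caps on a split, and a
  zigzag removes the cup of the original triangle.\<close>

lemma triangle': "mrg \<circ>\<^sub>w (pad [Single] (cape Single) [Single] \<circ>\<^sub>w (pad [] spl [Single, Single] \<circ>\<^sub>w pad [Double] spl [])) = 0"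
proof -
  have 1: "pad [] (cape Double) [Double] \<circ>\<^sub>w pad [Double, Double] mrg [] = mrg \<circ>\<^sub>w pad [] (cape Double) [Single, Single]"
    using pad_commute[OF Hom_cape[of Double] Hom_mrg, of "[]" "[]" "[]"] by simp
  have 2: "pad [] (cape Double) [Single, Single] \<circ>\<^sub>w pad [Double] mrg [Single, Single] =
      pad [] (cape Single) [Single, Single] \<circ>\<^sub>w (pad [Single] (cape Single) [Single, Single, Single] \<circ>\<^sub>w
      pad [] spl [Single, Single, Single, Single])"
    using arg_cong[OF cap_double_right, of "\<lambda>x. pad [] x [Single, Single]"] by (simp add: pad_comp wcomp_assoc)
  have 3: "pad [] spl [Single, Single, Single, Single] \<circ>\<^sub>w pad [Double, Single] (cupe Single) [Single] =
      pad [Single, Single, Single] (cupe Single) [Single] \<circ>\<^sub>w pad [] spl [Single, Single]"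
    using pad_commute[OF Hom_spl Hom_cupe[of Single], of "[]" "[Single]" "[Single]"] by simp
  have 4: "pad [Single] (cape Single) [Single, Single, Single] \<circ>\<^sub>w pad [Single, Single, Single] (cupe Single) [Single] =
      pad [Single] (cupe Single) [Single] \<circ>\<^sub>w pad [Single] (cape Single) [Single]"
    using pad_commute[OF Hom_cape[of Single] Hom_cupe[of Single], of "[Single]" "[]" "[Single]"] by simp
  have 5: "pad [] (cape Single) [Single, Single] \<circ>\<^sub>w pad [Single] (cupe Single) [Single] = id_web [Single, Single]"
    using arg_cong[OF zigzag_right[of Single], of "\<lambda>x. pad [] x [Single]"] by (simp add: pad_comp)
  have 6: "id_web [Single, Single] \<circ>\<^sub>w pad [Single] (cape Single) [Single] = pad [Single] (cape Single) [Single]"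
    using id_comp[OF Hom_pad[OF Hom_cape, of "[Single]" Single "[Single]"]] by simp
  have "0 = pad [] (cape Double) [Double] \<circ>\<^sub>w pad [Double] (pad [Double] mrg [] \<circ>\<^sub>w pad [] mrg [Single, Single] \<circ>\<^sub>w
    pad [Single] (cupe Single) [Single] \<circ>\<^sub>w spl) []"
    by (simp only: triangle) (simp add: pad_linear)
  also have "\<dots> = mrg \<circ>\<^sub>w (pad [Single] (cape Single) [Single] \<circ>\<^sub>w (pad [] spl [Single, Single] \<circ>\<^sub>w pad [Double] spl []))"
    by (simp add: pad_comp wcomp_assoc 1[THEN comp_eq_assoc] 2[THEN comp_eq_assoc] 3[THEN comp_eq_assoc]
      4[THEN comp_eq_assoc] 5[THEN comp_eq_assoc] 6[THEN comp_eq_assoc])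
  finally show ?thesis by simp
qed

section \<open>The triangle relation for I and J; operators at a given position\<close>

abbreviation (input) "S n \<equiv> replicate n Single"

lemma v12_eq: "v12 = pad [Single] mrg [] \<circ>\<^sub>w pad [] (cupe Single) [Single]"
  using turn_left[of "[Single]" Single "[Double]"] by simp

lemma v21_eq: "v21 = pad [Single] (cape Single) [] \<circ>\<^sub>w pad [] spl [Single]"
  using unturn_right[of "[Double]" Single "[Single]"] by simp

lemma Hom_v: "v12 \<in> Hom [Single] [Single, Double]" "v21 \<in> Hom [Double, Single] [Single]"
  by (simp_all add: Hom_vert)

definition JJ :: mor where "JJ = pad [Single] v21 [] \<circ>\<^sub>w pad [] v12 [Single]"

text \<open>The vertices of J and of the neighbouring I enclose a triangle of single edges. Writing
  \<open>v12\<close> as a merge on a cup and sliding disjoint vertices past each other exposes the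
  triangle web.\<close>

lemma IJI_left: "pad [] II [Single] \<circ>\<^sub>w (pad [Single] JJ [] \<circ>\<^sub>w pad [] II [Single]) = 0"
proof -
  have 1: "pad [] mrg [Single] \<circ>\<^sub>w pad [Single, Single] v21 [] = pad [Double] v21 [] \<circ>\<^sub>w pad [] mrg [Double, Single]"
    using pad_commute[OF Hom_mrg Hom_v(2), of "[]" "[]" "[]"] by simp
  have 2: "pad [] mrg [Double, Single] \<circ>\<^sub>w pad [Single, Single] mrg [Single] =
    pad [Double] mrg [Single] \<circ>\<^sub>w pad [] mrg [Single, Single, Single]"
    using pad_commute[OF Hom_mrg Hom_mrg, of "[]" "[]" "[Single]"] by simp
  have 3: "pad [Double] mrg [Single] \<circ>\<^sub>w (pad [] mrg [Single, Single, Single] \<circ>\<^sub>w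
    (pad [Single] (cupe Single) [Single, Single] \<circ>\<^sub>w pad [] spl [Single])) = 0"
    using arg_cong[OF triangle, of "\<lambda>x. pad [] x [Single]"] by (simp add: pad_comp pad_linear wcomp_assoc)
  have "pad [] mrg [Single] \<circ>\<^sub>w (pad [Single] JJ [] \<circ>\<^sub>w pad [] spl [Single]) = 0"
    by (simp add: JJ_def v12_eq pad_comp wcomp_assoc 1[THEN comp_eq_assoc] 2[THEN comp_eq_assoc] 3)
  \<comment> \<open>The composite vanishes already between the inner vertices of the two I; their
    outer split and merge are put back here.\<close>
  from comp_eq_assoc[OF this[THEN arg_cong[of _ _ "\<lambda>x. pad [] spl [Single] \<circ>\<^sub>w x"]], of "pad [] mrg [Single]"]
  show ?thesis by (simp add: II_def pad_comp wcomp_assoc)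
qed

text \<open>Here \<open>v21\<close>, a cap on a split, exposes the triangle with two legs at the
  bottom, hence \<open>triangle'\<close>.\<close>

lemma IJI_right: "pad [Single] II [] \<circ>\<^sub>w (pad [] JJ [Single] \<circ>\<^sub>w pad [Single] II []) = 0"
proof -
  have 1: "pad [] v12 [Single, Single] \<circ>\<^sub>w pad [Single] spl [] = pad [Single, Double] spl [] \<circ>\<^sub>w pad [] v12 [Double]"
    using pad_commute[OF Hom_v(1) Hom_spl, of "[]" "[]" "[]"] by simp
  have 3: "pad [Single] mrg [] \<circ>\<^sub>w (pad [Single, Single] (cape Single) [Single] \<circ>\<^sub>w
    (pad [Single] spl [Single, Single] \<circ>\<^sub>w (pad [Single, Double] spl [] \<circ>\<^sub>w x))) = 0" for x
    using arg_cong[OF triangle', of "\<lambda>y. pad [Single] y [] \<circ>\<^sub>w x"] by (simp add: pad_comp pad_linear wcomp_assoc)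
  have "pad [Single] mrg [] \<circ>\<^sub>w (pad [] JJ [Single] \<circ>\<^sub>w pad [Single] spl []) = 0"
    by (simp add: JJ_def v21_eq pad_comp wcomp_assoc 1 3)
  from comp_eq_assoc[OF this[THEN arg_cong[of _ _ "\<lambda>x. pad [Single] spl [] \<circ>\<^sub>w x"]], of "pad [Single] mrg []"]
  show ?thesis by (simp add: II_def pad_comp wcomp_assoc)
qed

lemma Hom_II: "II \<in> Hom [Single, Single] [Single, Single]"
  unfolding II_def by (intro Hom_comp[OF Hom_spl Hom_mrg])

lemma JJ_eq: "JJ = II - cupe Single \<circ>\<^sub>w cape Single + id_web [Single, Single]"
  unfolding JJ_def by (rule square)

lemma II_II: "II \<circ>\<^sub>w II = - (B *\<^sub>K II)"
proof -
  have "II \<circ>\<^sub>w II = spl \<circ>\<^sub>w ((mrg \<circ>\<^sub>w spl) \<circ>\<^sub>w mrg)" by (simp add: II_def wcomp_assoc)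
  also have "\<dots> = - (B *\<^sub>K (spl \<circ>\<^sub>w (id_web [Double] \<circ>\<^sub>w mrg)))" by (simp add: bigon)
  finally show ?thesis by (simp add: id_comp[OF Hom_mrg] II_def)
qed

text \<open>The operator \<open>x\<close> at position \<open>i\<close>, where \<open>m\<close> counts the strands that \<open>x\<close> does not touch.\<close>

definition op_at :: "mor \<Rightarrow> nat \<Rightarrow> nat \<Rightarrow> mor"
  where "op_at x m i = pad (S i) x (S (m - i))"

abbreviation "cI \<equiv> op_at II"
abbreviation "ccap \<equiv> op_at (cape Single)"
abbreviation "ccup \<equiv> op_at (cupe Single)"

lemma Hom_op_at: "x \<in> Hom (S a) (S b) \<Longrightarrow> i \<le> m \<Longrightarrow> op_at x m i \<in> Hom (S (m + a)) (S (m + b))"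
  using Hom_pad[of x "S a" "S b" "S i" "S (m - i)"]
  by (simp add: op_at_def replicate_add[symmetric] add.commute)

lemma pad_op_at: "i \<le> m \<Longrightarrow> pad (S a) (op_at x m i) (S b) = op_at x (a + m + b) (a + i)"
  by (simp add: op_at_def replicate_add[symmetric] add.commute)

lemma op_at_commute:
  assumes "x \<in> Hom (S a) (S b)" "y \<in> Hom (S c) (S d)" "i \<le> j" "j \<le> m"
  shows "op_at x (m + d) i \<circ>\<^sub>w op_at y (m + a) (j + a) = op_at y (m + b) (j + b) \<circ>\<^sub>w op_at x (m + c) i"
proof -
  obtain k l where kl: "j = i + k" "m = i + k + l" using assms(3,4) by (metis le_Suc_ex)
  show ?thesis
    using pad_commute[OF assms(1,2), of "S i" "S k" "S l"]
    by (simp add: kl op_at_def replicate_add[symmetric] ac_simps)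
qed

section \<open>Relations between operators on single strands\<close>

lemma Hom_S: "II \<in> Hom (S 2) (S 2)" "cape Single \<in> Hom (S 2) (S 0)" "cupe Single \<in> Hom (S 0) (S 2)"
  using Hom_II Hom_cape[of Single] Hom_cupe[of Single] by (simp_all add: numeral_2_eq_2)

lemma op_at_comp: "op_at (x \<circ>\<^sub>w y) m i = op_at x m i \<circ>\<^sub>w op_at y m i"
  by (simp add: op_at_def pad_comp)

lemma op_at_linear:
  "op_at (x + y) m i = op_at x m i + op_at y m i" "op_at (x - y) m i = op_at x m i - op_at y m i"
  "op_at (- x) m i = - op_at x m i" "op_at (c *\<^sub>K x) m i = c *\<^sub>K op_at x m i" "op_at 0 m i = 0"
  by (simp_all add: op_at_def pad_linear)

lemma Hom_ops:
  assumes "i \<le> m"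
  shows "cI m i \<in> Hom (S (m + 2)) (S (m + 2))" "ccap m i \<in> Hom (S (m + 2)) (S m)"
    "ccup m i \<in> Hom (S m) (S (m + 2))"
  using assms Hom_op_at[OF Hom_S(1)] Hom_op_at[OF Hom_S(2)] Hom_op_at[OF Hom_S(3)] by simp_all

lemma I_I: "cI m i \<circ>\<^sub>w cI m i = - (B *\<^sub>K cI m i)"
  by (simp add: op_at_comp[symmetric] II_II op_at_linear)

lemma cap_I: "ccap m i \<circ>\<^sub>w cI m i = 0"
  by (simp add: op_at_comp[symmetric] II_def comp_eq_assoc[OF monogon] op_at_linear)

lemma I_cup: "cI m i \<circ>\<^sub>w ccup m i = 0"
  by (simp add: op_at_comp[symmetric] II_def wcomp_assoc monogon' op_at_linear)

lemma op_at_id_Nil: "i \<le> m \<Longrightarrow> op_at (id_web []) m i = id_web (S m)"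
  by (simp add: op_at_def replicate_add[symmetric])

lemma cap_cup: "i \<le> m \<Longrightarrow> ccap m i \<circ>\<^sub>w ccup m i = \<delta> *\<^sub>K id_web (S m)"
  by (simp add: op_at_comp[symmetric] loop1 op_at_linear op_at_id_Nil)

lemma pad_1: "pad [] x [Single] = op_at x 1 0" "pad [Single] x [] = op_at x 1 1"
  by (simp_all add: op_at_def)

lemma zig_base: "ccap 1 0 \<circ>\<^sub>w ccup 1 1 = id_web (S 1)" "ccap 1 1 \<circ>\<^sub>w ccup 1 0 = id_web (S 1)"
  using zigzag_left[of Single] zigzag_right[of Single] by (simp_all add: pad_1)

lemma zig:
  assumes "i < m"
  shows "ccap m i \<circ>\<^sub>w ccup m (Suc i) = id_web (S m)" "ccap m (Suc i) \<circ>\<^sub>w ccup m i = id_web (S m)"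
proof -
  obtain j where m: "m = i + 1 + j" using assms by (metis less_iff_Suc_add add.assoc add.commute plus_1_eq_Suc)
  show "ccap m i \<circ>\<^sub>w ccup m (Suc i) = id_web (S m)"
    using arg_cong[OF zig_base(1), of "\<lambda>x. pad (S i) x (S j)"]
    by (simp only: pad_comp pad_op_at pad_id replicate_add[symmetric] m le0 order_refl) simp
  show "ccap m (Suc i) \<circ>\<^sub>w ccup m i = id_web (S m)"
    using arg_cong[OF zig_base(2), of "\<lambda>x. pad (S i) x (S j)"]
    by (simp only: pad_comp pad_op_at pad_id replicate_add[symmetric] m le0 order_refl) simp
qed

lemma I_I_commute: "i \<le> j \<Longrightarrow> j \<le> m \<Longrightarrow> cI (m + 2) (j + 2) \<circ>\<^sub>w cI (m + 2) i = cI (m + 2) i \<circ>\<^sub>w cI (m + 2) (j + 2)"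
  using op_at_commute[OF Hom_S(1,1)] by simp

lemma cap_I_commute:
  assumes "i \<le> j" "j \<le> m"
  shows "ccap (m + 2) i \<circ>\<^sub>w cI (m + 2) (j + 2) = cI m j \<circ>\<^sub>w ccap (m + 2) i"
    "ccap (m + 2) (j + 2) \<circ>\<^sub>w cI (m + 2) i = cI m i \<circ>\<^sub>w ccap (m + 2) (j + 2)"
  using op_at_commute[OF Hom_S(2,1) assms] op_at_commute[OF Hom_S(1,2) assms] by simp_all

lemma I_cup_commute:
  assumes "i \<le> j" "j \<le> m"
  shows "cI (m + 2) (j + 2) \<circ>\<^sub>w ccup (m + 2) i = ccup (m + 2) i \<circ>\<^sub>w cI m j"
    "cI (m + 2) i \<circ>\<^sub>w ccup (m + 2) (j + 2) = ccup (m + 2) (j + 2) \<circ>\<^sub>w cI m i"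
  using op_at_commute[OF Hom_S(3,1) assms] op_at_commute[OF Hom_S(1,3) assms] by simp_all

lemma cap_cup_commute:
  assumes "i \<le> j" "j \<le> m"
  shows "ccap (m + 2) i \<circ>\<^sub>w ccup (m + 2) (j + 2) = ccup m j \<circ>\<^sub>w ccap m i"
    "ccap (m + 2) (j + 2) \<circ>\<^sub>w ccup (m + 2) i = ccup m i \<circ>\<^sub>w ccap m j"
  using op_at_commute[OF Hom_S(2,3) assms] op_at_commute[OF Hom_S(3,2) assms] by simp_all

lemma cap_cap_commute:
  assumes "i \<le> j" "j \<le> m"
  shows "ccap m i \<circ>\<^sub>w ccap (m + 2) (j + 2) = ccap m j \<circ>\<^sub>w ccap (m + 2) i"
  using op_at_commute[OF Hom_S(2,2) assms] by simp

lemma cup_cup_commute: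
  assumes "i \<le> j" "j \<le> m"
  shows "ccup (m + 2) (j + 2) \<circ>\<^sub>w ccup m i = ccup (m + 2) i \<circ>\<^sub>w ccup m j"
  using op_at_commute[OF Hom_S(3,3) assms] by simp

text \<open>Both sides equal a double cap on two merges, with one merge carried across the double
  cap, where it becomes a split under nested single caps.\<close>

lemma rotate_I: "ccap 0 0 \<circ>\<^sub>w (ccap 2 1 \<circ>\<^sub>w cI 2 0) = ccap 0 0 \<circ>\<^sub>w (ccap 2 1 \<circ>\<^sub>w cI 2 2)"
proof -
  have 1: "pad [] mrg [Double] \<circ>\<^sub>w pad [Single, Single] mrg [] = pad [Double] mrg [] \<circ>\<^sub>w pad [] mrg [Single, Single]"
    using pad_commute[OF Hom_mrg Hom_mrg, of "[]" "[]" "[]"] by simp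
  have op2: "op_at x 2 0 = pad [] x [Single, Single]" "op_at x 2 2 = pad [Single, Single] x []"
    "op_at x 2 1 = pad [Single] x [Single]" for x
    by (simp_all add: op_at_def numeral_2_eq_2)
  have "ccap 0 0 \<circ>\<^sub>w (ccap 2 1 \<circ>\<^sub>w cI 2 0) = (ncaps \<circ>\<^sub>w pad [] spl [Single, Single]) \<circ>\<^sub>w pad [] mrg [Single, Single]"
    by (simp add: op2 II_def pad_comp wcomp_assoc) (simp add: op_at_def)
  also have "\<dots> = cape Double \<circ>\<^sub>w (pad [] mrg [Double] \<circ>\<^sub>w pad [Single, Single] mrg [])"
    by (simp only: cap_double_right[symmetric], simp only: wcomp_assoc 1)
  also have "\<dots> = (ncaps \<circ>\<^sub>w pad [Single, Single] spl []) \<circ>\<^sub>w pad [Single, Single] mrg []"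
    by (simp only: cap_double_left[symmetric], simp only: wcomp_assoc)
  also have "\<dots> = ccap 0 0 \<circ>\<^sub>w (ccap 2 1 \<circ>\<^sub>w cI 2 2)"
    by (simp add: op2 II_def pad_comp wcomp_assoc) (simp add: op_at_def)
  finally show ?thesis .
qed

text \<open>J is I after a quarter turn, with a cup on its left and a cap on its right. This removes
  the vertices from the square relation and leaves I, cups and caps.\<close>

lemma JJ_ops: "JJ = ccap 2 2 \<circ>\<^sub>w (cI 2 1 \<circ>\<^sub>w ccup 2 0)"
  by (simp add: JJ_def v12_eq v21_eq II_def op_at_def pad_comp wcomp_assoc numeral_2_eq_2)

lemma op_at_JJ_1: "op_at JJ 1 0 = ccap 3 2 \<circ>\<^sub>w (cI 3 1 \<circ>\<^sub>w ccup 3 0)"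
proof -
  have "pad (S 0) JJ (S 1) = pad (S 0) (ccap 2 2 \<circ>\<^sub>w (cI 2 1 \<circ>\<^sub>w ccup 2 0)) (S 1)"
    by (simp only: JJ_ops)
  then show ?thesis
    by (simp only: pad_comp pad_op_at) (simp add: op_at_def numeral_eq_Suc)
qed

text \<open>A cap over the rotated I forms nested caps, so \<open>rotate_I\<close> carries I to the
  other side; the cup left over from the rotation is straightened by a zigzag.\<close>

lemma cap_JJ: "ccap 1 0 \<circ>\<^sub>w cI 1 1 = ccap 1 1 \<circ>\<^sub>w op_at JJ 1 0"
proof -
  have N: "ccap 1 1 \<circ>\<^sub>w (ccap 3 2 \<circ>\<^sub>w cI 3 1) = ccap 1 1 \<circ>\<^sub>w (ccap 3 2 \<circ>\<^sub>w cI 3 3)"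
    using arg_cong[OF rotate_I, of "\<lambda>x. pad (S 1) x (S 0)"]
    by (simp only: pad_comp pad_op_at) (simp add: numeral_eq_Suc)
  have "ccap 1 1 \<circ>\<^sub>w op_at JJ 1 0 = (ccap 1 1 \<circ>\<^sub>w (ccap 3 2 \<circ>\<^sub>w cI 3 1)) \<circ>\<^sub>w ccup 3 0"
    by (simp add: op_at_JJ_1[simplified] wcomp_assoc)
  also have "\<dots> = ccap 1 1 \<circ>\<^sub>w (ccap 3 2 \<circ>\<^sub>w (cI 3 3 \<circ>\<^sub>w ccup 3 0))"
    by (simp only: N, simp only: wcomp_assoc)
  also have "cI 3 3 \<circ>\<^sub>w ccup 3 0 = ccup 3 0 \<circ>\<^sub>w cI 1 1"
    using I_cup_commute(1)[of 0 1 1] by (simp add: numeral_eq_Suc)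
  also have "ccap 3 2 \<circ>\<^sub>w (ccup 3 0 \<circ>\<^sub>w cI 1 1) = ccup 1 0 \<circ>\<^sub>w (ccap 1 0 \<circ>\<^sub>w cI 1 1)"
    using cap_cup_commute(2)[of 0 0 1, THEN comp_eq_assoc] by (simp add: numeral_eq_Suc wcomp_assoc)
  also have "ccap 1 1 \<circ>\<^sub>w (ccup 1 0 \<circ>\<^sub>w (ccap 1 0 \<circ>\<^sub>w cI 1 1)) = ccap 1 0 \<circ>\<^sub>w cI 1 1"
    using zig_base(2)[THEN comp_eq_assoc] id_comp[OF Hom_comp[OF Hom_ops(2)[of 0 1] Hom_ops(1)[of 1 1]]] by simp
  finally show ?thesis by simp
qed

lemma JJ_cup: "cI 1 1 \<circ>\<^sub>w ccup 1 0 = op_at JJ 1 0 \<circ>\<^sub>w ccup 1 1"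
proof -
  have "op_at JJ 1 0 \<circ>\<^sub>w ccup 1 1 = ccap 3 2 \<circ>\<^sub>w (cI 3 1 \<circ>\<^sub>w (ccup 3 0 \<circ>\<^sub>w ccup 1 1))"
    by (simp add: op_at_JJ_1[simplified] wcomp_assoc)
  also have "ccup 3 0 \<circ>\<^sub>w ccup 1 1 = ccup 3 3 \<circ>\<^sub>w ccup 1 0"
    using cup_cup_commute[of 0 1 1] by (simp add: numeral_eq_Suc)
  also have "cI 3 1 \<circ>\<^sub>w (ccup 3 3 \<circ>\<^sub>w ccup 1 0) = ccup 3 3 \<circ>\<^sub>w (cI 1 1 \<circ>\<^sub>w ccup 1 0)"
    using I_cup_commute(2)[of 1 1 1, THEN comp_eq_assoc] by (simp add: numeral_eq_Suc wcomp_assoc)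
  also have "ccap 3 2 \<circ>\<^sub>w (ccup 3 3 \<circ>\<^sub>w (cI 1 1 \<circ>\<^sub>w ccup 1 0)) = cI 1 1 \<circ>\<^sub>w ccup 1 0"
    using zig(1)[of 2 3, THEN comp_eq_assoc] id_comp[OF Hom_comp[OF Hom_ops(1)[of 1 1] Hom_ops(3)[of 0 1]]]
    by (simp add: numeral_eq_Suc)
  finally show ?thesis by simp
qed

lemma op_at_id_two: "i \<le> m \<Longrightarrow> op_at (id_web [Single, Single]) m i = id_web (S (m + 2))"
proof -
  assume "i \<le> m"
  then have "S i @ S 2 @ S (m - i) = S (m + 2)"
    by (simp only: replicate_add[symmetric]) simp
  moreover have "[Single, Single] = S 2" by (simp add: numeral_2_eq_2)
  ultimately show ?thesis by (simp only: op_at_def pad_id)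
qed

lemma op_at_JJ: "i \<le> m \<Longrightarrow> op_at JJ m i = cI m i - ccup m i \<circ>\<^sub>w ccap m i + id_web (S (m + 2))"
  by (simp add: op_at_id_two JJ_eq op_at_linear op_at_comp del: replicate_Suc)

text \<open>The square relation in the form used from here on. A cap on J is a cap on a neighbouring
  I, and expanding J turns its cup-cap part into a zigzag. So a cap beside an I moves over by one
  position at the price of bare caps.\<close>

lemma cap_R:
  assumes "i < m"
  shows "ccap m i \<circ>\<^sub>w cI m (Suc i) = ccap m (Suc i) \<circ>\<^sub>w cI m i + ccap m (Suc i) - ccap m i"
proof -
  obtain j where m: "m = i + 1 + j" using assms by (metis less_iff_Suc_add add.assoc add.commute plus_1_eq_Suc)
  have "ccap m i \<circ>\<^sub>w cI m (Suc i) = ccap m (Suc i) \<circ>\<^sub>w op_at JJ m i"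
    using arg_cong[OF cap_JJ, of "\<lambda>x. pad (S i) x (S j)"]
    by (simp only: pad_comp pad_op_at m le0 order_refl) simp
  also have "\<dots> = ccap m (Suc i) \<circ>\<^sub>w cI m i - (ccap m (Suc i) \<circ>\<^sub>w ccup m i) \<circ>\<^sub>w ccap m i + ccap m (Suc i)"
    using assms by (simp add: op_at_JJ comp_linear wcomp_assoc comp_id[OF Hom_ops(2)[of "Suc i" m], simplified])
  finally show ?thesis
    using assms by (simp add: zig id_comp[OF Hom_ops(2)[of i m]])
qed

lemma R_cup:
  assumes "i < m"
  shows "cI m (Suc i) \<circ>\<^sub>w ccup m i = cI m i \<circ>\<^sub>w ccup m (Suc i) + ccup m (Suc i) - ccup m i"
proof -
  obtain j where m: "m = i + 1 + j" using assms by (metis less_iff_Suc_add add.assoc add.commute plus_1_eq_Suc)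
  have "cI m (Suc i) \<circ>\<^sub>w ccup m i = op_at JJ m i \<circ>\<^sub>w ccup m (Suc i)"
    using arg_cong[OF JJ_cup, of "\<lambda>x. pad (S i) x (S j)"]
    by (simp only: pad_comp pad_op_at m le0 order_refl) simp
  also have "\<dots> = cI m i \<circ>\<^sub>w ccup m (Suc i) - ccup m i \<circ>\<^sub>w (ccap m i \<circ>\<^sub>w ccup m (Suc i)) + ccup m (Suc i)"
    using assms by (simp add: op_at_JJ comp_linear wcomp_assoc id_comp[OF Hom_ops(3)[of "Suc i" m], simplified])
  finally show ?thesis
    using assms by (simp add: zig comp_id[OF Hom_ops(3)[of i m]])
qed

text \<open>The triangle relation enters here: J is expanded in I J I = 0, and I squared is replaced
  by -B times I.\<close>

lemma I_I_I:
  assumes "i < m"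
  shows "cI m i \<circ>\<^sub>w (cI m (Suc i) \<circ>\<^sub>w cI m i) =
      B *\<^sub>K cI m i + cI m i \<circ>\<^sub>w (ccup m (Suc i) \<circ>\<^sub>w (ccap m (Suc i) \<circ>\<^sub>w cI m i))"
    and "cI m (Suc i) \<circ>\<^sub>w (cI m i \<circ>\<^sub>w cI m (Suc i)) =
      B *\<^sub>K cI m (Suc i) + cI m (Suc i) \<circ>\<^sub>w (ccup m i \<circ>\<^sub>w (ccap m i \<circ>\<^sub>w cI m (Suc i)))"
proof -
  obtain j where m: "m = i + 1 + j" using assms by (metis less_iff_Suc_add add.assoc add.commute plus_1_eq_Suc)
  have id: "id_web (S (m + 2)) \<circ>\<^sub>w cI m k = cI m k" if "k \<le> m" for k
    using id_comp[OF Hom_ops(1)] that by simp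
  have "cI m i \<circ>\<^sub>w (op_at JJ m (Suc i) \<circ>\<^sub>w cI m i) = 0"
    using arg_cong[OF IJI_left, of "\<lambda>x. pad (S i) x (S j)"] unfolding pad_1
    by (simp only: pad_comp pad_op_at m le0 order_refl pad_linear) simp
  then show "cI m i \<circ>\<^sub>w (cI m (Suc i) \<circ>\<^sub>w cI m i) =
      B *\<^sub>K cI m i + cI m i \<circ>\<^sub>w (ccup m (Suc i) \<circ>\<^sub>w (ccap m (Suc i) \<circ>\<^sub>w cI m i))"
    using assms id[of i] by (simp add: op_at_JJ comp_linear wcomp_assoc I_I algebra_simps)
  have "cI m (Suc i) \<circ>\<^sub>w (op_at JJ m i \<circ>\<^sub>w cI m (Suc i)) = 0"
    using arg_cong[OF IJI_right, of "\<lambda>x. pad (S i) x (S j)"] unfolding pad_1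
    by (simp only: pad_comp pad_op_at m le0 order_refl pad_linear) simp
  then show "cI m (Suc i) \<circ>\<^sub>w (cI m i \<circ>\<^sub>w cI m (Suc i)) =
      B *\<^sub>K cI m (Suc i) + cI m (Suc i) \<circ>\<^sub>w (ccup m i \<circ>\<^sub>w (ccap m i \<circ>\<^sub>w cI m (Suc i)))"
    using assms id[of "Suc i"] by (simp add: op_at_JJ comp_linear wcomp_assoc I_I algebra_simps)
qed

section \<open>Caps across several strands\<close>

lemma two_apart:
  assumes "i + 2 \<le> (j::nat)" "j \<le> m"
  obtains j' m' where "j = j' + 2" "m = m' + 2" "i \<le> j'" "j' \<le> m'"
  using that[of "j - 2" "m - 2"] assms by simp

lemmas cap_I_x = cap_I[THEN comp_eq_assoc, unfolded comp_zero]
lemmas I_cup_x = I_cup[THEN comp_eq_assoc, unfolded comp_zero]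
lemmas I_I_x = I_I[THEN comp_eq_assoc, unfolded comp_minus comp_scale_left]

lemma cap_R_x:
  "i < m \<Longrightarrow> ccap m i \<circ>\<^sub>w (cI m (Suc i) \<circ>\<^sub>w x) = ccap m (Suc i) \<circ>\<^sub>w (cI m i \<circ>\<^sub>w x) + ccap m (Suc i) \<circ>\<^sub>w x - ccap m i \<circ>\<^sub>w x"
  using cap_R[THEN comp_eq_assoc, of i m x] by (simp add: comp_linear wcomp_assoc)

lemma cap_R_x':
  "i < m \<Longrightarrow> ccap m (Suc i) \<circ>\<^sub>w (cI m i \<circ>\<^sub>w x) = ccap m i \<circ>\<^sub>w (cI m (Suc i) \<circ>\<^sub>w x) + ccap m i \<circ>\<^sub>w x - ccap m (Suc i) \<circ>\<^sub>w x"
  using cap_R_x[of i m x] by simp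

lemma R_cup_x:
  "i < m \<Longrightarrow> cI m (Suc i) \<circ>\<^sub>w (ccup m i \<circ>\<^sub>w x) = cI m i \<circ>\<^sub>w (ccup m (Suc i) \<circ>\<^sub>w x) + ccup m (Suc i) \<circ>\<^sub>w x - ccup m i \<circ>\<^sub>w x"
  using R_cup[THEN comp_eq_assoc, of i m x] by (simp add: comp_linear wcomp_assoc)

lemma R_cup_x':
  "i < m \<Longrightarrow> cI m i \<circ>\<^sub>w (ccup m (Suc i) \<circ>\<^sub>w x) = cI m (Suc i) \<circ>\<^sub>w (ccup m i \<circ>\<^sub>w x) + ccup m i \<circ>\<^sub>w x - ccup m (Suc i) \<circ>\<^sub>w x"
  using R_cup_x[of i m x] by simp

lemma I_I_I_x:
  assumes "i < m"
  shows "cI m i \<circ>\<^sub>w (cI m (Suc i) \<circ>\<^sub>w (cI m i \<circ>\<^sub>w x)) = B *\<^sub>K (cI m i \<circ>\<^sub>w x) +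
      cI m i \<circ>\<^sub>w (ccup m (Suc i) \<circ>\<^sub>w (ccap m (Suc i) \<circ>\<^sub>w (cI m i \<circ>\<^sub>w x)))"
    and "cI m (Suc i) \<circ>\<^sub>w (cI m i \<circ>\<^sub>w (cI m (Suc i) \<circ>\<^sub>w x)) = B *\<^sub>K (cI m (Suc i) \<circ>\<^sub>w x) +
      cI m (Suc i) \<circ>\<^sub>w (ccup m i \<circ>\<^sub>w (ccap m i \<circ>\<^sub>w (cI m (Suc i) \<circ>\<^sub>w x)))"
  using arg_cong[OF I_I_I(1)[OF assms], of "\<lambda>y. y \<circ>\<^sub>w x"] arg_cong[OF I_I_I(2)[OF assms], of "\<lambda>y. y \<circ>\<^sub>w x"]
  by (simp_all add: comp_linear wcomp_assoc)

lemma I_I_x_commute: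
  "i + 2 \<le> j \<Longrightarrow> j \<le> m \<Longrightarrow> cI m j \<circ>\<^sub>w (cI m i \<circ>\<^sub>w x) = cI m i \<circ>\<^sub>w (cI m j \<circ>\<^sub>w x)"
  by (erule (1) two_apart) (simp add: comp_eq_assoc[OF I_I_commute, simplified] wcomp_assoc)

lemma cap_I_x_commute:
  "i + 2 \<le> j \<Longrightarrow> j \<le> m \<Longrightarrow> ccap m i \<circ>\<^sub>w (cI m j \<circ>\<^sub>w x) = cI (m - 2) (j - 2) \<circ>\<^sub>w (ccap m i \<circ>\<^sub>w x)"
  "i + 2 \<le> j \<Longrightarrow> j \<le> m \<Longrightarrow> ccap m j \<circ>\<^sub>w (cI m i \<circ>\<^sub>w x) = cI (m - 2) i \<circ>\<^sub>w (ccap m j \<circ>\<^sub>w x)"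
  by (erule (1) two_apart, simp add: comp_eq_assoc[OF cap_I_commute(1), simplified]
      comp_eq_assoc[OF cap_I_commute(2), simplified] wcomp_assoc)+

lemma I_cup_x_commute:
  "i + 2 \<le> j \<Longrightarrow> j \<le> m \<Longrightarrow> cI m j \<circ>\<^sub>w (ccup m i \<circ>\<^sub>w x) = ccup m i \<circ>\<^sub>w (cI (m - 2) (j - 2) \<circ>\<^sub>w x)"
  "i + 2 \<le> j \<Longrightarrow> j \<le> m \<Longrightarrow> cI m i \<circ>\<^sub>w (ccup m j \<circ>\<^sub>w x) = ccup m j \<circ>\<^sub>w (cI (m - 2) i \<circ>\<^sub>w x)"
  by (erule (1) two_apart, simp add: comp_eq_assoc[OF I_cup_commute(1), simplified]
      comp_eq_assoc[OF I_cup_commute(2), simplified] wcomp_assoc)+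

lemma cap_cup_x_commute:
  "i + 2 \<le> j \<Longrightarrow> j \<le> m \<Longrightarrow> ccap m i \<circ>\<^sub>w (ccup m j \<circ>\<^sub>w x) = ccup (m - 2) (j - 2) \<circ>\<^sub>w (ccap (m - 2) i \<circ>\<^sub>w x)"
  "i + 2 \<le> j \<Longrightarrow> j \<le> m \<Longrightarrow> ccap m j \<circ>\<^sub>w (ccup m i \<circ>\<^sub>w x) = ccup (m - 2) i \<circ>\<^sub>w (ccap (m - 2) (j - 2) \<circ>\<^sub>w x)"
  by (erule (1) two_apart, simp add: comp_eq_assoc[OF cap_cup_commute(1), simplified]
      comp_eq_assoc[OF cap_cup_commute(2), simplified] wcomp_assoc)+

lemma zig_x:
  assumes "i < m" "x \<in> Hom s (S m)"
  shows "ccap m i \<circ>\<^sub>w (ccup m (Suc i) \<circ>\<^sub>w x) = x" "ccap m (Suc i) \<circ>\<^sub>w (ccup m i \<circ>\<^sub>w x) = x"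
  using assms by (simp_all add: wcomp_assoc[symmetric] zig id_comp)

lemma cap_cup_x:
  assumes "i \<le> m" "x \<in> Hom s (S m)"
  shows "ccap m i \<circ>\<^sub>w (ccup m i \<circ>\<^sub>w x) = \<delta> *\<^sub>K x"
  using assms by (simp add: wcomp_assoc[symmetric] cap_cup id_comp)

text \<open>\<open>chain m j d\<close> applies the \<open>d\<close> operators at the positions j, j + 1, \<dots>, bottom to top. Capping it at
  position \<open>j + d\<close> gives a cap that joins strand \<open>j\<close> with strand \<open>j + d + 1\<close>.\<close>

fun chain :: "nat \<Rightarrow> nat \<Rightarrow> nat \<Rightarrow> mor \<Rightarrow> mor" where
  "chain m j 0 x = x"
| "chain m j (Suc d) x = cI m (j + d) \<circ>\<^sub>w chain m j d x"

lemma chain_Suc: "chain m j (Suc d) x = chain m (Suc j) d (cI m j \<circ>\<^sub>w x)"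
  by (induction d) auto

lemma chain_add: "chain m j (d + e) x = chain m (j + d) e (chain m j d x)"
  by (induction e) (auto simp: ac_simps)

lemma chain_linear:
  "chain m j d (x + y) = chain m j d x + chain m j d y"
  "chain m j d (x - y) = chain m j d x - chain m j d y"
  "chain m j d (- x) = - chain m j d x"
  "chain m j d (c *\<^sub>K x) = c *\<^sub>K chain m j d x"
  "chain m j d 0 = 0"
  by (induction d) (auto simp: comp_linear)

lemma chain_I_above:
  "j + d < l \<Longrightarrow> l \<le> m \<Longrightarrow> chain m j d (cI m l \<circ>\<^sub>w x) = cI m l \<circ>\<^sub>w chain m j d x"
  by (induction d) (auto simp: I_I_x_commute[symmetric])

lemma chain_I_below:
  "l + 2 \<le> j \<Longrightarrow> j + d \<le> Suc m \<Longrightarrow> chain m j d (cI m l \<circ>\<^sub>w x) = cI m l \<circ>\<^sub>w chain m j d x"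
  by (induction d) (auto simp: I_I_x_commute)

lemma chain_chain:
  "i + e < j \<Longrightarrow> j + d \<le> Suc m \<Longrightarrow> chain m j d (chain m i e x) = chain m i e (chain m j d x)"
  by (induction e) (auto simp: chain_I_below)

lemma cap_chain:
  "j + d < l \<Longrightarrow> l \<le> m \<Longrightarrow> ccap m l \<circ>\<^sub>w chain m j d x = chain (m - 2) j d (ccap m l \<circ>\<^sub>w x)"
  by (induction d) (auto simp: cap_I_x_commute)

lemma chain_cup_above:
  "j + d < l \<Longrightarrow> l \<le> m \<Longrightarrow> chain m j d (ccup m l \<circ>\<^sub>w x) = ccup m l \<circ>\<^sub>w chain (m - 2) j d x"
  by (induction d) (auto simp: I_cup_x_commute)

lemma chain_cup_below:
  "l + 2 \<le> j \<Longrightarrow> j + d \<le> Suc m \<Longrightarrow> chain m j d (ccup m l \<circ>\<^sub>w x) = ccup m l \<circ>\<^sub>w chain (m - 2) (j - 2) d x"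
proof (induction d)
  case (Suc d)
  moreover have "j + d - 2 = j - 2 + d" using Suc.prems by simp
  ultimately show ?case by (auto simp: I_cup_x_commute)
qed simp

text \<open>Bare caps are not closed under \<open>cap_R\<close>, which makes the cap step back
  behind another I. Letting the chain have any length gives a family that is closed under moving
  past I and past cups.\<close>

definition wcap :: "nat \<Rightarrow> nat \<Rightarrow> nat \<Rightarrow> mor \<Rightarrow> mor"
  where "wcap m j d x = ccap m (j + d) \<circ>\<^sub>w chain m j d x"

lemma wcap_linear:
  "wcap m j d (x + y) = wcap m j d x + wcap m j d y"
  "wcap m j d (x - y) = wcap m j d x - wcap m j d y"
  "wcap m j d (- x) = - wcap m j d x"
  "wcap m j d (c *\<^sub>K x) = c *\<^sub>K wcap m j d x"
  "wcap m j d 0 = 0"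
  by (simp_all add: wcap_def chain_linear comp_linear)

lemma wcap_0 [simp]: "wcap m j 0 x = ccap m j \<circ>\<^sub>w x"
  by (simp add: wcap_def)

lemma wcap_Suc: "wcap m j (Suc d) x = wcap m (Suc j) d (cI m j \<circ>\<^sub>w x)"
  by (simp add: wcap_def chain_Suc del: chain.simps)

lemma wcap_add: "wcap m j (d + e) x = wcap m (j + d) e (chain m j d x)"
  by (simp add: wcap_def chain_add ac_simps)

lemma wcap_I_above:
  assumes "j + d + 2 \<le> l" "l \<le> m"
  shows "wcap m j d (cI m l \<circ>\<^sub>w x) = cI (m - 2) (l - 2) \<circ>\<^sub>w wcap m j d x"
  using assms by (simp add: wcap_def chain_I_above cap_I_x_commute)

lemma wcap_I_below:
  assumes "l + 2 \<le> j" "j + d \<le> m"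
  shows "wcap m j d (cI m l \<circ>\<^sub>w x) = cI (m - 2) l \<circ>\<^sub>w wcap m j d x"
  using assms by (simp add: wcap_def chain_I_below cap_I_x_commute)

lemma wcap_cup_above:
  assumes "j + d + 2 \<le> l" "l \<le> m"
  shows "wcap m j d (ccup m l \<circ>\<^sub>w x) = ccup (m - 2) (l - 2) \<circ>\<^sub>w wcap (m - 2) j d x"
  using assms by (simp add: wcap_def chain_cup_above cap_cup_x_commute)

lemma wcap_cup_below:
  assumes "l + 2 \<le> j" "j + d \<le> m"
  shows "wcap m j d (ccup m l \<circ>\<^sub>w x) = ccup (m - 2) l \<circ>\<^sub>w wcap (m - 2) (j - 2) d x"
proof -
  have "j + d - 2 = j - 2 + d" using assms by simp
  then show ?thesis using assms by (simp add: wcap_def chain_cup_below cap_cup_x_commute)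
qed

lemma cap_I_chain:
  assumes "j + e < m"
  shows "ccap m (j + e) \<circ>\<^sub>w (cI m (Suc (j + e)) \<circ>\<^sub>w chain m j e x) =
    wcap m j (Suc e) x + chain (m - 2) j e (ccap m (Suc (j + e)) \<circ>\<^sub>w x) - wcap m j e x"
  using assms cap_chain[of j e "Suc (j + e)" m x] by (simp add: cap_R_x wcap_def)

lemma wcap_I_end:
  assumes "j + d < m"
  shows "wcap m j d (cI m (Suc (j + d)) \<circ>\<^sub>w x) =
    wcap m j (Suc d) x + chain (m - 2) j d (ccap m (Suc (j + d)) \<circ>\<^sub>w x) - wcap m j d x"
  using assms cap_I_chain[OF assms] by (simp add: wcap_def chain_I_above)

text \<open>The new I sits right under the cap's position. After \<open>cap_R\<close> it meets a
  second copy of itself, giving -B, or stands alone, giving 1; the remaining term, a cap directly on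
  I, is zero.\<close>

lemma wcap_I_last:
  assumes "j + e < m"
  shows "wcap m j (Suc e) (cI m (Suc (j + e)) \<circ>\<^sub>w x) =
    (1 - B) *\<^sub>K (wcap m j (Suc e) x + chain (m - 2) j e (ccap m (Suc (j + e)) \<circ>\<^sub>w x) - wcap m j e x)"
  using assms cap_I_chain[OF assms, symmetric]
  by (simp add: wcap_def chain_I_above cap_R_x' I_I_x cap_I_x comp_linear mor.scale_left_diff_distrib)

lemma chain_Hom:
  "x \<in> Hom s (S m) \<Longrightarrow> j + d < m \<Longrightarrow> chain (m - 2) j d x \<in> Hom s (S m)"
proof (induction d)
  case (Suc d)
  \<comment> \<open>A nonempty chain forces m to be at least 2, so the truncated subtraction is
    exact.\<close>
  then have "m - 2 + 2 = m" by simp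
  then show ?case
    using Suc Hom_comp[OF Hom_ops(1)[of "j + d" "m - 2"], of "chain (m - 2) j d x" s] by (simp only:) simp
qed simp

lemma wcap_cup_last:
  assumes "j + e < m" "x \<in> Hom s (S m)"
  shows "wcap m j (Suc e) (ccup m (Suc (j + e)) \<circ>\<^sub>w x) = \<kappa> *\<^sub>K chain (m - 2) j e x"
proof -
  have "chain (m - 2) j e x \<in> Hom s (S m)"
    using assms by (intro chain_Hom) auto
  then show ?thesis
    using assms by (simp add: wcap_def chain_cup_above cap_R_x' I_cup_x zig_x cap_cup_x \<kappa>_def
        mor.scale_left_diff_distrib)
qed

lemma wcap_cup_end:
  assumes "j + d < m" "x \<in> Hom s (S m)"
  shows "wcap m j d (ccup m (Suc (j + d)) \<circ>\<^sub>w x) = chain (m - 2) j d x"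
proof -
  have "chain (m - 2) j d x \<in> Hom s (S m)"
    using assms by (intro chain_Hom) auto
  then show ?thesis
    using assms by (simp add: wcap_def chain_cup_above zig_x)
qed

section \<open>The action on a half-diagram\<close>

lemma q_half_power: "q_half ^ k = Fract ([:0, 1:] ^ k) 1"
  by (induction k) (simp_all add: q_half_def One_fract_def)

lemma q_half_power_neq_1: "k > 0 \<Longrightarrow> q_half ^ k \<noteq> 1"
proof
  assume "k > 0" "q_half ^ k = 1"
  then have "[:0, 1::complex:] ^ k = 1" by (simp add: q_half_power One_fract_def eq_fract)
  moreover have "poly ([:0, 1::complex:] ^ k) 0 = 0" using \<open>k > 0\<close> by (simp add: poly_power)
  ultimately show False by simp
qed

lemma q_half_neq_0: "q_half \<noteq> 0"
  using q_half_power_neq_1[of 1] by (auto simp: q_half_def Zero_fract_def eq_fract)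

lemma q_half_powi_neq: "k > 0 \<Longrightarrow> q_half powi k \<noteq> q_half powi (- k)"
proof
  assume "k > 0" and e: "q_half powi k = q_half powi (- k)"
  have "q_half powi (k + k) = q_half powi k * q_half powi k"
    by (rule power_int_add) (simp add: q_half_neq_0)
  also have "\<dots> = q_half powi (- k) * q_half powi k" by (simp only: e)
  also have "\<dots> = 1" using q_half_neq_0 by (simp add: power_int_minus)
  finally have "q_half ^ nat (k + k) = 1" using \<open>k > 0\<close> by (simp add: power_int_def)
  then show False using q_half_power_neq_1[of "nat (k + k)"] \<open>k > 0\<close> by simp
qed

lemma qint_neq_0: "k > 0 \<Longrightarrow> qint k \<noteq> 0"
  using q_half_powi_neq[of k] q_half_powi_neq[of 1] by (simp add: qint_def)

lemma B_neq_0 [simp]: "B \<noteq> 0"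
  by (simp add: B_def qint_neq_0)

text \<open>In \<open>span_ops N Z t x\<close> the numbers \<open>N\<close> and \<open>t\<close> count the single strands at the top of \<open>Z\<close> and \<open>x\<close>.\<close>

inductive span_ops :: "nat \<Rightarrow> mor \<Rightarrow> nat \<Rightarrow> mor \<Rightarrow> bool" for N Z where
  base: "span_ops N Z N Z"
| zero: "span_ops N Z t 0"
| add: "span_ops N Z t x \<Longrightarrow> span_ops N Z t y \<Longrightarrow> span_ops N Z t (x + y)"
| scale: "span_ops N Z t x \<Longrightarrow> span_ops N Z t (c *\<^sub>K x)"
| I: "span_ops N Z (m + 2) x \<Longrightarrow> i \<le> m \<Longrightarrow> span_ops N Z (m + 2) (cI m i \<circ>\<^sub>w x)"
| cup: "span_ops N Z m x \<Longrightarrow> i \<le> m \<Longrightarrow> span_ops N Z (m + 2) (ccup m i \<circ>\<^sub>w x)"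

text \<open>\<open>Z\<close> stands for the image of \<open>G\<close> on single strands. The last
  two assumptions imitate n adjacent cups: \<open>- I / [2]\<close> on each pair acts by the
  Temperley-Lieb loop value [2], and actual caps act by zero.\<close>

locale cup_diagram =
  fixes n :: nat and s :: word and Z :: mor
  assumes Hom_Z: "Z \<in> Hom s (S (2 * n))"
    and I_Z: "\<And>i. i < n \<Longrightarrow> cI (2 * n - 2) (2 * i) \<circ>\<^sub>w Z = - (B *\<^sub>K Z)"
    and cap_Z: "\<And>j. j + 2 \<le> 2 * n \<Longrightarrow> ccap (2 * n - 2) j \<circ>\<^sub>w Z = 0"
begin

abbreviation M :: "nat \<Rightarrow> mor \<Rightarrow> bool" where "M \<equiv> span_ops (2 * n) Z"

lemma M_uminus: "M t x \<Longrightarrow> M t (- x)"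
  using span_ops.scale[of "2 * n" Z t x "- 1"] by simp

lemma M_diff: "M t x \<Longrightarrow> M t y \<Longrightarrow> M t (x - y)"
  using span_ops.add[of "2 * n" Z t x "- y"] M_uminus by simp

lemmas M_closed = span_ops.zero span_ops.add span_ops.scale M_uminus M_diff

lemma M_I: "M t x \<Longrightarrow> i + 2 \<le> t \<Longrightarrow> M t (cI (t - 2) i \<circ>\<^sub>w x)"
proof -
  assume "M t x" "i + 2 \<le> t"
  moreover from this have "t - 2 + 2 = t" by simp
  ultimately show ?thesis using span_ops.I[of "2 * n" Z "t - 2" x i] by (simp only:)
qed

lemma M_cup: "M t x \<Longrightarrow> i \<le> t \<Longrightarrow> M (Suc (Suc t)) (ccup t i \<circ>\<^sub>w x)"
  using span_ops.cup[of "2 * n" Z t x i] by simp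

lemma M_cup': "M (t - 2) x \<Longrightarrow> i + 2 \<le> t \<Longrightarrow> M t (ccup (t - 2) i \<circ>\<^sub>w x)"
proof -
  assume "M (t - 2) x" "i + 2 \<le> t"
  moreover from this have "t - 2 + 2 = t" by simp
  ultimately show ?thesis using span_ops.cup[of "2 * n" Z "t - 2" x i] by (simp only:)
qed

lemma M_chain: "M t x \<Longrightarrow> j + d < t \<Longrightarrow> M t (chain (t - 2) j d x)"
  by (induction d) (auto intro: M_I)

lemma M_Hom: "M t x \<Longrightarrow> x \<in> Hom s (S t)"
proof (induction rule: span_ops.induct)
  case (I m x i)
  then show ?case using Hom_comp[OF Hom_ops(1)] by simp
next
  case (cup m x i)
  then show ?case using Hom_comp[OF Hom_ops(3)] by simp
qed (auto simp: Hom_Z Hom_closed)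

text \<open>The second operator undoes the nesting that the first creates. The triple relation is
  applied to \<open>Z\<close>, an eigenvector of its first factor; the cap term dies because caps
  kill \<open>Z\<close>.\<close>

lemma I_I_Z:
  assumes "Suc i < n"
  shows "cI (2 * n - 2) (Suc (Suc (2 * i))) \<circ>\<^sub>w (cI (2 * n - 2) (Suc (2 * i)) \<circ>\<^sub>w Z) = B *\<^sub>K Z"
proof -
  let ?m = "2 * n - 2" and ?j = "Suc (2 * i)"
  have I: "cI ?m (Suc ?j) \<circ>\<^sub>w Z = - (B *\<^sub>K Z)" using I_Z[of "Suc i"] assms by simp
  have c: "ccap ?m ?j \<circ>\<^sub>w Z = 0" using assms by (intro cap_Z) simp
  have "?j < ?m" using assms by simp
  from I_I_I_x(2)[OF this, of Z]
  have "- (B *\<^sub>K (cI ?m (Suc ?j) \<circ>\<^sub>w (cI ?m ?j \<circ>\<^sub>w Z))) = - (B *\<^sub>K (B *\<^sub>K Z))"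
    by (simp add: I c)
  then show ?thesis by (simp only: neg_equal_iff_equal mor.scale_cancel_left) simp
qed

text \<open>A chain starting at an even position begins with a scalar; one starting at an odd
  position loses its first two operators by \<open>I_I_Z\<close>. This drop by two is why the
  induction is strong. The chain of length one at an odd position is left over and turns into caps
  on \<open>Z\<close> by \<open>cap_R\<close>.\<close>

lemma wcap_Z: "j + d + 2 \<le> 2 * n \<Longrightarrow> wcap (2 * n - 2) j d Z = 0"
proof (induction d arbitrary: j rule: less_induct)
  case (less d)
  show ?case
  proof (cases d)
    case 0
    then show ?thesis using less.prems by (simp add: cap_Z)
  next
    case (Suc e)
    show ?thesis
    proof (cases "even j")
      case True
      then obtain i where "j = 2 * i" by blast
      then have "cI (2 * n - 2) j \<circ>\<^sub>w Z = - (B *\<^sub>K Z)" using I_Z[of i] less.prems by simp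
      then show ?thesis using less.IH[of e "Suc j"] less.prems Suc by (simp add: wcap_Suc wcap_linear)
    next
      case False
      then obtain i where j: "j = Suc (2 * i)" by (auto elim: oddE)
      show ?thesis
      proof (cases e)
        case 0
        have "cI (2 * n - 2) (Suc j) \<circ>\<^sub>w Z = - (B *\<^sub>K Z)" using I_Z[of "Suc i"] less.prems Suc j by simp
        moreover have "ccap (2 * n - 2) j \<circ>\<^sub>w Z = 0" "ccap (2 * n - 2) (Suc j) \<circ>\<^sub>w Z = 0"
          using less.prems Suc by (simp_all add: cap_Z)
        moreover have "j < 2 * n - 2" using less.prems Suc by simp
        ultimately show ?thesis
          by (simp add: Suc 0 wcap_Suc cap_R_x')
      next
        case e: (Suc e')
        have "Suc i < n" using less.prems Suc e j by simp
        from I_I_Z[OF this] show ?thesis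
          using less.IH[of e' "Suc (Suc j)"] less.prems Suc e by (simp add: wcap_Suc wcap_linear j)
      qed
    qed
  qed
qed

text \<open>The cup overlaps the first strand of the long cap. The first I of the chain meets the
  cup, and \<open>R_cup\<close> moves the cup one step right, where the chain is shorter; the term
  in which the cup stays is disjoint from the shortened cap, and \<open>H\<close> applies beneath
  it.\<close>

lemma M_wcap_cup_below_end:
  assumes H: "\<And>z j d. M t z \<Longrightarrow> j + d + 2 \<le> t \<Longrightarrow> M (t - 2) (wcap (t - 2) j d z)"
  shows "M t z \<Longrightarrow> j + d < t \<Longrightarrow> M t (wcap t (Suc j) d (ccup t j \<circ>\<^sub>w z))"
proof (induction d arbitrary: j z)
  case 0
  then show ?case using zig_x(2)[OF _ M_Hom[OF 0(1)], of j] by simp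
next
  case (Suc d)
  have 1: "M t (wcap t (Suc (Suc j)) d (ccup t (Suc j) \<circ>\<^sub>w z))" using Suc by simp
  have "wcap t (Suc (Suc j)) d (cI t j \<circ>\<^sub>w (ccup t (Suc j) \<circ>\<^sub>w z)) =
    cI (t - 2) j \<circ>\<^sub>w wcap t (Suc (Suc j)) d (ccup t (Suc j) \<circ>\<^sub>w z)"
    using Suc.prems by (intro wcap_I_below) auto
  then have 2: "M t (wcap t (Suc (Suc j)) d (cI t j \<circ>\<^sub>w (ccup t (Suc j) \<circ>\<^sub>w z)))"
    using M_I[OF 1, of j] Suc.prems by simp
  have "wcap t (Suc (Suc j)) d (ccup t j \<circ>\<^sub>w z) = ccup (t - 2) j \<circ>\<^sub>w wcap (t - 2) j d z"
    using Suc.prems wcap_cup_below[of j "Suc (Suc j)" d t z] by simp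
  then have 3: "M t (wcap t (Suc (Suc j)) d (ccup t j \<circ>\<^sub>w z))"
    using Suc.prems M_cup'[OF H[OF Suc.prems(1), of j d]] by simp
  show ?case
    using Suc.prems 1 2 3 by (simp add: wcap_Suc R_cup_x wcap_linear M_closed)
qed

text \<open>The assumption is the claim for fewer strands; it is discharged by induction in \<open>M_wcap\<close>.\<close>

lemma M_wcap_cup:
  assumes H: "\<And>z j d. M t z \<Longrightarrow> j + d + 2 \<le> t \<Longrightarrow> M (t - 2) (wcap (t - 2) j d z)"
    and z: "M t z" and "j + d \<le> t" "l \<le> t"
  shows "M t (wcap t j d (ccup t l \<circ>\<^sub>w z))"
proof -
  \<comment> \<open>The long cap joins strands \<open>j\<close> and \<open>j + d + 1\<close>. The
    cup lies to its right, overlaps its right end in one of two ways, lies strictly inside, overlaps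
    its left end in one of two ways, or lies to its left.\<close>
  consider "j + d + 2 \<le> l" | "l = Suc (j + d)" | "l = j + d" | e f where "l = Suc (j + e)" "d = Suc (Suc (e + f))"
    | e where "l = j" "d = Suc e" | "j = Suc l" | "l + 2 \<le> j"
  proof -
    have "\<exists>e f. l = Suc (j + e) \<and> d = Suc (Suc (e + f))" if "j < l" "l < j + d"
      by (rule exI[of _ "l - j - 1"], rule exI[of _ "d + j - l - 1"]) (use that in auto)
    moreover have "\<exists>e. d = Suc e" if "l = j" "l \<noteq> j + d" using that by (cases d) auto
    ultimately show ?thesis using that by (metis Suc_leI add_2_eq_Suc' le_neq_implies_less linorder_less_linear
      not_less_eq_eq)
  qed
  then show ?thesis
  proof cases
    case 1
    then show ?thesis
      using assms by (simp add: wcap_cup_above M_cup' H)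
  next
    case 2
    then show ?thesis
      using assms wcap_cup_end[of j d t z s] M_Hom[OF z] M_chain[OF z, of j d] by simp
  next
    case 3
    show ?thesis
    proof (cases d)
      case 0
      then show ?thesis using 3 assms cap_cup_x[OF _ M_Hom[OF z], of j] by (simp add: M_closed)
    next
      case (Suc e)
      then show ?thesis
        using 3 assms wcap_cup_last[of j e t z s] M_Hom[OF z] M_chain[OF z, of j e] by (simp add: M_closed)
    qed
  next
    case (4 e f)
    let ?y = "chain t j e (ccup t l \<circ>\<^sub>w z)" and ?z = "chain (t - 2) j e z"
    have z': "M t ?z" using z assms 4 by (intro M_chain) auto
    have y: "?y = ccup t l \<circ>\<^sub>w ?z" using assms 4 by (intro chain_cup_above) auto
    have "wcap t j d (ccup t l \<circ>\<^sub>w z) = wcap t (j + e) (Suc (Suc f)) ?y"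
      using 4 wcap_add[of t j e "Suc (Suc f)" "ccup t l \<circ>\<^sub>w z"] by simp
    also have "\<dots> = wcap t (Suc l) f (cI t l \<circ>\<^sub>w (cI t (j + e) \<circ>\<^sub>w (ccup t l \<circ>\<^sub>w ?z)))"
      by (simp add: wcap_Suc y) (simp add: 4)
    \<comment> \<open>\<open>R_cup\<close> moves the cup one step left. I squared contributes -B,
      the bare cup 1, and the I directly on its own cup 0. The cup then sits at the left end of the
      remaining chain.\<close>
    also have "cI t l \<circ>\<^sub>w (cI t (j + e) \<circ>\<^sub>w (ccup t l \<circ>\<^sub>w ?z)) = (1 - B) *\<^sub>K (cI t l \<circ>\<^sub>w (ccup t (j + e) \<circ>\<^sub>w ?z))"
      using assms 4 by (simp add: R_cup_x' comp_linear I_I_x I_cup_x mor.scale_left_diff_distrib)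
    also have "wcap t (Suc l) f \<dots> = (1 - B) *\<^sub>K wcap t (Suc (j + e)) (Suc f) (ccup t (j + e) \<circ>\<^sub>w ?z)"
      using 4 by (simp add: wcap_Suc wcap_linear)
    finally show ?thesis
      using M_wcap_cup_below_end[OF H z', of "j + e" "Suc f"] assms 4 by (simp add: M_closed)
  next
    case (5 e)
    then show ?thesis using assms by (simp add: wcap_Suc I_cup_x wcap_linear M_closed)
  next
    case 6
    then show ?thesis using M_wcap_cup_below_end[OF H z, of l d] assms by simp
  next
    case 7
    then show ?thesis
      using assms by (simp add: wcap_cup_below M_cup' H)
  qed
qed

text \<open>The case split is the one for cups. By \<open>x\<close>, all long caps of the old
  element are known to lie in the span, and every case but the interior one reduces to them.\<close>

lemma M_wcap_I:
  assumes H: "\<And>z j d. M t z \<Longrightarrow> j + d + 2 \<le> t \<Longrightarrow> M (t - 2) (wcap (t - 2) j d z)"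
    and x: "\<And>j d. j + d \<le> t \<Longrightarrow> M t (wcap t j d x)" and jd: "j + d \<le> t" and l: "l \<le> t"
  shows "M t (wcap t j d (cI t l \<circ>\<^sub>w x))"
proof -
  have cap: "M t (ccap t i \<circ>\<^sub>w x)" if "i \<le> t" for i using x[of i 0] that by simp
  consider "j + d + 2 \<le> l" | "l = Suc (j + d)" | "l = j + d" | e f where "l = Suc (j + e)" "d = Suc (Suc (e + f))"
    | e where "l = j" "d = Suc e" | "j = Suc l" | "l + 2 \<le> j"
  proof -
    have "\<exists>e f. l = Suc (j + e) \<and> d = Suc (Suc (e + f))" if "j < l" "l < j + d"
      by (rule exI[of _ "l - j - 1"], rule exI[of _ "d + j - l - 1"]) (use that in auto)
    moreover have "\<exists>e. d = Suc e" if "l = j" "l \<noteq> j + d" using that by (cases d) auto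
    ultimately show ?thesis using that by (metis Suc_leI add_2_eq_Suc' le_neq_implies_less linorder_less_linear
      not_less_eq_eq)
  qed
  then show ?thesis
  proof cases
    case 1
    then show ?thesis using l x[OF jd] by (simp add: wcap_I_above M_I)
  next
    case 2
    then show ?thesis
      using l wcap_I_end[of j d t x] x[of j "Suc d"] x[of j d] M_chain[OF cap, of "Suc (j + d)" j d]
      by (simp add: M_closed)
  next
    case 3
    show ?thesis
    proof (cases d)
      case 0
      then show ?thesis using 3 by (simp add: cap_I_x M_closed)
    next
      case (Suc e)
      then show ?thesis
        using 3 l wcap_I_last[of j e t x] x[of j "Suc e"] x[of j e] M_chain[OF cap, of "Suc (j + e)" j e]
        by (simp add: M_closed)
    qed
  next
    case (4 e f)
    let ?y = "chain t j e x" and ?i = "j + e"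
    have y: "chain t j e (cI t l \<circ>\<^sub>w x) = cI t l \<circ>\<^sub>w ?y" using jd l 4 by (intro chain_I_above) auto
    \<comment> \<open>The triple relation used below creates a cup whose argument is this capped
      element. \<open>cap_I_chain\<close> shows that the argument lies in the span, so the cup can
      be treated by \<open>M_wcap_cup_below_end\<close>.\<close>
    have z: "M t (ccap t ?i \<circ>\<^sub>w (cI t l \<circ>\<^sub>w ?y))"
      using cap_I_chain[of j e t x] jd 4 x[of j "Suc e"] x[of j e] M_chain[OF cap, of l j e]
      by (simp add: M_closed)
    have "wcap t j d (cI t l \<circ>\<^sub>w x) = wcap t ?i (Suc (Suc f)) (cI t l \<circ>\<^sub>w ?y)"
      using wcap_add[of t j e "Suc (Suc f)" "cI t l \<circ>\<^sub>w x"] by (simp only: y 4(2) add_Suc_right)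
    also have "\<dots> = wcap t (Suc l) f (cI t l \<circ>\<^sub>w (cI t ?i \<circ>\<^sub>w (cI t l \<circ>\<^sub>w ?y)))"
      by (simp add: wcap_Suc 4)
    also have "cI t l \<circ>\<^sub>w (cI t ?i \<circ>\<^sub>w (cI t l \<circ>\<^sub>w ?y)) = B *\<^sub>K (cI t l \<circ>\<^sub>w ?y) +
        cI t l \<circ>\<^sub>w (ccup t ?i \<circ>\<^sub>w (ccap t ?i \<circ>\<^sub>w (cI t l \<circ>\<^sub>w ?y)))"
      using I_I_I_x(2)[of ?i t ?y] jd 4 by simp
    also have "wcap t (Suc l) f \<dots> = B *\<^sub>K wcap t l (Suc f) ?y +
        wcap t l (Suc f) (ccup t ?i \<circ>\<^sub>w (ccap t ?i \<circ>\<^sub>w (cI t l \<circ>\<^sub>w ?y)))"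
      by (simp add: wcap_Suc wcap_linear)
    also have "wcap t l (Suc f) ?y = chain (t - 2) j e (wcap t l (Suc f) x)"
      using jd 4 cap_chain[of j e "l + Suc f" t "chain t l (Suc f) x"]
      by (simp add: wcap_def chain_chain del: chain.simps)
    finally show ?thesis
      using M_wcap_cup_below_end[OF H z, of "j + e" "Suc f"] jd 4 x[of l "Suc f"]
        M_chain[of t "wcap t l (Suc f) x" j e] by (simp add: M_closed)
  next
    case (5 e)
    then show ?thesis using x[of "Suc j" e] x[OF jd] jd by (simp add: wcap_Suc I_I_x wcap_linear M_closed)
  next
    case 6
    then show ?thesis using x[of l "Suc d"] jd by (simp add: wcap_Suc)
  next
    case 7
    then show ?thesis using x[OF jd] jd by (simp add: wcap_I_below M_I)
  qed
qed

text \<open>The outer induction is on the number of strands, because what lies beneath a cup has two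
  strands fewer and may have to be capped in turn. The inner induction follows the generation of
  \<open>x\<close>.\<close>

lemma M_wcap: "M t x \<Longrightarrow> j + d + 2 \<le> t \<Longrightarrow> M (t - 2) (wcap (t - 2) j d x)"
proof (induction t arbitrary: x j d rule: less_induct)
  case (less t)
  have "M t' x \<Longrightarrow> t' = t \<Longrightarrow> j + d + 2 \<le> t' \<Longrightarrow> M (t' - 2) (wcap (t' - 2) j d x)" for t' x j d
  proof (induction arbitrary: j d rule: span_ops.induct)
    case base
    show ?case by (simp only: wcap_Z[OF base(2)] span_ops.zero)
  next
    case (I m x i)
    have "M m (wcap m j d (cI m i \<circ>\<^sub>w x))"
      by (rule M_wcap_I) (use I less.IH[of m] in auto)
    then show ?case by simp
  next
    case (cup m x i)
    have "M m (wcap m j d (ccup m i \<circ>\<^sub>w x))"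
      by (rule M_wcap_cup) (use cup less.IH[of m] in auto)
    then show ?case by simp
  qed (auto simp: wcap_linear M_closed)
  then show ?case using less.prems by simp
qed

lemma M_cap: "M t x \<Longrightarrow> i + 2 \<le> t \<Longrightarrow> M (t - 2) (ccap (t - 2) i \<circ>\<^sub>w x)"
  using M_wcap[of t x i 0] by simp

text \<open>Generation starts with \<open>2 * n\<close> strands and never removes any.\<close>

lemma M_small: "M t x \<Longrightarrow> t < 2 * n \<Longrightarrow> x = 0"
  by (induction rule: span_ops.induct) auto

text \<open>\<open>T k\<close> is spanned by the results of applying to \<open>Z\<close> only the operators I on the first \<open>k\<close> strands.\<close>

inductive T :: "nat \<Rightarrow> mor \<Rightarrow> bool" where
  base: "T k Z"
| zero: "T k 0"
| add: "T k x \<Longrightarrow> T k y \<Longrightarrow> T k (x + y)"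
| scale: "T k x \<Longrightarrow> T k (c *\<^sub>K x)"
| I: "T k x \<Longrightarrow> i + 2 \<le> k \<Longrightarrow> i + 2 \<le> 2 * n \<Longrightarrow> T k (cI (2 * n - 2) i \<circ>\<^sub>w x)"

lemma T_uminus: "T k x \<Longrightarrow> T k (- x)"
  using T.scale[of k x "- 1"] by simp

lemma T_M: "T k x \<Longrightarrow> M (2 * n) x"
  by (induction rule: T.induct) (auto intro: span_ops.intros M_I)

lemma M_T: "M t x \<Longrightarrow> t = 2 * n \<Longrightarrow> T (2 * n) x"
proof (induction rule: span_ops.induct)
  case (I m x i)
  then show ?case using T.I[of "2 * n" x i] by (simp flip: I.prems)
next
  case (cup m x i)
  \<comment> \<open>A cup that ends on \<open>2 * n\<close> strands starts from an element with too
    few strands.\<close>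
  then have "x = 0" by (intro M_small) auto
  then show ?case by (simp add: T.zero)
qed (auto intro: T.intros)

text \<open>The capped element has fewer strands than \<open>Z\<close>. On \<open>T\<close> the
  triple relation therefore loses its cap term and becomes the Temperley-Lieb relation.\<close>

lemma T_cap: "T k x \<Longrightarrow> i + 2 \<le> 2 * n \<Longrightarrow> ccap (2 * n - 2) i \<circ>\<^sub>w x = 0"
  using M_small[OF M_cap[OF T_M]] by simp

lemma T_chain: "T k x \<Longrightarrow> j + d < k \<Longrightarrow> j + d < 2 * n \<Longrightarrow> T k (chain (2 * n - 2) j d x)"
  by (induction d) (auto intro: T.I)

text \<open>The last operator of a nonempty chain is at an even position. From an odd start the
  operators then cancel in pairs by \<open>I_I_Z\<close>; from an even start the first one is a
  scalar first.\<close>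

lemma chain_Z: "j + d < 2 * n \<Longrightarrow> odd (j + d) \<Longrightarrow> T 0 (chain (2 * n - 2) j d Z)"
proof (induction d arbitrary: j rule: less_induct)
  case (less d)
  show ?case
  proof (cases d)
    case 0
    then show ?thesis by (simp add: T.base)
  next
    case (Suc e)
    show ?thesis
    proof (cases "even j")
      case True
      then obtain i where "j = 2 * i" by blast
      then have "cI (2 * n - 2) j \<circ>\<^sub>w Z = - (B *\<^sub>K Z)" using I_Z[of i] less.prems by simp
      then show ?thesis using less.IH[of e "Suc j"] less.prems Suc
        by (simp add: chain_Suc chain_linear T.scale T_uminus del: chain.simps)
    next
      case False
      then obtain i where j: "j = Suc (2 * i)" by (auto elim: oddE)
      obtain e' where e: "e = Suc e'" using less.prems Suc False by (cases e) auto
      have "Suc i < n" using less.prems Suc e j by simp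
      from I_I_Z[OF this] show ?thesis
        using less.IH[of e' "Suc (Suc j)"] less.prems Suc e
        by (simp add: chain_Suc chain_linear j T.scale T_uminus del: chain.simps)
    qed
  qed
qed

lemma T_mono: "T k x \<Longrightarrow> k \<le> l \<Longrightarrow> T l x"
  by (induction rule: T.induct) (auto intro: T.intros)

text \<open>In Temperley-Lieb terms the operator at position \<open>2 * p\<close> joins the last two
  of the \<open>2 * p + 2\<close> strands by a cup, so the rest of the half-diagram lives on the
  first \<open>2 * p\<close>. A chain ending there, rather than one operator, makes the claim
  survive the passage through the generators of \<open>T\<close>.\<close>

lemma T_chain_reduce:
  "T k x \<Longrightarrow> k = 2 * p + 2 \<Longrightarrow> p < n \<Longrightarrow> j + d = 2 * p + 1 \<Longrightarrow> d > 0 \<Longrightarrow> T (2 * p) (chain (2 * n - 2) j d x)"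
proof (induction arbitrary: j d rule: T.induct)
  case (base k)
  then show ?case by (intro T_mono[OF chain_Z]) auto
next
  case (I k x l)
  let ?m = "2 * n - 2"
  have l: "l \<le> 2 * p" "2 * p \<le> ?m" using I.hyps I.prems by auto
  consider e f where "l = Suc (j + e)" "d = Suc (Suc (e + f))" | "l = j" | "j = Suc l" | "l + 2 \<le> j"
  proof -
    have "\<exists>e f. l = Suc (j + e) \<and> d = Suc (Suc (e + f))" if "j < l"
      by (rule exI[of _ "l - j - 1"], rule exI[of _ "d + j - l - 1"]) (use that I.prems l in auto)
    then show ?thesis using that by (metis add_2_eq_Suc' linorder_neqE_nat Suc_leI le_neq_implies_less)
  qed
  then show ?case
  proof cases
    case (1 e f)
    let ?y = "chain ?m j e x" and ?i = "j + e"
    have y: "chain ?m j e (cI ?m l \<circ>\<^sub>w x) = cI ?m l \<circ>\<^sub>w ?y" using l 1 by (intro chain_I_above) auto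
    have "T k (cI ?m l \<circ>\<^sub>w ?y)"
      unfolding y[symmetric] by (intro T_chain T.I I.hyps) (use I.prems l 1 in auto)
    \<comment> \<open>This is the cap term of the triple relation, so the latter shortens the three
      operators below to one.\<close>
    then have c: "ccap ?m ?i \<circ>\<^sub>w (cI ?m l \<circ>\<^sub>w ?y) = 0"
      using T_cap[of k _ ?i] l 1 I.prems by simp
    have "chain ?m j d (cI ?m l \<circ>\<^sub>w x) = chain ?m ?i (Suc (Suc f)) (cI ?m l \<circ>\<^sub>w ?y)"
      using chain_add[of ?m j e "Suc (Suc f)" "cI ?m l \<circ>\<^sub>w x"] by (simp only: y 1(2) add_Suc_right)
    also have "\<dots> = chain ?m (Suc l) f (cI ?m l \<circ>\<^sub>w (cI ?m ?i \<circ>\<^sub>w (cI ?m l \<circ>\<^sub>w ?y)))"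
      by (simp add: chain_Suc 1 del: chain.simps)
    also have "cI ?m l \<circ>\<^sub>w (cI ?m ?i \<circ>\<^sub>w (cI ?m l \<circ>\<^sub>w ?y)) = B *\<^sub>K (cI ?m l \<circ>\<^sub>w ?y)"
      using I_I_I_x(2)[of ?i ?m ?y] l 1 c by simp
    also have "chain ?m (Suc l) f \<dots> = B *\<^sub>K chain ?m l (Suc f) ?y"
      by (simp add: chain_Suc chain_linear del: chain.simps)
    also have "chain ?m l (Suc f) ?y = chain ?m j e (chain ?m l (Suc f) x)"
      using l 1 I.prems by (intro chain_chain) auto
    also have "T (2 * p) (B *\<^sub>K \<dots>)"
      using I.prems 1 l by (intro T.scale T_chain I.IH) auto
    finally show ?thesis .
  next
    case 2
    then obtain e where "d = Suc e" using I.prems by (cases d) auto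
    then have "chain ?m j d (cI ?m l \<circ>\<^sub>w x) = - (B *\<^sub>K chain ?m j d x)"
      using 2 by (simp add: chain_Suc I_I_x chain_linear del: chain.simps)
    then show ?thesis using I.IH[of j d] I.prems by (simp add: T.scale T_uminus)
  next
    case 3
    then show ?thesis using I.IH[of l "Suc d"] I.prems by (simp add: chain_Suc del: chain.simps)
  next
    case 4
    then have "chain ?m j d (cI ?m l \<circ>\<^sub>w x) = cI ?m l \<circ>\<^sub>w chain ?m j d x"
      using I.prems l by (intro chain_I_below) auto
    then show ?thesis using I.IH[of j d] I.prems l 4 by (auto intro!: T.I)
  qed
qed (auto simp: chain_linear intro: T.intros)

text \<open>The pairs are merged from right to left, so that each merge lowers the number of strands
  on which the element differs from \<open>Z\<close>.\<close>

fun merge_all :: "nat \<Rightarrow> mor \<Rightarrow> mor" where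
  "merge_all 0 x = x"
| "merge_all (Suc p) x = merge_all p (cI (2 * n - 2) (2 * p) \<circ>\<^sub>w x)"

lemma T_0: "T k x \<Longrightarrow> k = 0 \<Longrightarrow> \<exists>c. x = c *\<^sub>K Z"
proof (induction rule: T.induct)
  case (base k)
  then show ?case by (intro exI[of _ 1]) simp
next
  case (zero k)
  then show ?case by (intro exI[of _ 0]) simp
next
  case (add k x y)
  then show ?case by (metis mor.scale_left_distrib)
qed auto

lemma T_merge_all: "T (2 * p) x \<Longrightarrow> p \<le> n \<Longrightarrow> \<exists>c. merge_all p x = c *\<^sub>K Z"
proof (induction p arbitrary: x)
  case 0
  then show ?case using T_0 by simp
next
  case (Suc p)
  then show ?case using T_chain_reduce[of "2 * Suc p" x p "2 * p" 1] by simp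
qed

lemma M_merge_all: "M (2 * n) x \<Longrightarrow> \<exists>c. merge_all n x = c *\<^sub>K Z"
  by (intro T_merge_all M_T) auto

end

section \<open>Reduction of arbitrary webs to single strands\<close>

fun deg :: "word \<Rightarrow> nat" where
  "deg [] = 0"
| "deg (Single # t) = Suc (deg t)"
| "deg (Double # t) = Suc (Suc (deg t))"

fun to_singles :: "word \<Rightarrow> mor" where
  "to_singles [] = id_web []"
| "to_singles (Single # t) = id_web [Single] \<otimes>\<^sub>w to_singles t"
| "to_singles (Double # t) = spl \<otimes>\<^sub>w to_singles t"

lemma deg_append [simp]: "deg (u @ v) = deg u + deg v"
  by (induction u rule: deg.induct) auto

lemma deg_S [simp]: "deg (S k) = k"
  by (induction k) auto

lemma deg_Double [simp]: "deg (replicate k Double) = 2 * k"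
  by (induction k) auto

lemma to_singles_append: "to_singles (u @ v) = to_singles u \<otimes>\<^sub>w to_singles v"
  by (induction u rule: to_singles.induct) (auto simp: wtensor_assoc)

lemma Hom_to_singles: "to_singles t \<in> Hom t (S (deg t))"
proof (induction t rule: to_singles.induct)
  case (2 t)
  then show ?case using Hom_tensor[OF Hom_id[of "[Single]"] 2] by simp
next
  case (3 t)
  then show ?case using Hom_tensor[OF Hom_spl 3] by simp
qed simp

text \<open>\<open>X\<close> is a lift of \<open>x\<close> to single strands. Because
  \<open>to_singles\<close> is a tensor product over the letters, a lift of a local piece gives a
  lift in every context.\<close>

lemma to_singles_pad:
  assumes x: "x \<in> Hom a b" and X: "X \<in> Hom (S (deg a)) (S (deg b))" and e: "to_singles b \<circ>\<^sub>w x = X \<circ>\<^sub>w to_singles a"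
  shows "to_singles (u @ b @ v) \<circ>\<^sub>w pad u x v = op_at X (deg u + deg v) (deg u) \<circ>\<^sub>w to_singles (u @ a @ v)"
proof -
  have "to_singles (u @ b @ v) \<circ>\<^sub>w pad u x v = (to_singles u \<otimes>\<^sub>w (to_singles b \<otimes>\<^sub>w to_singles v)) \<circ>\<^sub>w (id_web u \<otimes>\<^sub>w (x \<otimes>\<^sub>w id_web v))"
    by (simp add: pad_def wtensor_assoc to_singles_append)
  also have "\<dots> = (to_singles u \<circ>\<^sub>w id_web u) \<otimes>\<^sub>w ((to_singles b \<circ>\<^sub>w x) \<otimes>\<^sub>w (to_singles v \<circ>\<^sub>w id_web v))"
    by (simp add: interchange[OF Hom_to_singles Hom_tensor[OF Hom_to_singles Hom_to_singles] Hom_id Hom_tensor[OF x Hom_id]]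
        interchange[OF Hom_to_singles Hom_to_singles x Hom_id])
  also have "\<dots> = (id_web (S (deg u)) \<circ>\<^sub>w to_singles u) \<otimes>\<^sub>w ((X \<circ>\<^sub>w to_singles a) \<otimes>\<^sub>w (id_web (S (deg v)) \<circ>\<^sub>w to_singles v))"
    by (simp add: e id_comp[OF Hom_to_singles] comp_id[OF Hom_to_singles])
  also have "\<dots> = (id_web (S (deg u)) \<otimes>\<^sub>w (X \<otimes>\<^sub>w id_web (S (deg v)))) \<circ>\<^sub>w (to_singles u \<otimes>\<^sub>w (to_singles a \<otimes>\<^sub>w to_singles v))"
    by (simp add: interchange[OF Hom_id Hom_tensor[OF X Hom_id] Hom_to_singles Hom_tensor[OF Hom_to_singles Hom_to_singles]]
        interchange[OF X Hom_id Hom_to_singles Hom_to_singles])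
  also have "\<dots> = op_at X (deg u + deg v) (deg u) \<circ>\<^sub>w to_singles (u @ a @ v)"
    by (simp add: op_at_def pad_def wtensor_assoc to_singles_append)
  finally show ?thesis .
qed

lemma to_singles_ops:
  "to_singles (u @ [Single, Single] @ v) \<circ>\<^sub>w pad u (cupe Single) v = ccup (deg u + deg v) (deg u) \<circ>\<^sub>w to_singles (u @ v)"
  "to_singles (u @ v) \<circ>\<^sub>w pad u (cape Single) v = ccap (deg u + deg v) (deg u) \<circ>\<^sub>w to_singles (u @ [Single, Single] @ v)"
  "to_singles (u @ [Double] @ v) \<circ>\<^sub>w pad u mrg v = cI (deg u + deg v) (deg u) \<circ>\<^sub>w to_singles (u @ [Single, Single] @ v)"
  "to_singles (u @ [Single, Single] @ v) \<circ>\<^sub>w pad u spl v = to_singles (u @ [Double] @ v)"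
proof -
  show "to_singles (u @ [Single, Single] @ v) \<circ>\<^sub>w pad u (cupe Single) v = ccup (deg u + deg v) (deg u) \<circ>\<^sub>w to_singles (u @ v)"
    using to_singles_pad[OF Hom_cupe, of "cupe Single" Single u v] Hom_cupe[of Single]
    by (simp add: id_comp[OF Hom_cupe] comp_id[OF Hom_cupe])
  show "to_singles (u @ v) \<circ>\<^sub>w pad u (cape Single) v = ccap (deg u + deg v) (deg u) \<circ>\<^sub>w to_singles (u @ [Single, Single] @ v)"
    using to_singles_pad[OF Hom_cape, of "cape Single" Single u v] Hom_cape[of Single]
    by (simp add: id_comp[OF Hom_cape] comp_id[OF Hom_cape])
  show "to_singles (u @ [Double] @ v) \<circ>\<^sub>w pad u mrg v = cI (deg u + deg v) (deg u) \<circ>\<^sub>w to_singles (u @ [Single, Single] @ v)"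
    using to_singles_pad[OF Hom_mrg, of II u v] Hom_II by (simp add: II_def[symmetric] comp_id[OF Hom_II])
  show "to_singles (u @ [Single, Single] @ v) \<circ>\<^sub>w pad u spl v = to_singles (u @ [Double] @ v)"
    using to_singles_pad[OF Hom_spl, of "id_web [Single, Single]" u v] id_comp[OF Hom_to_singles[of "u @ [Double] @ v"]]
    by (simp add: op_at_id_two id_comp[OF Hom_spl])
qed

lemma to_singles_I: "cI (deg u + deg v) (deg u) \<circ>\<^sub>w to_singles (u @ [Double] @ v) = - (B *\<^sub>K to_singles (u @ [Double] @ v))"
proof -
  have "cI (deg u + deg v) (deg u) \<circ>\<^sub>w to_singles (u @ [Double] @ v) =
    to_singles (u @ [Double] @ v) \<circ>\<^sub>w pad u (mrg \<circ>\<^sub>w spl) v"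
    by (simp only: to_singles_ops(4)[symmetric, of u v] pad_comp wcomp_assoc[symmetric])
      (simp only: to_singles_ops(3,4) wcomp_assoc)
  also have "\<dots> = - (B *\<^sub>K to_singles (u @ [Double] @ v))"
    using comp_id[OF Hom_to_singles[of "u @ [Double] @ v"]] by (simp add: bigon pad_linear)
  finally show ?thesis .
qed

section \<open>Recovering a morphism from its image on single strands\<close>

fun of_singles :: "word \<Rightarrow> mor" where
  "of_singles [] = id_web []"
| "of_singles (Single # t) = id_web [Single] \<otimes>\<^sub>w of_singles t"
| "of_singles (Double # t) = mrg \<otimes>\<^sub>w of_singles t"

lemma Hom_of_singles: "of_singles t \<in> Hom (S (deg t)) t"
proof (induction t rule: of_singles.induct)
  case (2 t)
  then show ?case using Hom_tensor[OF Hom_id[of "[Single]"] 2] by simp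
next
  case (3 t)
  then show ?case using Hom_tensor[OF Hom_mrg 3] by simp
qed simp

lemma of_singles_to_singles: "of_singles t \<circ>\<^sub>w to_singles t = ((- B) ^ count_list t Double) *\<^sub>K id_web t"
proof (induction t rule: of_singles.induct)
  case (2 t)
  then show ?case
    using interchange[OF Hom_id[of "[Single]"] Hom_of_singles[of t] Hom_id Hom_to_singles[of t]] comp_id[OF Hom_id]
    by simp
next
  case (3 t)
  then show ?case
    using interchange[OF Hom_mrg Hom_of_singles[of t] Hom_spl Hom_to_singles[of t]] by (simp add: bigon mult.commute)
qed (use comp_id[OF Hom_id] in simp)

text \<open>By the bigon relation \<open>of_singles\<close> is a left inverse up to a power of -B,
  which is invertible. Equations between webs can therefore be checked after splitting.\<close>

lemma to_singles_cancel:
  assumes "to_singles t \<circ>\<^sub>w x = to_singles t \<circ>\<^sub>w y" "x \<in> Hom s t" "y \<in> Hom s t"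
  shows "x = y"
proof -
  have "of_singles t \<circ>\<^sub>w (to_singles t \<circ>\<^sub>w x) = of_singles t \<circ>\<^sub>w (to_singles t \<circ>\<^sub>w y)"
    by (simp only: assms)
  then have "((- B) ^ count_list t Double) *\<^sub>K x = ((- B) ^ count_list t Double) *\<^sub>K y"
    by (simp add: wcomp_assoc[symmetric] of_singles_to_singles id_comp[OF assms(2)] id_comp[OF assms(3)])
  then show ?thesis by (simp only: mor.scale_cancel_left) simp
qed

text \<open>A bigon is inserted into the double cup, and its split is turned around the cup.\<close>

lemma cup_double: "- (B *\<^sub>K cupe Double) =
    pad [] mrg [Double] \<circ>\<^sub>w (pad [Single, Single] mrg [] \<circ>\<^sub>w ncups)"
proof -
  have "pad [] (mrg \<circ>\<^sub>w spl) [Double] \<circ>\<^sub>w cupe Double = - (B *\<^sub>K cupe Double)"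
    by (simp add: bigon pad_linear id_comp[OF Hom_cupe])
  then show ?thesis by (simp only: pad_comp wcomp_assoc cup_double_left)
qed

lemma cap_double: "- (B *\<^sub>K cape Double) =
    ncaps \<circ>\<^sub>w (pad [Single, Single] spl [] \<circ>\<^sub>w pad [] spl [Double])"
proof -
  have "cape Double \<circ>\<^sub>w pad [] (mrg \<circ>\<^sub>w spl) [Double] = - (B *\<^sub>K cape Double)"
    by (simp add: bigon pad_linear comp_id[OF Hom_cape])
  then have "- (B *\<^sub>K cape Double) = (cape Double \<circ>\<^sub>w pad [] mrg [Double]) \<circ>\<^sub>w pad [] spl [Double]"
    by (simp only: pad_comp wcomp_assoc)
  then show ?thesis by (simp only: cap_double_left wcomp_assoc)
qed

lemma mset_vertex:
  assumes "mset w = {#Single, Single, Double#}"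
  shows "w \<in> {[Single, Single, Double], [Single, Double, Single], [Double, Single, Single]}"
proof -
  have "length w = 3" using arg_cong[OF assms, of size] by simp
  then obtain x y z where "w = [x, y, z]" by (auto simp: numeral_3_eq_3 length_Suc_conv)
  then show ?thesis using arg_cong[OF assms, of "\<lambda>A. count A Double"] by (cases x; cases y; cases z) auto
qed

section \<open>Stability of the span under arbitrary webs\<close>

context cup_diagram
begin

definition adm :: "word \<Rightarrow> mor \<Rightarrow> bool"
  where "adm t x \<longleftrightarrow> x \<in> Hom s t \<and> M (deg t) (to_singles t \<circ>\<^sub>w x)"

text \<open>The context is quantified inside the definition so that the property passes to
  composites and paddings, and only the events have to be inspected.\<close>

definition good :: "mor \<Rightarrow> word \<Rightarrow> word \<Rightarrow> bool"
  where "good e a b \<longleftrightarrow> e \<in> Hom a b \<and> (\<forall>u v x. adm (u @ a @ v) x \<longrightarrow> adm (u @ b @ v) (pad u e v \<circ>\<^sub>w x))"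

lemma good_comp: "good f b c \<Longrightarrow> good e a b \<Longrightarrow> good (f \<circ>\<^sub>w e) a c"
  by (auto simp: good_def pad_comp wcomp_assoc Hom_comp)

lemma good_pad: "good e a b \<Longrightarrow> good (pad u e v) (u @ a @ v) (u @ b @ v)"
  unfolding good_def
proof safe
  fix u' v' x
  assume "e \<in> Hom a b" and *: "\<forall>u v x. adm (u @ a @ v) x \<longrightarrow> adm (u @ b @ v) (pad u e v \<circ>\<^sub>w x)"
    and "adm (u' @ (u @ a @ v) @ v') x"
  then show "adm (u' @ (u @ b @ v) @ v') (pad u' (pad u e v) v' \<circ>\<^sub>w x)"
    using *[rule_format, of "u' @ u" "v @ v'" x] by simp
qed (auto intro: Hom_pad)

lemma adm_closed:
  "adm t 0" "adm t x \<Longrightarrow> adm t y \<Longrightarrow> adm t (x + y)" "adm t x \<Longrightarrow> adm t (c *\<^sub>K x)"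
  by (auto simp: adm_def Hom_closed comp_linear M_closed)

lemma good_scale: "good e a b \<Longrightarrow> good (c *\<^sub>K e) a b"
  by (auto simp: good_def Hom_closed pad_linear adm_closed)

lemma good_I:
  assumes "e \<in> Hom a b"
    and "\<And>u v x. M (deg u + deg a + deg v) (to_singles (u @ a @ v) \<circ>\<^sub>w x) \<Longrightarrow>
      M (deg u + deg b + deg v) ((to_singles (u @ b @ v) \<circ>\<^sub>w pad u e v) \<circ>\<^sub>w x)"
  shows "good e a b"
  using assms Hom_comp[OF Hom_pad[OF assms(1)]] by (auto simp: good_def adm_def wcomp_assoc ac_simps)

lemma good_gens: "good (cupe Single) [] [Single, Single]" "good (cape Single) [Single, Single] []"
  "good mrg [Single, Single] [Double]" "good spl [Double] [Single, Single]"
proof -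
  show "good (cupe Single) [] [Single, Single]"
    by (rule good_I[OF Hom_cupe]) (use M_cup to_singles_ops(1) in \<open>auto simp: wcomp_assoc\<close>)
  show "good (cape Single) [Single, Single] []"
    by (rule good_I[OF Hom_cape]) (use M_cap to_singles_ops(2) in \<open>force simp: wcomp_assoc\<close>)
  show "good mrg [Single, Single] [Double]"
    by (rule good_I[OF Hom_mrg]) (use M_I to_singles_ops(3) in \<open>force simp: wcomp_assoc\<close>)
  show "good spl [Double] [Single, Single]"
    by (rule good_I[OF Hom_spl]) (use to_singles_ops(4) in \<open>auto simp: wcomp_assoc\<close>)
qed

lemma good_double: "good (cupe Double) [] [Double, Double]" "good (cape Double) [Double, Double] []"
proof -
  have *: "x = (- inverse B) *\<^sub>K (- (B *\<^sub>K x))" for x by simp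
  have "good (pad [] mrg [Double] \<circ>\<^sub>w (pad [Single, Single] mrg [] \<circ>\<^sub>w ncups)) [] [Double, Double]"
    using good_pad[OF good_gens(3), of "[]" "[Double]"] good_pad[OF good_gens(3), of "[Single, Single]" "[]"]
      good_pad[OF good_gens(1), of "[Single]" "[Single]"] good_gens(1)
    by (auto intro!: good_comp)
  then show "good (cupe Double) [] [Double, Double]"
    by (subst *) (simp only: cup_double good_scale)
  have "good (ncaps \<circ>\<^sub>w (pad [Single, Single] spl [] \<circ>\<^sub>w pad [] spl [Double])) [Double, Double] []"
    using good_pad[OF good_gens(4), of "[]" "[Double]"] good_pad[OF good_gens(4), of "[Single, Single]" "[]"]
      good_pad[OF good_gens(2), of "[Single]" "[Single]"] good_gens(2)
    by (auto intro!: good_comp)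
  then show "good (cape Double) [Double, Double] []"
    by (subst *) (simp only: cap_double good_scale)
qed

lemma good_cup: "good (cupe x) [] [x, x]"
  using good_gens good_double by (cases x) auto

lemma good_cap: "good (cape x) [x, x] []"
  using good_gens good_double by (cases x) auto

lemma good_turn:
  assumes "mset (a @ [x] @ b) = {#Single, Single, Double#}"
  shows "good (vert (a @ [x]) b) (a @ [x]) b \<Longrightarrow> good (vert a (b @ [x])) a (b @ [x])"
    and "good (vert (x # a) b) (x # a) b \<Longrightarrow> good (vert a (x # b)) a (x # b)"
    and "good (vert a (b @ [x])) a (b @ [x]) \<Longrightarrow> good (vert (a @ [x]) b) (a @ [x]) b"
    and "good (vert a (x # b)) a (x # b) \<Longrightarrow> good (vert (x # a) b) (x # a) b"
proof -
  show "good (vert a (b @ [x])) (a) (b @ [x])" if "good (vert (a @ [x]) b) (a @ [x]) (b)"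
  proof -
    have "good (pad [] (vert (a @ [x]) b) [x]) (a @ [x, x]) (b @ [x])" "good (pad a (cupe x) []) (a) (a @ [x, x])"
      using good_pad[OF that, of "[]" "[x]"] good_pad[OF good_cup[of x], of "a" "[]"] by simp_all
    from good_comp[OF this] show ?thesis by (simp only: turn_right[OF assms])
  qed
  show "good (vert a (x # b)) (a) (x # b)" if "good (vert (x # a) b) (x # a) (b)"
  proof -
    have "good (pad [x] (vert (x # a) b) []) (x # x # a) (x # b)" "good (pad [] (cupe x) a) (a) (x # x # a)"
      using good_pad[OF that, of "[x]" "[]"] good_pad[OF good_cup[of x], of "[]" "a"] by simp_all
    from good_comp[OF this] show ?thesis by (simp only: turn_left[OF assms])
  qed
  show "good (vert (a @ [x]) b) (a @ [x]) (b)" if "good (vert a (b @ [x])) (a) (b @ [x])"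
  proof -
    have "good (pad b (cape x) []) (b @ [x, x]) (b)" "good (pad [] (vert a (b @ [x])) [x]) (a @ [x]) (b @ [x, x])"
      using good_pad[OF that, of "[]" "[x]"] good_pad[OF good_cap[of x], of "b" "[]"] by simp_all
    from good_comp[OF this] show ?thesis by (simp only: unturn_right[OF assms])
  qed
  show "good (vert (x # a) b) (x # a) (b)" if "good (vert a (x # b)) (a) (x # b)"
  proof -
    have "good (pad [] (cape x) b) (x # x # b) (b)" "good (pad [x] (vert a (x # b)) []) (x # a) (x # x # b)"
      using good_pad[OF that, of "[x]" "[]"] good_pad[OF good_cap[of x], of "[]" "b"] by simp_all
    from good_comp[OF this] show ?thesis by (simp only: unturn_left[OF assms])
  qed
qed

lemma good_vertex:
  assumes "mset (a @ b) = {#Single, Single, Double#}"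
  shows "good (vert a b) a b"
proof -
  note t = good_turn
  have 1: "good (vert [Single] [Single, Double]) [Single] [Single, Double]"
    using t(2)[of "[Single]" Single "[Double]"] good_gens(3) by simp
  have 2: "good (vert [Single] [Double, Single]) [Single] [Double, Single]"
    using t(1)[of "[Single]" Single "[Double]"] good_gens(3) by simp
  have 3: "good (vert [Single, Double] [Single]) [Single, Double] [Single]"
    using t(4)[of "[Double]" Single "[Single]"] good_gens(4) by simp
  have 4: "good (vert [Double, Single] [Single]) [Double, Single] [Single]"
    using t(3)[of "[Double]" Single "[Single]"] good_gens(4) by simp
  have 5: "good (vert [] [Single, Single, Double]) [] [Single, Single, Double]"
    using t(2)[of "[]" Single "[Single, Double]"] 1 by simp
  have 6: "good (vert [] [Double, Single, Single]) [] [Double, Single, Single]"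
    using t(1)[of "[]" Single "[Double, Single]"] 2 by simp
  have 7: "good (vert [] [Single, Double, Single]) [] [Single, Double, Single]"
    using t(2)[of "[]" Single "[Double, Single]"] 2 by simp
  have 8: "good (vert [Single, Single, Double] []) [Single, Single, Double] []"
    using t(4)[of "[Single, Double]" Single "[]"] 3 by simp
  have 9: "good (vert [Double, Single, Single] []) [Double, Single, Single] []"
    using t(3)[of "[Double, Single]" Single "[]"] 4 by simp
  have 10: "good (vert [Single, Double, Single] []) [Single, Double, Single] []"
    using t(4)[of "[Double, Single]" Single "[]"] 4 by simp
  show ?thesis
    using mset_vertex[OF assms] good_gens(3,4) 1 2 3 4 5 6 7 8 9 10
    by (auto simp: append_eq_Cons_conv)
qed

lemma good_ev: "event_ok e \<Longrightarrow> good (ev e) (event_bot e) (event_top e)"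
  using good_cup good_cap good_vertex by (cases e) auto

lemma adm_web: "is_diagram t D r \<Longrightarrow> adm t x \<Longrightarrow> adm r (web t D r \<circ>\<^sub>w x)"
proof (induction arbitrary: x rule: is_diagram.induct)
  case (Nil t)
  then show ?case by (auto simp: adm_def id_web_def[symmetric] id_comp)
next
  case (Cons e u v D r)
  then have "adm (u @ event_top e @ v) (pad u (ev e) v \<circ>\<^sub>w x)"
    using good_ev[of e] unfolding good_def by blast
  then show ?case using Cons by (simp add: web_slice wcomp_assoc)
qed

lemma adm_Hom: "f \<in> Hom t r \<Longrightarrow> adm t x \<Longrightarrow> adm r (f \<circ>\<^sub>w x)"
  by (induction rule: Hom_induct) (auto simp: adm_closed adm_web comp_linear)

end

section \<open>Endomorphisms act by scalars\<close>

lemma cap_even_to_singles: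
  assumes "i < n"
  shows "cI (2 * n - 2) (2 * i) \<circ>\<^sub>w to_singles (replicate n Double) = - (B *\<^sub>K to_singles (replicate n Double))"
    and "ccap (2 * n - 2) (2 * i) \<circ>\<^sub>w to_singles (replicate n Double) = 0"
proof -
  obtain k where k: "n = i + (Suc k)" using assms less_iff_Suc_add by auto
  have w: "replicate n Double = replicate i Double @ [Double] @ replicate k Double"
    by (simp only: k replicate_add) simp
  have m: "2 * n - 2 = 2 * i + 2 * k" using k by simp
  show I: "cI (2 * n - 2) (2 * i) \<circ>\<^sub>w to_singles (replicate n Double) = - (B *\<^sub>K to_singles (replicate n Double))"
    using to_singles_I[of "replicate i Double" "replicate k Double"] by (simp only: w m) simp
  have "ccap (2 * n - 2) (2 * i) \<circ>\<^sub>w (cI (2 * n - 2) (2 * i) \<circ>\<^sub>w to_singles (replicate n Double)) = 0"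
    by (rule cap_I_x)
  then show "ccap (2 * n - 2) (2 * i) \<circ>\<^sub>w to_singles (replicate n Double) = 0"
    by (simp add: I)
qed

text \<open>Caps inside one split double strand vanish by the monogon relation, so the hypothesis
  concerns caps between neighbours. Merging all pairs of \<open>f \<circ>\<^sub>w G\<close> on
  single strands is evaluated twice: the closure of the span gives a multiple of \<open>?Z\<close>,
  and the bigon relation gives a power of -B.\<close>

theorem Hom_double_scalar:
  assumes G: "G \<in> Hom (replicate n Double) (replicate n Double)"
    and cap: "\<And>i. Suc i < n \<Longrightarrow> ccap (2 * n - 2) (Suc (2 * i)) \<circ>\<^sub>w (to_singles (replicate n Double) \<circ>\<^sub>w G) = 0"
    and f: "f \<in> Hom (replicate n Double) (replicate n Double)"
  shows "\<exists>c. f \<circ>\<^sub>w G = c *\<^sub>K G"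
proof -
  let ?w = "replicate n Double"
  let ?Z = "to_singles ?w \<circ>\<^sub>w G"
  have I_to_singles: "cI (2 * n - 2) (2 * i) \<circ>\<^sub>w (to_singles ?w \<circ>\<^sub>w x) = - (B *\<^sub>K (to_singles ?w \<circ>\<^sub>w x))" if "i < n" for i x
    using cap_even_to_singles(1)[OF that, THEN comp_eq_assoc] by simp
  interpret cup_diagram n ?w ?Z
  proof
    show "?Z \<in> Hom ?w (S (2 * n))" using Hom_comp[OF Hom_to_singles G] by simp
    show "cI (2 * n - 2) (2 * i) \<circ>\<^sub>w ?Z = - (B *\<^sub>K ?Z)" if "i < n" for i by (rule I_to_singles[OF that])
    fix j assume j: "j + 2 \<le> 2 * n"
    show "ccap (2 * n - 2) j \<circ>\<^sub>w ?Z = 0"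
    proof (cases "even j")
      case True
      then obtain i where "j = 2 * i" by blast
      then show ?thesis using j cap_even_to_singles(2)[of i n, THEN comp_eq_assoc] by simp
    next
      case False
      then obtain i where "j = Suc (2 * i)" by (auto elim: oddE)
      then show ?thesis using j cap[of i] by simp
    qed
  qed
  have "adm ?w G" using G span_ops.base by (simp add: adm_def)
  then have "adm ?w (f \<circ>\<^sub>w G)" by (rule adm_Hom[OF f])
  then have "M (2 * n) (to_singles ?w \<circ>\<^sub>w (f \<circ>\<^sub>w G))" by (simp add: adm_def)
  then obtain c where c: "merge_all n (to_singles ?w \<circ>\<^sub>w (f \<circ>\<^sub>w G)) = c *\<^sub>K ?Z" using M_merge_all by blast
  \<comment> \<open>On anything that comes from double strands each pair is the image of a split, so
    merging it multiplies by -B.\<close>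
  have "merge_all p (d *\<^sub>K (to_singles ?w \<circ>\<^sub>w x)) = ((- B) ^ p * d) *\<^sub>K (to_singles ?w \<circ>\<^sub>w x)" if "p \<le> n" for p d x
    using that
  proof (induction p arbitrary: d)
    case (Suc p)
    have "merge_all (Suc p) (d *\<^sub>K (to_singles ?w \<circ>\<^sub>w x)) = merge_all p (- (d * B) *\<^sub>K (to_singles ?w \<circ>\<^sub>w x))"
      using Suc.prems I_to_singles[of p x] by simp
    also have "\<dots> = ((- B) ^ p * - (d * B)) *\<^sub>K (to_singles ?w \<circ>\<^sub>w x)"
      by (rule Suc.IH) (use Suc.prems in simp)
    also have "(- B) ^ p * - (d * B) = (- B) ^ Suc p * d" by simp
    finally show ?case .
  qed simp
  from this[of n 1 "f \<circ>\<^sub>w G"] c have "((- B) ^ n) *\<^sub>K (to_singles ?w \<circ>\<^sub>w (f \<circ>\<^sub>w G)) = c *\<^sub>K ?Z" by simp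
  then have "inverse ((- B) ^ n) *\<^sub>K (((- B) ^ n) *\<^sub>K (to_singles ?w \<circ>\<^sub>w (f \<circ>\<^sub>w G))) =
    inverse ((- B) ^ n) *\<^sub>K (c *\<^sub>K ?Z)" by simp
  then have "to_singles ?w \<circ>\<^sub>w (f \<circ>\<^sub>w G) = to_singles ?w \<circ>\<^sub>w ((inverse ((- B) ^ n) * c) *\<^sub>K G)"
    by simp
  from to_singles_cancel[OF this Hom_comp[OF f G] Hom_closed(5)[OF G]] show ?thesis by blast
qed

section \<open>Local computations on two and three double strands\<close>

text \<open>In this locale positions are counted from strand \<open>P\<close>.\<close>

locale strands =
  fixes P :: nat and s :: word
begin

definition oI :: "nat \<Rightarrow> nat \<Rightarrow> mor \<Rightarrow> mor" where "oI m i x = cI (P + m) (P + i) \<circ>\<^sub>w x"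
definition oC :: "nat \<Rightarrow> nat \<Rightarrow> mor \<Rightarrow> mor" where "oC m i x = ccap (P + m) (P + i) \<circ>\<^sub>w x"
definition oD :: "nat \<Rightarrow> nat \<Rightarrow> mor \<Rightarrow> mor" where "oD m i x = ccup (P + m) (P + i) \<circ>\<^sub>w x"

lemmas o_defs = oI_def oC_def oD_def

lemma o_linear:
  "oI m i (x + y) = oI m i x + oI m i y" "oI m i (x - y) = oI m i x - oI m i y"
  "oI m i (- x) = - oI m i x" "oI m i (c *\<^sub>K x) = c *\<^sub>K oI m i x" "oI m i 0 = 0"
  "oC m i (x + y) = oC m i x + oC m i y" "oC m i (x - y) = oC m i x - oC m i y"
  "oC m i (- x) = - oC m i x" "oC m i (c *\<^sub>K x) = c *\<^sub>K oC m i x" "oC m i 0 = 0"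
  "oD m i (x + y) = oD m i x + oD m i y" "oD m i (x - y) = oD m i x - oD m i y"
  "oD m i (- x) = - oD m i x" "oD m i (c *\<^sub>K x) = c *\<^sub>K oD m i x" "oD m i 0 = 0"
  by (simp_all add: o_defs comp_linear)

lemma o_simps:
  "oI m i (oI m i x) = - (B *\<^sub>K oI m i x)" "oC m i (oI m i x) = 0" "oI m i (oD m i x) = 0"
  by (simp_all add: o_defs I_I_x cap_I_x I_cup_x)

definition ty :: "nat \<Rightarrow> mor \<Rightarrow> bool" where "ty m x \<longleftrightarrow> x \<in> Hom s (S (P + m))"

lemma o_ty:
  "i \<le> m \<Longrightarrow> ty (m + 2) x \<Longrightarrow> ty (m + 2) (oI m i x)"
  "i \<le> m \<Longrightarrow> ty (m + 2) x \<Longrightarrow> ty m (oC m i x)"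
  "i \<le> m \<Longrightarrow> ty m x \<Longrightarrow> ty (m + 2) (oD m i x)"
  using Hom_comp[OF Hom_ops(1)] Hom_comp[OF Hom_ops(2)] Hom_comp[OF Hom_ops(3)] by (simp_all add: o_defs ty_def)

lemma o_zig:
  assumes "ty m x"
  shows "Suc i = j \<Longrightarrow> j \<le> m \<Longrightarrow> oC m i (oD m j x) = x"
    "Suc i = j \<Longrightarrow> j \<le> m \<Longrightarrow> oC m j (oD m i x) = x"
  using zig_x[of "P + i" "P + m" x] assms by (auto simp: o_defs ty_def)

lemma o_loop: "ty m x \<Longrightarrow> i \<le> m \<Longrightarrow> oC m i (oD m i x) = \<delta> *\<^sub>K x"
  using cap_cup_x[of "P + i" "P + m" x] by (simp add: o_defs ty_def)

lemma o_R:
  assumes "Suc i = j" "j \<le> m"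
  shows "oC m i (oI m j x) = oC m j (oI m i x) + oC m j x - oC m i x"
    "oC m j (oI m i x) = oC m i (oI m j x) + oC m i x - oC m j x"
    "oI m j (oD m i x) = oI m i (oD m j x) + oD m j x - oD m i x"
    "oI m i (oD m j x) = oI m j (oD m i x) + oD m i x - oD m j x"
  using cap_R_x[of "P + i" "P + m" x] R_cup_x[of "P + i" "P + m" x] assms by (auto simp: o_defs)

lemma o_III:
  assumes "Suc i = j" "j \<le> m"
  shows "oI m i (oI m j (oI m i x)) = B *\<^sub>K oI m i x + oI m i (oD m j (oC m j (oI m i x)))"
    "oI m j (oI m i (oI m j x)) = B *\<^sub>K oI m j x + oI m j (oD m i (oC m i (oI m j x)))"
  using I_I_I_x[of "P + i" "P + m" x] assms by (auto simp: o_defs)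

lemma o_commute:
  assumes "i + 2 \<le> j" "j \<le> m"
  shows "oI m j (oI m i x) = oI m i (oI m j x)"
    "oC m i (oI m j x) = oI (m - 2) (j - 2) (oC m i x)"
    "oC m j (oI m i x) = oI (m - 2) i (oC m j x)"
    "oI m j (oD m i x) = oD m i (oI (m - 2) (j - 2) x)"
    "oI m i (oD m j x) = oD m j (oI (m - 2) i x)"
    "oC m i (oD m j x) = oD (m - 2) (j - 2) (oC (m - 2) i x)"
    "oC m j (oD m i x) = oD (m - 2) i (oC (m - 2) (j - 2) x)"
  using assms I_I_x_commute[of "P + i" "P + j" "P + m" x] cap_I_x_commute[of "P + i" "P + j" "P + m" x]
    I_cup_x_commute[of "P + i" "P + j" "P + m" x] cap_cup_x_commute[of "P + i" "P + j" "P + m" x]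
  by (simp_all add: o_defs)

lemma o_cap_cap:
  assumes "i \<le> j" "j \<le> m" "j' = j + 2" "m' = m + 2"
  shows "oC m i (oC m' j' x) = oC m j (oC m' i x)"
  using comp_eq_assoc[OF cap_cap_commute[of "P + i" "P + j" "P + m"], of x] assms
  by (simp add: o_defs wcomp_assoc)

lemma B_cancel: "B *\<^sub>K x = B *\<^sub>K y \<Longrightarrow> x = y"
  by (simp only: mor.scale_cancel_left) simp

text \<open>\<open>v\<close> is a morphism into two double strands, read on their four single
  strands. \<open>w\<close> caps the two middle strands and \<open>u\<close> then caps the outer
  two.\<close>

context
  fixes v w u :: mor
  assumes Hom_v: "ty 4 v"
    and Iv: "oI 2 0 v = - (B *\<^sub>K v)" "oI 2 2 v = - (B *\<^sub>K v)"
  defines "w \<equiv> oC 2 (Suc 0) v" and "u \<equiv> oC 0 0 w"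
begin

lemma two_Cv: "oC 2 0 v = 0"
proof -
  have "- (B *\<^sub>K oC 2 0 v) = - (B *\<^sub>K 0)" using o_simps(2)[of 2 0 v] by (simp add: Iv o_linear)
  then show ?thesis by (simp only: neg_equal_iff_equal B_cancel)
qed

lemma two_Hom_w: "ty 2 w"
  using o_ty(2)[of 1 2 v] Hom_v by (simp add: w_def)

lemma two_Hom_u: "ty 0 u"
  using o_ty(2)[of 0 0 w] two_Hom_w by (simp add: u_def numeral_2_eq_2)

text \<open>This is the relation \<open>triangle'\<close> for a vector on which the outer I act as
  on split double strands, derived from the operator relations alone: I of \<open>w\<close> is
  computed in two ways.\<close>

lemma two_I_w: "oI 0 0 w = 0"
proof -
  have "- (B *\<^sub>K oI 2 2 (oI 2 (Suc 0) v)) = - (B *\<^sub>K (B *\<^sub>K v + oI 2 2 (oD 2 (Suc 0) w)))"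
    using o_III(2)[of 1 2 2 v] by (simp add: Iv o_linear w_def algebra_simps)
  then have I43: "oI 2 2 (oI 2 (Suc 0) v) = B *\<^sub>K v + oI 2 2 (oD 2 (Suc 0) w)"
    using B_cancel by simp
  have "oI 0 0 (oC 2 0 (oI 2 (Suc 0) v)) = oC 2 0 (oI 2 2 (oI 2 (Suc 0) v))"
    using o_commute(2)[of 0 2 2 "oI 2 (Suc 0) v"] by simp
  also have "\<dots> = oI 0 0 w"
    using o_commute(2)[of 0 2 2 "oD 2 (Suc 0) w"] o_zig(1)[of 2 w 0 1] two_Hom_w by (simp add: I43 o_linear two_Cv)
  finally have *: "oI 0 0 (oC 2 0 (oI 2 (Suc 0) v)) = oI 0 0 w" .
  have "- (B *\<^sub>K w) = oC 2 0 (oI 2 (Suc 0) v) - w"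
    using o_R(2)[of 0 1 2 v] by (simp add: Iv two_Cv o_linear w_def)
  from arg_cong[OF this, of "oI 0 0"] have "B *\<^sub>K oI 0 0 w = B *\<^sub>K 0"
    by (simp add: * o_linear)
  then show ?thesis by (rule B_cancel)
qed

lemma cap_I_cup: "ty 2 x \<Longrightarrow> oC 2 (Suc 0) (oI 2 2 (oD 2 (Suc 0) x)) = \<kappa> *\<^sub>K x"
  using o_R(1)[of 1 2 2 "oD 2 (Suc 0) x"] o_zig(2)[of 2 x 1 2] o_loop[of 2 x 1]
  by (simp add: o_simps o_linear \<kappa>_def mor.scale_left_diff_distrib)

lemma two_hU: "oC 2 (Suc 0) (oI 2 2 (oD 2 (Suc 0) (oD 0 0 u))) = \<kappa> *\<^sub>K oD 0 0 u"
  using o_ty(3)[of 0 0 u] two_Hom_u by (intro cap_I_cup) (simp add: numeral_2_eq_2)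

lemma two_hX: "oC 2 (Suc 0) (oI 2 0 (oI 2 2 (oD 2 (Suc 0) w))) = (1 - B - \<kappa>) *\<^sub>K w - (1 - B) *\<^sub>K oD 0 0 u"
proof -
  have 1: "oC 2 0 (oI 2 (Suc 0) (oD 2 2 w)) = w - oD 0 0 u"
    using o_R(4)[of 1 2 2 w] o_commute(2)[of 0 2 2 "oD 2 (Suc 0) w"] o_zig(1)[of 2 w 0 1] o_commute(6)[of 0 2 2 w] two_Hom_w
    by (simp add: o_linear two_I_w u_def)
  have 2: "oC 2 (Suc 0) (oI 2 0 (oI 2 (Suc 0) (oD 2 2 w))) = (1 - B) *\<^sub>K (w - oD 0 0 u)"
    using o_R(2)[of 0 1 2 "oI 2 (Suc 0) (oD 2 2 w)"] by (simp add: o_simps o_linear 1 mor.scale_left_diff_distrib)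
  have 3: "oC 2 (Suc 0) (oI 2 0 (oD 2 2 w)) = 0"
    using o_commute(5)[of 0 2 2 w] by (simp add: two_I_w o_linear)
  have 4: "oC 2 (Suc 0) (oI 2 0 (oD 2 (Suc 0) w)) = \<kappa> *\<^sub>K w"
    using o_R(2)[of 0 1 2 "oD 2 (Suc 0) w"] o_zig(1)[of 2 w 0 1] o_loop[of 2 w 1] two_Hom_w
    by (simp add: o_simps o_linear \<kappa>_def mor.scale_left_diff_distrib)
  \<comment> \<open>The square relation moves I from the right pair to the middle; the three
    resulting terms are the ones evaluated in 2, 3 and 4.\<close>
  have 5: "oI 2 2 (oD 2 (Suc 0) w) = oI 2 (Suc 0) (oD 2 2 w) + oD 2 2 w - oD 2 (Suc 0) w"
    by (rule o_R) simp_all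
  show ?thesis
    by (simp add: 5 o_linear 2 3 4 mor.scale_left_diff_distrib mor.scale_right_diff_distrib)
qed

end

text \<open>Now there are three double strands. The previous clasp acts on the first two, which
  gives \<open>Cv1\<close>; \<open>w\<close> caps across the last two, and \<open>u\<close> caps the
  result once more.\<close>

context
  fixes v w u :: mor
  assumes Hom_v: "ty 6 v"
    and Iv: "oI 4 0 v = - (B *\<^sub>K v)" "oI 4 2 v = - (B *\<^sub>K v)" "oI 4 4 v = - (B *\<^sub>K v)"
    and Cv1: "oC 4 (Suc 0) v = 0"
  defines "w \<equiv> oC 4 3 v" and "u \<equiv> oC 2 2 w"
begin

text \<open>The computations on two double strands are reused for the last two of the three, two
  single strands further right.\<close>

interpretation up: strands "P + 2" s .

lemma up: "up.oI m i x = oI (m + 2) (i + 2) x" "up.oC m i x = oC (m + 2) (i + 2) x"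
  "up.oD m i x = oD (m + 2) (i + 2) x" "up.ty m x = ty (m + 2) x"
  unfolding up.o_defs o_defs up.ty_def ty_def by (simp_all add: ac_simps)

lemma Cv: "oC 4 0 v = 0" "oC 4 2 v = 0"
  using B_cancel[of "oC 4 0 v" 0] o_simps(2)[of 4 0 v] up.two_Cv[of v, unfolded up] Hom_v Iv
  by (simp_all add: o_linear numeral_eq_Suc)

lemma Hom_w: "ty 4 w"
  using o_ty(2)[of 3 4 v] Hom_v by (simp add: w_def)

lemma Hom_u: "ty 2 u"
  using o_ty(2)[of 2 2 w] Hom_w by (simp add: u_def)

lemma I0_w: "oI 2 0 w = - (B *\<^sub>K w)"
  using o_commute(3)[of 0 3 4 v] by (simp add: w_def Iv o_linear)

lemma C_w: "oC 2 0 w = 0" "oC 2 (Suc 0) w = 0"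
  using o_cap_cap[of 0 1 2 3 4 v] o_cap_cap[of 1 1 2 3 4 v] by (simp_all add: w_def Cv Cv1 o_linear)

lemma I0_u: "oI 0 0 u = - (B *\<^sub>K u)"
  using o_commute(3)[of 0 2 2 w] by (simp add: u_def I0_w o_linear)

lemma I2_w: "oI 2 2 w = 0"
  using up.two_I_w[of v, unfolded up] Hom_v Iv by (simp add: w_def numeral_eq_Suc)

text \<open>In these names h is the cap across the last two double strands, U and X are the
  correction terms of the current step, and the primed ones those of the preceding step. U and U'
  appear without their factor -1/B, which comes in with \<open>to_singles_pads\<close>.\<close>

lemma hU: "oC 4 3 (oI 4 4 (oD 4 3 (oD 2 2 u))) = \<kappa> *\<^sub>K oD 2 2 u"
  using up.two_hU[of v, unfolded up] Hom_v Iv by (simp add: w_def u_def numeral_eq_Suc)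

lemma hX: "oC 4 3 (oI 4 2 (oI 4 4 (oD 4 3 w))) = (1 - B - \<kappa>) *\<^sub>K w - (1 - B) *\<^sub>K oD 2 2 u"
  using up.two_hX[of v, unfolded up] Hom_v Iv by (simp add: w_def u_def numeral_eq_Suc)

lemma I0_I1_w: "oI 2 0 (oI 2 (Suc 0) w) = B *\<^sub>K w"
proof -
  have "- (B *\<^sub>K oI 2 0 (oI 2 (Suc 0) w)) = - (B *\<^sub>K (B *\<^sub>K w))"
    using o_III(1)[of 0 1 2 w] by (simp only: I0_w o_linear) (simp add: C_w o_linear I0_w)
  then show ?thesis by (simp only: neg_equal_iff_equal B_cancel)
qed

lemma I0_I1_cup2_u: "oI 2 0 (oI 2 (Suc 0) (oD 2 2 u)) = B *\<^sub>K oD 2 2 u + oI 2 0 (oD 2 (Suc 0) u)"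
proof -
  have I: "oI 2 0 (oD 2 2 u) = - (B *\<^sub>K oD 2 2 u)"
    using o_commute(5)[of 0 2 2 u] by (simp add: I0_u o_linear)
  have C: "oC 2 (Suc 0) (oD 2 2 u) = u"
    using o_zig(1)[of 2 u 1 2] Hom_u by simp
  have "- (B *\<^sub>K oI 2 0 (oI 2 (Suc 0) (oD 2 2 u))) =
      - (B *\<^sub>K (B *\<^sub>K oD 2 2 u + oI 2 0 (oD 2 (Suc 0) u)))"
    using o_III(1)[of 0 "Suc 0" 2 "oD 2 2 u"] unfolding I o_linear C mor.scale_right_distrib by simp
  then show ?thesis by (simp only: neg_equal_iff_equal B_cancel)
qed

lemma I0_I2_cup1_u: "oI 2 0 (oI 2 2 (oD 2 (Suc 0) u)) = 0"
  using o_R(3)[of 1 2 2 u] o_commute(5)[of 0 2 2 u]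
  by (simp add: I0_I1_cup2_u o_linear I0_u)

lemma hU'U: "oC 4 3 (oI 4 2 (oD 4 (Suc 0) (oD 2 0 (oC 2 0 (oC 4 (Suc 0) (oI 4 4 (oD 4 3 (oD 2 2 u)))))))) =
    - (B *\<^sub>K oI 2 0 (oD 2 (Suc 0) u))"
proof -
  have "oC 4 (Suc 0) (oI 4 4 (oD 4 3 (oD 2 2 u))) = oI 2 2 (oD 2 (Suc 0) u)"
    using o_commute(2)[of 1 4 4] o_commute(6)[of 1 3 4 "oD 2 2 u"] o_zig(1)[of 2 u 1 2] Hom_u
    by simp
  moreover have "oC 2 0 (oI 2 2 (oD 2 (Suc 0) u)) = - (B *\<^sub>K u)"
    using o_commute(2)[of 0 2 2 "oD 2 (Suc 0) u"] o_zig(1)[of 2 u 0 1] Hom_u by (simp add: I0_u)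
  moreover have "oC 4 3 (oI 4 2 (oD 4 (Suc 0) (oD 2 0 u))) = oI 2 0 (oD 2 (Suc 0) u)"
  proof -
    have c: "ty 6 (oD 4 (Suc 0) (oD 2 0 u))" "ty 4 (oD 2 0 u)"
      using o_ty(3)[of 1 4 "oD 2 0 u"] o_ty(3)[of 0 2 u] Hom_u by simp_all
    have "oC 4 2 (oI 4 3 (oD 4 (Suc 0) (oD 2 0 u))) = oI 2 (Suc 0) (oD 2 0 u)"
      using o_commute(4)[of 1 3 4 "oD 2 0 u"] o_zig(2)[of 4 "oI 2 (Suc 0) (oD 2 0 u)" 1 2]
        o_ty(1)[of 1 2 "oD 2 0 u"] c by simp
    moreover have "oC 4 2 (oD 4 (Suc 0) (oD 2 0 u)) = oD 2 0 u"
      using o_zig(2)[of 4 "oD 2 0 u" 1 2] c by simp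
    moreover have "oC 4 3 (oD 4 (Suc 0) (oD 2 0 u)) = oD 2 (Suc 0) u"
      using o_commute(7)[of 1 3 4 "oD 2 0 u"] o_zig(2)[of 2 u 0 1] Hom_u by simp
    ultimately show ?thesis
      using o_R(2)[of 2 3 4 "oD 4 (Suc 0) (oD 2 0 u)"] o_R(3)[of 0 1 2 u] by simp
  qed
  ultimately show ?thesis by (simp add: o_linear)
qed

lemma hI2cup1:
  assumes "ty 4 x"
  shows "oC 4 3 (oI 4 2 (oD 4 (Suc 0) x)) = oI 2 (Suc 0) x + x - oD 2 (Suc 0) (oC 2 (Suc 0) x)"
proof -
  have "oC 4 2 (oI 4 3 (oD 4 (Suc 0) x)) = oI 2 (Suc 0) x"
    using o_commute(4)[of 1 3 4 x] o_zig(2)[of 4 "oI 2 (Suc 0) x" 1 2] o_ty(1)[of 1 2 x] assms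
    by simp
  then show ?thesis
    using o_R(2)[of 2 3 4 "oD 4 (Suc 0) x"] o_zig(2)[of 4 x 1 2] o_commute(7)[of 1 3 4 x] assms
    by simp
qed

lemma h_I0_I2: "ty 4 x \<Longrightarrow>
    oC 4 3 (oI 4 0 (oI 4 2 (oD 4 (Suc 0) x))) = oI 2 0 (oI 2 (Suc 0) x + x - oD 2 (Suc 0) (oC 2 (Suc 0) x))"
  using o_commute(3)[of 0 3 4 "oI 4 2 (oD 4 (Suc 0) x)"] by (simp add: hI2cup1)

lemma hX'U: "oC 4 3 (oI 4 0 (oI 4 2 (oD 4 (Suc 0) (oC 4 (Suc 0) (oI 4 4 (oD 4 3 (oD 2 2 u))))))) =
    ((1 - B) * B) *\<^sub>K oD 2 2 u + (1 - B - \<kappa>) *\<^sub>K oI 2 0 (oD 2 (Suc 0) u)"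
proof -
  let ?x = "oI 2 2 (oD 2 (Suc 0) u)"
  have x: "ty 4 ?x"
    using o_ty(1)[of 2 2 "oD 2 (Suc 0) u"] o_ty(3)[of 1 2 u] Hom_u by simp
  have 1: "oC 4 (Suc 0) (oI 4 4 (oD 4 3 (oD 2 2 u))) = ?x"
    using o_commute(2)[of 1 4 4] o_commute(6)[of 1 3 4 "oD 2 2 u"] o_zig(1)[of 2 u 1 2] Hom_u
    by simp
  have 2: "oI 2 (Suc 0) ?x = (1 - B) *\<^sub>K oI 2 (Suc 0) (oD 2 2 u)"
    using o_R(3)[of 1 2 2 u] by (simp add: o_simps o_linear mor.scale_left_diff_distrib)
  have 3: "oC 2 (Suc 0) ?x = \<kappa> *\<^sub>K u"
    using o_R(1)[of 1 2 2 "oD 2 (Suc 0) u"] o_zig(2)[of 2 u 1 2] o_loop[of 2 u 1] Hom_u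
    by (simp add: o_simps o_linear \<kappa>_def mor.scale_left_diff_distrib)
  show ?thesis
    by (simp add: 1 h_I0_I2[OF x] 2 3 o_linear I0_I2_cup1_u I0_I1_cup2_u mor.scale_right_distrib
        mor.scale_left_diff_distrib algebra_simps)
qed

lemma x_X: "oC 4 (Suc 0) (oI 4 2 (oI 4 4 (oD 4 3 w))) = oI 2 2 (oI 2 (Suc 0) w)"
proof -
  have "oC 4 (Suc 0) (oI 4 2 (oD 4 3 w)) = oI 2 (Suc 0) w + w"
    using o_R(1)[of 1 2 4 "oD 4 3 w"] o_commute(5)[of 1 3 4 w] o_zig(1)[of 4 "oI 2 (Suc 0) w" 2 3] o_ty(1)[of 1 2 w]
      o_zig(1)[of 4 w 2 3] o_commute(6)[of 1 3 4 w] Hom_w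
    by (simp add: C_w o_linear)
  then show ?thesis
    using o_commute(1)[of 2 4 4 "oD 4 3 w"] o_commute(2)[of 1 4 4 "oI 4 2 (oD 4 3 w)"]
    by (simp add: I2_w o_linear)
qed

lemma hU'X: "oC 2 0 (oC 4 (Suc 0) (oI 4 2 (oI 4 4 (oD 4 3 w)))) = 0"
proof -
  have "oC 2 0 (oI 2 (Suc 0) w) = 0"
    using o_R(1)[of 0 1 2 w] by (simp add: I0_w C_w o_linear)
  then show ?thesis
    using o_commute(2)[of 0 2 2 "oI 2 (Suc 0) w"] by (simp add: x_X o_linear)
qed

lemma hX'X: "oC 4 3 (oI 4 0 (oI 4 2 (oD 4 (Suc 0) (oC 4 (Suc 0) (oI 4 2 (oI 4 4 (oD 4 3 w))))))) =
    (B * B) *\<^sub>K w - B *\<^sub>K oD 2 2 u - B *\<^sub>K oI 2 0 (oD 2 (Suc 0) u)"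
proof -
  let ?x = "oI 2 2 (oI 2 (Suc 0) w)"
  have x: "ty 4 ?x"
    using o_ty(1)[of 2 2 "oI 2 (Suc 0) w"] o_ty(1)[of 1 2 w] Hom_w by simp
  have 0: "oC 2 2 (oI 2 (Suc 0) w) = - u"
    using o_R(2)[of 1 2 2 w] by (simp add: I2_w C_w u_def o_linear)
  have 1: "oC 2 (Suc 0) ?x = - ((1 - B) *\<^sub>K u)"
    using o_R(1)[of 1 2 2 "oI 2 (Suc 0) w"]
    by (simp add: o_simps o_linear 0 mor.scale_left_diff_distrib)
  have 2: "oI 2 (Suc 0) ?x = B *\<^sub>K oI 2 (Suc 0) w - oI 2 (Suc 0) (oD 2 2 u)"
    using o_III(1)[of 1 2 2 w] by (simp add: 0 o_linear)
  have 3: "oI 2 0 ?x = 0"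
    using o_commute(1)[of 0 2 2 "oI 2 (Suc 0) w"] by (simp add: I0_I1_w I2_w o_linear)
  show ?thesis
    by (simp add: x_X h_I0_I2[OF x] 1 2 3 o_linear I0_I1_w I0_I1_cup2_u mor.scale_right_distrib
        mor.scale_right_diff_distrib mor.scale_left_diff_distrib algebra_simps)
qed

end

end

section \<open>Coefficients\<close>

text \<open>This is q + 1/q = [4]/[2], the multiplier in the recurrence with step two. The scalars
  of the web relations used below are polynomials in it.\<close>

definition qc :: scalar where "qc = q_half powi 2 + q_half powi (- 2)"

lemma qint_1_denominator: "q_half powi 1 - q_half powi (- 1) \<noteq> 0"
  using q_half_powi_neq[of 1] by simp

lemma qint_step1: "qint (k + 1) + qint (k - 1) = qint 2 * qint k"
proof -
  define h where "h = q_half"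
  have h: "h \<noteq> 0" "h powi 1 - h powi (- 1) \<noteq> 0"
    using q_half_neq_0 qint_1_denominator by (simp_all add: h_def)
  have "h powi (k + 1) - h powi (- (k + 1)) + (h powi (k - 1) - h powi (- (k - 1))) =
    (h powi 1 + h powi (- 1)) * (h powi k - h powi (- k))"
    using h(1) by (simp add: power_int_add power_int_diff power_int_minus field_simps)
  moreover have "h powi 2 - h powi (- 2) = (h powi 1 + h powi (- 1)) * (h powi 1 - h powi (- 1))"
    using h(1) by (simp add: power_int_minus field_simps power2_eq_square)
  ultimately show ?thesis
    using h(2) unfolding qint_def h_def[symmetric] add_divide_distrib[symmetric] by simp
qed

lemma qint_step2: "qint (k + 2) + qint (k - 2) = qc * qint k"
proof -
  define h where "h = q_half"
  have h: "h \<noteq> 0" using q_half_neq_0 by (simp add: h_def)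
  have "h powi (k + 2) - h powi (- (k + 2)) + (h powi (k - 2) - h powi (- (k - 2))) =
    (h powi 2 + h powi (- 2)) * (h powi k - h powi (- k))"
    using h by (simp add: power_int_add power_int_diff power_int_minus field_simps)
  then show ?thesis
    unfolding qint_def qc_def h_def[symmetric] add_divide_distrib[symmetric] by simp
qed

lemma qint_0 [simp]: "qint 0 = 0"
  by (simp add: qint_def)

lemma qint_1 [simp]: "qint 1 = 1"
  using qint_1_denominator by (simp add: qint_def)

lemma qint_minus: "qint (- k) = - qint k"
  by (simp add: qint_def minus_divide_left)

lemma qint_3: "qint 3 = qc + 1"
  using qint_step2[of 1] qint_minus[of 1] by (simp add: algebra_simps)

lemma B_qc: "B = qc + 2"
  using qint_step1[of 2] by (simp add: B_def power2_eq_square qint_3 algebra_simps)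

lemma qint_4: "qint 4 = qc * qint 2"
  using qint_step2[of 2] by simp

lemma qint_6: "qint 6 = (qc * qc - 1) * qint 2"
  using qint_step2[of 4] by (simp add: qint_4 algebra_simps)

lemma \<kappa>_qc: "\<kappa> = qc * qc + qc - 1"
proof -
  have "qc + 1 \<noteq> 0" using qint_neq_0[of 3] by (simp add: qint_3)
  \<comment> \<open>The factor \<open>qc + 1\<close> is [3], which cancels the denominator of the
    loop value.\<close>
  moreover have "qint 6 * qint 2 = (qc + 1) * ((qc - 1) * (qc + 2))"
    using B_qc by (simp add: qint_6 B_def power2_eq_square algebra_simps)
  ultimately have "qint 6 * qint 2 / qint 3 = (qc - 1) * (qc + 2)" by (simp add: qint_3)
  then show ?thesis by (simp add: \<kappa>_def \<delta>_def algebra_simps)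
qed

definition coefU :: "nat \<Rightarrow> scalar"
  where "coefU n = qint (2 * int n - 1) * qint (2 * int n - 2) / (qint (2 * int n + 1) * qint (2 * int n))"

definition coefX :: "nat \<Rightarrow> scalar"
  where "coefX n = qint (2 * int n - 2) / (qint (2 * int n) * qint 2 * qint 2)"

text \<open>These are the hypotheses of \<open>last_three\<close>. With denominators cleared, the
  first and third are instances of the recurrence with step two, while the second mixes both
  recurrences. For n = 2 the primed coefficients vanish because [0] = 0, which gives the hypotheses
  of \<open>last_two\<close>.\<close>

lemma coef_equations:
  assumes "n \<ge> 2"
  defines "a \<equiv> coefU n" and "b \<equiv> coefX n" and "a' \<equiv> coefU (n - 1)" and "b' \<equiv> coefX (n - 1)"
  shows "1 + b * (1 - B - \<kappa>) + b * b' * (B * B) = 0"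
    and "a * \<kappa> / B + a * b' * (1 - B) + b * (1 - B) + b * b' * B = 0"
    and "a * a' / B + a * b' * (1 - B - \<kappa>) / B + b * b' * B = 0"
proof -
  define x0 x1 x2 x3 x4 y1 where "x0 = qint (2 * int n)" and "x1 = qint (2 * int n - 1)"
    and "x2 = qint (2 * int n - 2)" and "x3 = qint (2 * int n - 3)" and "x4 = qint (2 * int n - 4)"
    and "y1 = qint (2 * int n + 1)"
  note x_defs = this
  have nz: "x0 \<noteq> 0" "x1 \<noteq> 0" "x2 \<noteq> 0" "y1 \<noteq> 0"
    using assms(1) by (auto simp: x_defs intro!: qint_neq_0)
  have r1: "x0 + x4 = qc * x2" using qint_step2[of "2 * int n - 2"] by (simp add: x_defs)
  have r2: "y1 + x3 = qc * x1" using qint_step2[of "2 * int n - 1"] by (simp add: x_defs add.commute)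
  have r3: "x2 + x0 = qint 2 * x1" using qint_step1[of "2 * int n - 1"] by (simp add: x_defs add.commute)
  have e: "qint (2 * int n + 2) + x0 = qint 2 * y1" "qint (2 * int n + 2) + x2 = qc * x0"
    using qint_step1[of "2 * int n + 1"] qint_step2[of "2 * int n"] by (simp_all add: x_defs add.commute)
  have "(qc + 1) * x0 - x2 = qc * x0 + x0 - x2" by (simp add: distrib_right)
  also have "\<dots> = qint (2 * int n + 2) + x2 + x0 - x2" by (simp only: e(2))
  also have "\<dots> = qint (2 * int n + 2) + x0" by simp
  finally have r4: "(qc + 1) * x0 - x2 = qint 2 * y1" by (simp only: e(1))
  have i: "2 * int (n - 1) = 2 * int n - 2" using assms(1) by (simp add: of_nat_diff)
  have a: "a = x1 * x2 / (y1 * x0)" by (simp add: a_def coefU_def x_defs)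
  have b: "b = x2 / (x0 * B)" by (simp add: b_def coefX_def x_defs B_def power2_eq_square mult.assoc)
  have a': "a' = x3 * x4 / (x1 * x2)"
    unfolding a'_def coefU_def i by (simp add: x_defs algebra_simps)
  have b': "b' = x4 / (x2 * B)"
    unfolding b'_def coefX_def i by (simp add: x_defs B_def power2_eq_square mult.assoc)
  have k: "1 - B - \<kappa> = - (qc * B)" by (simp add: B_qc \<kappa>_qc algebra_simps)
  have "x0 - qc * x2 + x4 = 0" using r1 by (simp add: algebra_simps)
  then have "(x0 - qc * x2 + x4) / x0 = 0" by simp
  then show "1 + b * (1 - B - \<kappa>) + b * b' * (B * B) = 0"
    using nz unfolding k b b' by (simp add: field_simps)
  have "(x3 + y1 - qc * x1) * x4 / (x0 * y1 * B) = 0" using r2 by (simp add: algebra_simps)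
  then show "a * a' / B + a * b' * (1 - B - \<kappa>) / B + b * b' * B = 0"
    using nz unfolding k a b a' b' by (simp add: field_simps)
  have x4: "x4 = qc * x2 - x0" using r1 by (simp add: algebra_simps)
  \<comment> \<open>Eliminating \<open>x4\<close> leaves a difference of two products, both equal to
    [2] times \<open>x1 * y1\<close> by \<open>r4\<close> and \<open>r3\<close>.\<close>
  have "\<kappa> * x1 * x2 + x1 * x4 * (1 - B) + x2 * y1 * (1 - B) + x4 * y1 =
      x1 * ((qc + 1) * x0 - x2) - y1 * (x2 + x0)"
    by (simp add: x4 B_qc \<kappa>_qc algebra_simps)
  also have "\<dots> = 0" by (simp add: r3 r4)
  finally have *: "\<kappa> * x1 * x2 + x1 * x4 * (1 - B) + x2 * y1 * (1 - B) + x4 * y1 = 0" .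
  have "a * \<kappa> / B + a * b' * (1 - B) + b * (1 - B) + b * b' * B =
      (\<kappa> * x1 * x2 + x1 * x4 * (1 - B) + x2 * y1 * (1 - B) + x4 * y1) / (x0 * y1 * B)"
    using nz unfolding a b b' by (simp add: field_simps)
  then show "a * \<kappa> / B + a * b' * (1 - B) + b * (1 - B) + b * b' * B = 0"
    by (simp only: *) simp
qed

section \<open>The cup-cap web and the tetravalent vertex on single strands\<close>

lemma to_singles_22: "to_singles [Double, Double] = pad [Single, Single] spl [] \<circ>\<^sub>w pad [] spl [Double]"
  using tensor_eq_comp[OF Hom_spl Hom_spl] by (simp add: pad_def)

lemma Hom_U2: "U2 \<in> Hom [Double, Double] [Double, Double]"
  unfolding U2_def by (intro Hom_web is_diagram_local_webs)

lemma Hom_X2: "X2 \<in> Hom [Double, Double] [Double, Double]"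
  unfolding X2_def by (intro Hom_web is_diagram_local_webs)

lemma U2_eval: "U2 = cupe Double \<circ>\<^sub>w cape Double"
  unfolding U2_def by (simp add: web_eval is_diagram_local_webs)

lemma X2_eval: "X2 = pad [Double] mrg [] \<circ>\<^sub>w (pad [] mrg [Single, Single] \<circ>\<^sub>w
    (pad [Single] (cupe Single) [Single] \<circ>\<^sub>w (pad [Single] (cape Single) [Single] \<circ>\<^sub>w to_singles [Double, Double])))"
  unfolding X2_def by (simp add: web_eval is_diagram_local_webs to_singles_22 wcomp_assoc del: to_singles.simps)

text \<open>Splitting the top of the square web turns its two upper corners into I. For the cup-cap
  web the lower cap has to be opened by a bigon, so its lift is \<open>U_singles\<close> only up to
  the factor -1/B.\<close>

definition X_singles :: mor where "X_singles = cI 2 0 \<circ>\<^sub>w (cI 2 2 \<circ>\<^sub>w (ccup 2 1 \<circ>\<^sub>w ccap 2 1))"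
definition U_singles :: mor where "U_singles = cI 2 2 \<circ>\<^sub>w (ccup 2 1 \<circ>\<^sub>w (ccup 0 0 \<circ>\<^sub>w (ccap 0 0 \<circ>\<^sub>w ccap 2 1)))"

lemma op_at_2: "op_at x 2 0 = pad [] x [Single, Single]" "op_at x 2 2 = pad [Single, Single] x []"
    "op_at x 2 1 = pad [Single] x [Single]" "op_at x 0 0 = x"
  by (simp_all add: op_at_def numeral_2_eq_2)

lemma to_singles_X2: "to_singles [Double, Double] \<circ>\<^sub>w X2 = X_singles \<circ>\<^sub>w to_singles [Double, Double]"
proof -
  have 1: "pad [] spl [Double] \<circ>\<^sub>w pad [Double] mrg [] = pad [Single, Single] mrg [] \<circ>\<^sub>w pad [] spl [Single, Single]"
    using pad_commute[OF Hom_spl Hom_mrg, of "[]" "[]" "[]"] by simp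
  have 2: "cI 2 2 \<circ>\<^sub>w cI 2 0 = cI 2 0 \<circ>\<^sub>w cI 2 2"
    using I_I_commute[of 0 0 0] by (simp add: numeral_2_eq_2)
  have "to_singles [Double, Double] \<circ>\<^sub>w X2 = cI 2 2 \<circ>\<^sub>w (cI 2 0 \<circ>\<^sub>w
      (ccup 2 1 \<circ>\<^sub>w (ccap 2 1 \<circ>\<^sub>w to_singles [Double, Double])))"
    by (simp only: X2_eval op_at_2 II_def pad_comp wcomp_assoc)
      (simp only: to_singles_22 wcomp_assoc 1[THEN comp_eq_assoc])
  then show ?thesis by (simp only: X_singles_def wcomp_assoc 2[THEN comp_eq_assoc])
qed

lemma to_singles_U2: "to_singles [Double, Double] \<circ>\<^sub>w U2 = ((- inverse B) *\<^sub>K U_singles) \<circ>\<^sub>w to_singles [Double, Double]"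
proof -
  have "to_singles [Double, Double] \<circ>\<^sub>w cupe Double = cI 2 2 \<circ>\<^sub>w (ccup 2 1 \<circ>\<^sub>w ccup 0 0)"
    by (simp only: to_singles_22 wcomp_assoc cup_double_left op_at_2 II_def pad_comp)
  moreover have "cape Double = (- inverse B) *\<^sub>K (ccap 0 0 \<circ>\<^sub>w (ccap 2 1 \<circ>\<^sub>w to_singles [Double, Double]))"
  proof -
    have "cape Double = (- inverse B) *\<^sub>K - (B *\<^sub>K cape Double)" by simp
    then show ?thesis by (simp only: cap_double to_singles_22 op_at_2 wcomp_assoc)
  qed
  ultimately show ?thesis
    unfolding U2_eval wcomp_assoc[symmetric] by (simp add: U_singles_def wcomp_assoc)
qed

text \<open>The lower half of the square web. The double cap factors through it as well, so a
  morphism killed by it is killed by both correction webs.\<close>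

definition inner_cap :: mor where "inner_cap = ccap 2 1 \<circ>\<^sub>w to_singles [Double, Double]"

lemma Hom_4: "X_singles \<in> Hom (S 4) (S 4)" "U_singles \<in> Hom (S 4) (S 4)" "ccap 2 1 \<in> Hom (S 4) (S 2)"
proof -
  have o: "cI 2 0 \<in> Hom (S 4) (S 4)" "cI 2 2 \<in> Hom (S 4) (S 4)" "ccup 2 1 \<in> Hom (S 2) (S 4)"
    "ccap 2 1 \<in> Hom (S 4) (S 2)" "ccup 0 0 \<in> Hom (S 0) (S 2)" "ccap 0 0 \<in> Hom (S 2) (S 0)"
    using Hom_ops[of 0 2] Hom_ops[of 1 2] Hom_ops[of 2 2] Hom_ops[of 0 0] by (simp_all add: numeral_eq_Suc)
  show "X_singles \<in> Hom (S 4) (S 4)" "U_singles \<in> Hom (S 4) (S 4)" "ccap 2 1 \<in> Hom (S 4) (S 2)"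
    unfolding X_singles_def U_singles_def by (intro Hom_comp[OF o(1)] Hom_comp[OF o(2)] Hom_comp[OF o(3)] Hom_comp[OF o(5)]
      Hom_comp[OF o(6)] o(4))+
qed

lemma Hom_inner_cap: "inner_cap \<in> Hom [Double, Double] [Single, Single]"
  using Hom_comp[OF Hom_4(3), of "to_singles [Double, Double]" "[Double, Double]"] Hom_to_singles[of "[Double, Double]"]
  by (simp add: inner_cap_def numeral_eq_Suc)

lemma op_at_op_at: "i \<le> m \<Longrightarrow> op_at (op_at x m i) (P + d) P = op_at x (P + (m + d)) (P + i)"
  using pad_op_at[of i m P x d] by (simp add: op_at_def[of "op_at x m i"] ac_simps)

lemma to_singles_pads:
  fixes u v :: word
  defines "P \<equiv> deg u" and "m \<equiv> 2 + deg v" and "w \<equiv> u @ [Double, Double] @ v"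
  shows "to_singles w \<circ>\<^sub>w (pad u X2 v \<circ>\<^sub>w x) = strands.oI P m 0 (strands.oI P m 2 (strands.oD P m 1
      (strands.oC P m 1 (to_singles w \<circ>\<^sub>w x))))"
    and "to_singles w \<circ>\<^sub>w (pad u U2 v \<circ>\<^sub>w x) = (- inverse B) *\<^sub>K strands.oI P m 2 (strands.oD P m 1
      (strands.oD P (deg v) 0 (strands.oC P (deg v) 0 (strands.oC P m 1 (to_singles w \<circ>\<^sub>w x)))))"
    and "to_singles (u @ [Single, Single] @ v) \<circ>\<^sub>w (pad u inner_cap v \<circ>\<^sub>w x) = strands.oC P m 1 (to_singles w \<circ>\<^sub>w x)"
proof -
  have d: "deg [Double, Double] = 4" by simp
  have "X_singles \<in> Hom (S (deg [Double, Double])) (S (deg [Double, Double]))"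
    "(- inverse B) *\<^sub>K U_singles \<in> Hom (S (deg [Double, Double])) (S (deg [Double, Double]))"
    "ccap 2 1 \<in> Hom (S (deg [Double, Double])) (S (deg [Single, Single]))"
    using Hom_4 by (auto simp: numeral_eq_Suc intro: Hom_closed simp del: replicate_Suc)
  note h = this
  have e: "to_singles [Single, Single] \<circ>\<^sub>w inner_cap = ccap 2 1 \<circ>\<^sub>w to_singles [Double, Double]"
    using id_comp[OF Hom_inner_cap] by (simp add: inner_cap_def)
  show "to_singles w \<circ>\<^sub>w (pad u X2 v \<circ>\<^sub>w x) = strands.oI P m 0 (strands.oI P m 2 (strands.oD P m 1
      (strands.oC P m 1 (to_singles w \<circ>\<^sub>w x))))"
    using arg_cong[OF to_singles_pad[OF Hom_X2 h(1) to_singles_X2, of u v], of "\<lambda>y. y \<circ>\<^sub>w x"]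
    by (simp add: X_singles_def op_at_comp op_at_op_at wcomp_assoc strands.o_defs P_def m_def w_def)
  show "to_singles w \<circ>\<^sub>w (pad u U2 v \<circ>\<^sub>w x) = (- inverse B) *\<^sub>K strands.oI P m 2 (strands.oD P m 1
      (strands.oD P (deg v) 0 (strands.oC P (deg v) 0 (strands.oC P m 1 (to_singles w \<circ>\<^sub>w x)))))"
    using arg_cong[OF to_singles_pad[OF Hom_U2 h(2) to_singles_U2, of u v], of "\<lambda>y. y \<circ>\<^sub>w x"]
    by (simp add: U_singles_def op_at_comp op_at_op_at op_at_linear wcomp_assoc strands.o_defs P_def m_def w_def)
  show "to_singles (u @ [Single, Single] @ v) \<circ>\<^sub>w (pad u inner_cap v \<circ>\<^sub>w x) = strands.oC P m 1 (to_singles w \<circ>\<^sub>w x)"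
    using arg_cong[OF to_singles_pad[OF Hom_inner_cap h(3) e, of u v], of "\<lambda>y. y \<circ>\<^sub>w x"]
    by (simp add: op_at_op_at wcomp_assoc strands.o_defs P_def m_def w_def)
qed

lemma strands_to_singles_I: "strands.oI (deg u) (deg v + deg w) (deg v) (to_singles (u @ v @ [Double] @ w) \<circ>\<^sub>w x) =
    - (B *\<^sub>K (to_singles (u @ v @ [Double] @ w) \<circ>\<^sub>w x))"
  using comp_eq_assoc[OF to_singles_I[of "u @ v" w], of x] by (simp add: strands.o_defs ac_simps)

section \<open>The recursion\<close>

abbreviation (input) "W n \<equiv> replicate n Double"

text \<open>Serves the clasp on two double strands: its predecessor is an identity, so there is no
  second expansion, and the coefficients of \<open>w\<close> and of the cup on \<open>u\<close> are
  the only ones to vanish.\<close>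

lemma last_two:
  assumes x: "x \<in> Hom s (W k @ [Double, Double])"
    and eqs: "1 + b * (1 - B - \<kappa>) = 0" "a * \<kappa> / B + b * (1 - B) = 0"
  shows "pad (W k) inner_cap [] \<circ>\<^sub>w (x + a *\<^sub>K (pad (W k) U2 [] \<circ>\<^sub>w x) + b *\<^sub>K (pad (W k) X2 [] \<circ>\<^sub>w x)) = 0"
proof -
  interpret strands "2 * k" s .
  let ?w = "W k @ [Double, Double]" and ?E = "pad (W k) inner_cap []"
  define v where "v = to_singles ?w \<circ>\<^sub>w x"
  define w where "w = oC 2 (Suc 0) v"
  define u where "u = oC 0 0 w"
  have "deg ?w = 2 * k + 4" by simp
  then have v: "ty 4 v" using Hom_comp[OF Hom_to_singles x] by (simp only: v_def ty_def)
  have I: "oI 2 0 v = - (B *\<^sub>K v)" "oI 2 2 v = - (B *\<^sub>K v)"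
    using strands_to_singles_I[of "W k" "[]" "[Double]" x] strands_to_singles_I[of "W k" "[Double]" "[]" x]
    by (simp_all add: v_def numeral_2_eq_2)
  note two = two_hU[OF v I] two_hX[OF v I]
  have e: "to_singles (W k @ [Single, Single]) \<circ>\<^sub>w (?E \<circ>\<^sub>w y) = oC 2 (Suc 0) (to_singles ?w \<circ>\<^sub>w y)" for y
    using to_singles_pads(3)[of "W k" "[]" y] by simp
  have X: "to_singles ?w \<circ>\<^sub>w (pad (W k) X2 [] \<circ>\<^sub>w x) = oI 2 0 (oI 2 2 (oD 2 (Suc 0) w))"
    using to_singles_pads(1)[of "W k" "[]" x] by (simp add: v_def w_def)
  have U: "to_singles ?w \<circ>\<^sub>w (pad (W k) U2 [] \<circ>\<^sub>w x) = (- inverse B) *\<^sub>K oI 2 2 (oD 2 (Suc 0) (oD 0 0 u))"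
    using to_singles_pads(2)[of "W k" "[]" x] by (simp add: v_def w_def u_def)
  have "to_singles (W k @ [Single, Single]) \<circ>\<^sub>w (?E \<circ>\<^sub>w (x + a *\<^sub>K (pad (W k) U2 [] \<circ>\<^sub>w x) + b *\<^sub>K (pad (W k) X2 [] \<circ>\<^sub>w x))) =
    w + (- (a * \<kappa> / B)) *\<^sub>K oD 0 0 u + b *\<^sub>K ((1 - B - \<kappa>) *\<^sub>K w - (1 - B) *\<^sub>K oD 0 0 u)"
    unfolding e by (simp add: comp_linear o_linear U X two[folded w_def u_def] v_def[symmetric] w_def[symmetric])
      (simp add: divide_inverse mult.commute mult.left_commute)
  also have "\<dots> = (1 + b * (1 - B - \<kappa>)) *\<^sub>K w - (a * \<kappa> / B + b * (1 - B)) *\<^sub>K oD 0 0 u"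
    by (simp add: mor.scale_left_distrib mor.scale_right_diff_distrib algebra_simps)
  also have "\<dots> = 0" by (simp add: eqs)
  finally have z: "to_singles (W k @ [Single, Single]) \<circ>\<^sub>w (?E \<circ>\<^sub>w (x + a *\<^sub>K (pad (W k) U2 [] \<circ>\<^sub>w x) +
      b *\<^sub>K (pad (W k) X2 [] \<circ>\<^sub>w x))) = to_singles (W k @ [Single, Single]) \<circ>\<^sub>w 0" by simp
  have h: "?E \<in> Hom ?w (W k @ [Single, Single])" "pad (W k) U2 [] \<in> Hom ?w ?w" "pad (W k) X2 [] \<in> Hom ?w ?w"
    using Hom_pad[OF Hom_inner_cap, of "W k" "[]"] Hom_pad[OF Hom_U2, of "W k" "[]"] Hom_pad[OF Hom_X2, of "W k" "[]"]
    by simp_all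
  show ?thesis
    by (rule to_singles_cancel[OF z, where s = s]) (intro Hom_comp[OF h(1)] Hom_comp[OF h(2)] Hom_comp[OF h(3)] Hom_closed x)+
qed

lemma collect_coefficients:
  "w + a *\<^sub>K ((- (i * k)) *\<^sub>K c + a' *\<^sub>K ((- i) *\<^sub>K r) + b' *\<^sub>K ((- e) *\<^sub>K c - (i * l) *\<^sub>K r)) +
    b *\<^sub>K (l *\<^sub>K w - e *\<^sub>K c + b' *\<^sub>K ((f * f) *\<^sub>K w - f *\<^sub>K c - f *\<^sub>K r)) =
  (1 + b * l + b * b' * (f * f)) *\<^sub>K w - (a * k * i + a * b' * e + b * e + b * b' * f) *\<^sub>K c -
    (a * a' * i + a * b' * l * i + b * b' * f) *\<^sub>K r"
  by (simp add: mor.scale_left_distrib mor.scale_right_diff_distrib mor.scale_right_distrib ac_simps)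

text \<open>
  Here \<open>D\<close> is the clasp two steps before. The three equations say that the coefficients of
  \<open>w\<close>, of a cup next to \<open>u\<close> and of I applied to such a cup vanish.
\<close>

lemma last_three:
  fixes k :: nat and a b a' b' :: scalar
  defines "A \<equiv> W k"
  defines "U \<equiv> pad (A @ [Double]) U2 []" and "X \<equiv> pad (A @ [Double]) X2 []"
    and "U' \<equiv> pad A U2 [Double]" and "X' \<equiv> pad A X2 [Double]" and "E \<equiv> pad (A @ [Double]) inner_cap []"
  assumes D: "D \<in> Hom (A @ [Double]) (A @ [Double])"
  defines "Q' \<equiv> pad [] D [Double, Double]"
  defines "Q \<equiv> Q' + a' *\<^sub>K (Q' \<circ>\<^sub>w (U' \<circ>\<^sub>w Q')) + b' *\<^sub>K (Q' \<circ>\<^sub>w (X' \<circ>\<^sub>w Q'))"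
  assumes x: "x \<in> Hom s (A @ [Double, Double, Double])" and Qx: "Q' \<circ>\<^sub>w x = x"
    and cap: "ccap (2 * k + 4) (Suc (2 * k)) \<circ>\<^sub>w (to_singles (A @ [Double, Double, Double]) \<circ>\<^sub>w x) = 0"
    and eqs: "1 + b * (1 - B - \<kappa>) + b * b' * (B * B) = 0"
      "a * \<kappa> / B + a * b' * (1 - B) + b * (1 - B) + b * b' * B = 0"
      "a * a' / B + a * b' * (1 - B - \<kappa>) / B + b * b' * B = 0"
  shows "E \<circ>\<^sub>w (x + a *\<^sub>K (Q \<circ>\<^sub>w (U \<circ>\<^sub>w x)) + b *\<^sub>K (Q \<circ>\<^sub>w (X \<circ>\<^sub>w x))) = 0"
proof -
  interpret strands "2 * k" s .
  let ?w = "A @ [Double, Double, Double]"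
  let ?t = "A @ [Double, Single, Single]"
  define v where "v = to_singles ?w \<circ>\<^sub>w x"
  define w where "w = oC 4 3 v"
  define u where "u = oC 2 2 w"
  have "deg ?w = 2 * k + 6" by (simp add: A_def)
  then have v: "ty 6 v" using Hom_comp[OF Hom_to_singles x] by (simp only: v_def ty_def)
  have I: "oI 4 0 v = - (B *\<^sub>K v)" "oI 4 2 v = - (B *\<^sub>K v)" "oI 4 4 v = - (B *\<^sub>K v)"
    using strands_to_singles_I[of A "[]" "[Double, Double]" x] strands_to_singles_I[of A "[Double]" "[Double]" x]
      strands_to_singles_I[of A "[Double, Double]" "[]" x]
    by (simp_all add: v_def A_def numeral_eq_Suc)
  have C: "oC 4 (Suc 0) v = 0" using cap by (simp add: oC_def v_def)
  note three = hU[OF v I C] hX[OF v I C] hU'U[OF v I C] hX'U[OF v I C] hU'X[OF v I C] hX'X[OF v I C]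
  note three = three[folded w_def, folded u_def]
  have e: "to_singles ?t \<circ>\<^sub>w (E \<circ>\<^sub>w y) = oC 4 3 (to_singles ?w \<circ>\<^sub>w y)" for y
    using to_singles_pads(3)[of "A @ [Double]" "[]" y]
    by (simp add: E_def A_def strands.o_defs) (simp add: o_defs numeral_eq_Suc)
  have X: "to_singles ?w \<circ>\<^sub>w (X \<circ>\<^sub>w x) = oI 4 2 (oI 4 4 (oD 4 3 w))"
    using to_singles_pads(1)[of "A @ [Double]" "[]" x]
    by (simp add: X_def A_def strands.o_defs v_def w_def) (simp add: o_defs numeral_eq_Suc)
  have U: "to_singles ?w \<circ>\<^sub>w (U \<circ>\<^sub>w x) = (- inverse B) *\<^sub>K oI 4 4 (oD 4 3 (oD 2 2 u))"
    using to_singles_pads(2)[of "A @ [Double]" "[]" x]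
    by (simp add: U_def A_def strands.o_defs v_def w_def u_def) (simp add: o_defs numeral_eq_Suc)
  have X': "to_singles ?w \<circ>\<^sub>w (X' \<circ>\<^sub>w y) = oI 4 0 (oI 4 2 (oD 4 (Suc 0) (oC 4 (Suc 0) (to_singles ?w \<circ>\<^sub>w y))))" for y
    using to_singles_pads(1)[of A "[Double]" y]
    by (simp add: X'_def A_def strands.o_defs)
  have U': "to_singles ?w \<circ>\<^sub>w (U' \<circ>\<^sub>w y) = (- inverse B) *\<^sub>K oI 4 2 (oD 4 (Suc 0) (oD 2 0 (oC 2 0
      (oC 4 (Suc 0) (to_singles ?w \<circ>\<^sub>w y)))))" for y
    using to_singles_pads(2)[of A "[Double]" y]
    by (simp add: U'_def A_def strands.o_defs)
  \<comment> \<open>\<open>Q'\<close> acts on strands disjoint from \<open>U\<close>,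
    \<open>X\<close> and the cap in \<open>E\<close>, and it fixes \<open>x\<close>. The expression
    in the claim is therefore \<open>Q'\<close> applied to \<open>?L\<close>, and \<open>E\<close>
    can be applied to \<open>?L\<close> before the projection.\<close>
  let ?L = "x + a *\<^sub>K (U \<circ>\<^sub>w x + a' *\<^sub>K (U' \<circ>\<^sub>w (U \<circ>\<^sub>w x)) + b' *\<^sub>K (X' \<circ>\<^sub>w (U \<circ>\<^sub>w x))) +
    b *\<^sub>K (X \<circ>\<^sub>w x + a' *\<^sub>K (U' \<circ>\<^sub>w (X \<circ>\<^sub>w x)) + b' *\<^sub>K (X' \<circ>\<^sub>w (X \<circ>\<^sub>w x)))"
  let ?c = "oD 2 2 u" and ?r = "oI 2 0 (oD 2 (Suc 0) u)"
  have i: "(- inverse B) *\<^sub>K (((1 - B) * B) *\<^sub>K y + l *\<^sub>K z) = (- (1 - B)) *\<^sub>K y - (inverse B * l) *\<^sub>K z" for y z l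
  proof -
    have "- inverse B * ((1 - B) * B) = - (1 - B)" by (simp add: field_simps)
    then show ?thesis by (simp only: mor.scale_right_distrib mor.scale_scale) simp
  qed
  have "to_singles ?t \<circ>\<^sub>w (E \<circ>\<^sub>w ?L) = w + a *\<^sub>K ((- inverse B) *\<^sub>K (\<kappa> *\<^sub>K ?c) +
      a' *\<^sub>K ((- inverse B) *\<^sub>K ((- inverse B) *\<^sub>K (- (B *\<^sub>K ?r)))) +
      b' *\<^sub>K ((- inverse B) *\<^sub>K (((1 - B) * B) *\<^sub>K ?c + (1 - B - \<kappa>) *\<^sub>K ?r))) +
    b *\<^sub>K ((1 - B - \<kappa>) *\<^sub>K w - (1 - B) *\<^sub>K ?c + a' *\<^sub>K ((- inverse B) *\<^sub>K 0) +
      b' *\<^sub>K ((B * B) *\<^sub>K w - B *\<^sub>K ?c - B *\<^sub>K ?r))"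
    unfolding e by (simp only: comp_linear comp_scale_right o_linear U X U' X' three v_def[symmetric] w_def[symmetric])
  also have "\<dots> = w + a *\<^sub>K ((- (inverse B * \<kappa>)) *\<^sub>K ?c + a' *\<^sub>K ((- inverse B) *\<^sub>K ?r) +
      b' *\<^sub>K ((- (1 - B)) *\<^sub>K ?c - (inverse B * (1 - B - \<kappa>)) *\<^sub>K ?r)) +
    b *\<^sub>K ((1 - B - \<kappa>) *\<^sub>K w - (1 - B) *\<^sub>K ?c + b' *\<^sub>K ((B * B) *\<^sub>K w - B *\<^sub>K ?c - B *\<^sub>K ?r))"
    unfolding i by simp
  also have "\<dots> = 0"
    unfolding collect_coefficients using eqs by (simp add: divide_inverse)
  finally have z: "to_singles ?t \<circ>\<^sub>w (E \<circ>\<^sub>w ?L) = to_singles ?t \<circ>\<^sub>w 0" by simp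
  have hE: "E \<in> Hom ?w ?t" using Hom_pad[OF Hom_inner_cap, of "A @ [Double]" "[]"] by (simp add: E_def)
  have h: "U \<in> Hom ?w ?w" "X \<in> Hom ?w ?w" "U' \<in> Hom ?w ?w" "X' \<in> Hom ?w ?w"
    using Hom_pad[OF Hom_U2, of "A @ [Double]" "[]"] Hom_pad[OF Hom_X2, of "A @ [Double]" "[]"]
      Hom_pad[OF Hom_U2, of A "[Double]"] Hom_pad[OF Hom_X2, of A "[Double]"]
    by (simp_all add: U_def X_def U'_def X'_def)
  have L: "?L \<in> Hom s ?w"
    by (intro Hom_closed Hom_comp[OF h(1)] Hom_comp[OF h(2)] Hom_comp[OF h(3)] Hom_comp[OF h(4)] x)
  have EL: "E \<circ>\<^sub>w ?L = 0"
    by (rule to_singles_cancel[OF z, where s = s]) (intro Hom_comp[OF hE] L Hom_closed)+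
  have cU: "Q' \<circ>\<^sub>w U = U \<circ>\<^sub>w Q'" and cX: "Q' \<circ>\<^sub>w X = X \<circ>\<^sub>w Q'" and cE: "E \<circ>\<^sub>w Q' = pad [] D [Single, Single] \<circ>\<^sub>w E"
    using pad_commute[OF D Hom_U2, of "[]" "[]" "[]"] pad_commute[OF D Hom_X2, of "[]" "[]" "[]"]
      pad_commute[OF D Hom_inner_cap, of "[]" "[]" "[]"]
    by (simp_all add: Q'_def U_def X_def E_def)
  have "x + a *\<^sub>K (Q \<circ>\<^sub>w (U \<circ>\<^sub>w x)) + b *\<^sub>K (Q \<circ>\<^sub>w (X \<circ>\<^sub>w x)) = Q' \<circ>\<^sub>w ?L"
    by (simp add: Q_def comp_linear wcomp_assoc Qx cU[THEN comp_eq_assoc] cX[THEN comp_eq_assoc])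
  then have "E \<circ>\<^sub>w (x + a *\<^sub>K (Q \<circ>\<^sub>w (U \<circ>\<^sub>w x)) + b *\<^sub>K (Q \<circ>\<^sub>w (X \<circ>\<^sub>w x))) = pad [] D [Single, Single] \<circ>\<^sub>w (E \<circ>\<^sub>w ?L)"
    by (simp only: cE[THEN comp_eq_assoc] wcomp_assoc)
  then show ?thesis by (simp only: EL comp_zero)
qed

section \<open>The recursively defined idempotents\<close>

fun clasp :: "nat \<Rightarrow> mor" where
  "clasp 0 = id_web []"
| "clasp (Suc 0) = id_web [Double]"
| "clasp (Suc (Suc n)) = (let Q = pad [] (clasp (Suc n)) [Double] in
    Q + coefU (n + 2) *\<^sub>K (Q \<circ>\<^sub>w (pad (W n) U2 [] \<circ>\<^sub>w Q)) +
      coefX (n + 2) *\<^sub>K (Q \<circ>\<^sub>w (pad (W n) X2 [] \<circ>\<^sub>w Q)))"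

lemma W_Suc: "W (Suc n) = W n @ [Double]" "W (Suc (Suc n)) = W n @ [Double, Double]"
  by (simp_all add: replicate_append_same[symmetric])

lemma Hom_clasp: "clasp n \<in> Hom (W n) (W n)"
proof (induction n rule: clasp.induct)
  case (3 n)
  have "pad [] (clasp (Suc n)) [Double] \<in> Hom (W n @ [Double, Double]) (W n @ [Double, Double])"
    using Hom_pad[OF 3, of "[]" "[Double]"] by (simp add: replicate_append_same[symmetric])
  moreover have "pad (W n) U2 [] \<in> Hom (W n @ [Double, Double]) (W n @ [Double, Double])"
    "pad (W n) X2 [] \<in> Hom (W n @ [Double, Double]) (W n @ [Double, Double])"
    using Hom_pad[OF Hom_U2, of "W n" "[]"] Hom_pad[OF Hom_X2, of "W n" "[]"] by simp_all
  ultimately show ?case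
    unfolding clasp.simps Let_def W_Suc(2)
    by (intro Hom_closed) (auto intro: Hom_comp)
qed simp_all

text \<open>An odd position straddles two neighbouring double strands; at even positions caps vanish
  on every image of \<open>to_singles\<close>.\<close>

definition cap_free :: "nat \<Rightarrow> mor \<Rightarrow> bool"
  where "cap_free n x \<longleftrightarrow> (\<forall>i. Suc i < n \<longrightarrow> ccap (2 * n - 2) (Suc (2 * i)) \<circ>\<^sub>w (to_singles (W n) \<circ>\<^sub>w x) = 0)"

lemma cap_free_pad:
  assumes "cap_free n x" "x \<in> Hom (W n) (W n)" "Suc i < n"
  shows "ccap (2 * n) (Suc (2 * i)) \<circ>\<^sub>w (to_singles (W (Suc n)) \<circ>\<^sub>w pad [] x [Double]) = 0"
proof -
  have "pad (S 0) (ccap (2 * n - 2) (Suc (2 * i))) (S 2) = ccap (0 + (2 * n - 2) + 2) (0 + Suc (2 * i))"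
    by (rule pad_op_at) (use assms(3) in simp)
  moreover have "0 + (2 * n - 2) + 2 = 2 * n" using assms(3) by simp
  ultimately have c: "ccap (2 * n) (Suc (2 * i)) = pad [] (ccap (2 * n - 2) (Suc (2 * i))) (S 2)"
    by (simp only:) simp
  have "ccap (2 * n - 2) (Suc (2 * i)) \<in> Hom (S (2 * n - 2 + 2)) (S (2 * n - 2))"
    by (rule Hom_ops) (use assms(3) in simp)
  then have h: "ccap (2 * n - 2) (Suc (2 * i)) \<in> Hom (S (2 * n)) (S (2 * n - 2))"
  proof -
    assume "ccap (2 * n - 2) (Suc (2 * i)) \<in> Hom (S (2 * n - 2 + 2)) (S (2 * n - 2))"
    moreover have "2 * n - 2 + 2 = 2 * n" using assms(3) by simp
    ultimately show ?thesis by (simp only:)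
  qed
  have spl: "spl \<in> Hom [Double] (S 2)" using Hom_spl by (simp add: numeral_2_eq_2)
  have "to_singles (W (Suc n)) \<circ>\<^sub>w pad [] x [Double] = (to_singles (W n) \<otimes>\<^sub>w spl) \<circ>\<^sub>w (x \<otimes>\<^sub>w id_web [Double])"
    by (simp only: W_Suc to_singles_append) (simp add: pad_def)
  also have "\<dots> = (to_singles (W n) \<circ>\<^sub>w x) \<otimes>\<^sub>w spl"
    using interchange[OF Hom_to_singles[of "W n"] Hom_spl assms(2) Hom_id] comp_id[OF Hom_spl] by simp
  also have "ccap (2 * n) (Suc (2 * i)) \<circ>\<^sub>w \<dots> = (ccap (2 * n - 2) (Suc (2 * i)) \<circ>\<^sub>w (to_singles (W n) \<circ>\<^sub>w x)) \<otimes>\<^sub>w spl"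
    using interchange[OF h Hom_id _ spl, of "to_singles (W n) \<circ>\<^sub>w x" "W n"] Hom_comp[OF Hom_to_singles[of "W n"] assms(2)]
      id_comp[OF spl] by (simp add: c pad_def)
  also have "\<dots> = 0" using assms(1,3) by (simp add: cap_free_def)
  finally show ?thesis .
qed

lemma cap_free_UX:
  assumes x: "x \<in> Hom s (W (Suc (Suc n)))"
    and cap: "ccap (2 * n + 2) (Suc (2 * n)) \<circ>\<^sub>w (to_singles (W (Suc (Suc n))) \<circ>\<^sub>w x) = 0"
  shows "pad (W n) U2 [] \<circ>\<^sub>w x = 0" "pad (W n) X2 [] \<circ>\<^sub>w x = 0"
proof -
  interpret strands "2 * n" s .
  have c: "oC 2 (Suc 0) (to_singles (W n @ [Double, Double]) \<circ>\<^sub>w x) = 0"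
    using cap by (simp only: W_Suc(2) oC_def) simp
  have h: "pad (W n) U2 [] \<in> Hom (W n @ [Double, Double]) (W n @ [Double, Double])"
    "pad (W n) X2 [] \<in> Hom (W n @ [Double, Double]) (W n @ [Double, Double])"
    using Hom_pad[OF Hom_U2, of "W n" "[]"] Hom_pad[OF Hom_X2, of "W n" "[]"] by simp_all
  have z: "to_singles (W n @ [Double, Double]) \<circ>\<^sub>w (pad (W n) U2 [] \<circ>\<^sub>w x) = to_singles (W n @ [Double, Double]) \<circ>\<^sub>w 0"
    "to_singles (W n @ [Double, Double]) \<circ>\<^sub>w (pad (W n) X2 [] \<circ>\<^sub>w x) = to_singles (W n @ [Double, Double]) \<circ>\<^sub>w 0"
    using to_singles_pads(1,2)[of "W n" "[]" x] c by (simp_all add: o_linear)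
  have x': "x \<in> Hom s (W n @ [Double, Double])" using x by (simp only: W_Suc(2))
  show "pad (W n) U2 [] \<circ>\<^sub>w x = 0" "pad (W n) X2 [] \<circ>\<^sub>w x = 0"
    by (rule to_singles_cancel[OF z(1) Hom_comp[OF h(1) x'] Hom_closed(1)])
      (rule to_singles_cancel[OF z(2) Hom_comp[OF h(2) x'] Hom_closed(1)])
qed

text \<open>The clasp is expanded, and then the copy of its predecessor inside it, until the cap
  acts on three double strands. Below them the predecessor survives, and its own last cap is known
  to vanish.\<close>

lemma clasp_last_cap:
  assumes idem: "clasp (Suc n) \<circ>\<^sub>w clasp (Suc n) = clasp (Suc n)" "clasp n \<circ>\<^sub>w clasp n = clasp n"
    and free: "cap_free (Suc n) (clasp (Suc n))"
  shows "pad (W n) inner_cap [] \<circ>\<^sub>w clasp (Suc (Suc n)) = 0"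
proof -
  define a b where "a = coefU (n + 2)" and "b = coefX (n + 2)"
  define x where "x = pad [] (clasp (Suc n)) [Double]"
  have cl: "clasp (Suc (Suc n)) = x + a *\<^sub>K (x \<circ>\<^sub>w (pad (W n) U2 [] \<circ>\<^sub>w x)) + b *\<^sub>K (x \<circ>\<^sub>w (pad (W n) X2 [] \<circ>\<^sub>w x))"
    by (simp add: x_def a_def b_def Let_def)
  note eqs = coef_equations[of "n + 2", folded a_def b_def]
  show ?thesis
  proof (cases n)
    case 0
    have x2: "x = id_web [Double, Double]" by (simp add: x_def 0)
    \<comment> \<open>Both have the factor [0], so the terms of the second expansion drop out of the
      equations.\<close>
    have "coefU (Suc 0) = 0" "coefX (Suc 0) = 0" by (simp_all add: coefU_def coefX_def)
    then have e: "1 + b * (1 - B - \<kappa>) = 0" "a * \<kappa> / B + b * (1 - B) = 0"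
      using eqs(1,2) by (simp_all add: 0)
    have f: "x \<circ>\<^sub>w (pad (W 0) U2 [] \<circ>\<^sub>w x) = pad (W 0) U2 [] \<circ>\<^sub>w x"
      "x \<circ>\<^sub>w (pad (W 0) X2 [] \<circ>\<^sub>w x) = pad (W 0) X2 [] \<circ>\<^sub>w x"
      by (simp_all add: x2 id_comp[OF Hom_U2] comp_id[OF Hom_U2] id_comp[OF Hom_X2] comp_id[OF Hom_X2])
    have "x \<in> Hom [Double, Double] (W 0 @ [Double, Double])" by (simp add: x2)
    from last_two[OF this e] show ?thesis unfolding cl unfolding 0 f .
  next
    case (Suc k)
    define a' b' where "a' = coefU (k + 2)" and "b' = coefX (k + 2)"
    have n1: "n + 2 - 1 = k + 2" using Suc by simp
    have D: "clasp (Suc k) \<in> Hom (W k @ [Double]) (W k @ [Double])"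
      using Hom_clasp[of "Suc k"] by (simp only: W_Suc)
    let ?Q' = "pad [] (clasp (Suc k)) [Double, Double]"
    have w3: "W (Suc n) @ [Double] = W k @ [Double, Double, Double]" "W n = W k @ [Double]"
      "W (Suc (Suc n)) = W k @ [Double, Double, Double]"
      by (simp_all add: Suc replicate_append_same[symmetric])
    have x: "x \<in> Hom (W k @ [Double, Double, Double]) (W k @ [Double, Double, Double])"
      using Hom_pad[OF Hom_clasp[of "Suc n"], of "[]" "[Double]"] by (simp only: x_def append_Nil w3)
    have x_eq: "x = ?Q' + a' *\<^sub>K (?Q' \<circ>\<^sub>w (pad (W k) U2 [Double] \<circ>\<^sub>w ?Q')) +
        b' *\<^sub>K (?Q' \<circ>\<^sub>w (pad (W k) X2 [Double] \<circ>\<^sub>w ?Q'))"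
      unfolding x_def Suc by (simp add: a'_def b'_def Let_def pad_linear pad_comp)
    have QQ: "?Q' \<circ>\<^sub>w ?Q' = ?Q'"
      using idem(2) Suc by (simp add: pad_comp[symmetric])
    \<comment> \<open>Every term of the predecessor begins with the idempotent \<open>?Q'\<close> at
      the top.\<close>
    have Qx: "?Q' \<circ>\<^sub>w x = x"
      unfolding x_eq by (simp add: comp_linear QQ QQ[THEN comp_eq_assoc])
    have "ccap (2 * Suc n) (Suc (2 * k)) \<circ>\<^sub>w (to_singles (W (Suc (Suc n))) \<circ>\<^sub>w x) = 0"
      unfolding x_def by (rule cap_free_pad[OF free Hom_clasp]) (simp add: Suc)
    then have cap: "ccap (2 * k + 4) (Suc (2 * k)) \<circ>\<^sub>w (to_singles (W k @ [Double, Double, Double]) \<circ>\<^sub>w x) = 0"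
      by (simp only: w3) (simp add: Suc numeral_eq_Suc)
    have "pad (W k @ [Double]) inner_cap [] \<circ>\<^sub>w (x + a *\<^sub>K (x \<circ>\<^sub>w (pad (W k @ [Double]) U2 [] \<circ>\<^sub>w x)) +
        b *\<^sub>K (x \<circ>\<^sub>w (pad (W k @ [Double]) X2 [] \<circ>\<^sub>w x))) = 0"
      using last_three[OF D x Qx cap, of b b' a a'] eqs unfolding n1 a'_def[symmetric] b'_def[symmetric] x_eq[symmetric]
      by simp
    then show ?thesis by (simp only: cl w3)
  qed
qed

text \<open>The two properties need each other: the last cap vanishes because an earlier clasp is
  idempotent, and the new clasp is idempotent because this cap kills both correction terms.\<close>

lemma clasp_props: "cap_free n (clasp n) \<and> clasp n \<circ>\<^sub>w clasp n = clasp n"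
proof (induction n rule: less_induct)
  case (less n)
  show ?case
  proof (cases n rule: clasp.cases)
    case 1
    then show ?thesis by (simp add: cap_free_def comp_id[OF Hom_id])
  next
    case 2
    then show ?thesis by (simp add: cap_free_def comp_id[OF Hom_id])
  next
    case (3 k)
    have IH: "cap_free (Suc k) (clasp (Suc k))" "clasp (Suc k) \<circ>\<^sub>w clasp (Suc k) = clasp (Suc k)"
      "clasp k \<circ>\<^sub>w clasp k = clasp k" using less[of "Suc k"] less[of k] 3 by simp_all
    define Q where "Q = pad [] (clasp (Suc k)) [Double]"
    have QQ: "Q \<circ>\<^sub>w Q = Q" by (simp add: Q_def pad_comp[symmetric] IH)
    have cl: "clasp n = Q + coefU (k + 2) *\<^sub>K (Q \<circ>\<^sub>w (pad (W k) U2 [] \<circ>\<^sub>w Q)) +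
        coefX (k + 2) *\<^sub>K (Q \<circ>\<^sub>w (pad (W k) X2 [] \<circ>\<^sub>w Q))"
      by (simp add: 3 Q_def Let_def)
    have Qc: "Q \<circ>\<^sub>w clasp n = clasp n"
      unfolding cl by (simp add: comp_linear QQ QQ[THEN comp_eq_assoc])
    have Hn: "clasp n \<in> Hom (W (Suc (Suc k))) (W (Suc (Suc k)))" using Hom_clasp[of n] 3 by simp
    have "pad (W k) inner_cap [] \<circ>\<^sub>w clasp n = 0" using clasp_last_cap[OF IH(2,3,1)] 3 by simp
    then have "strands.oC (2 * k) 2 1 (to_singles (W k @ [Double, Double]) \<circ>\<^sub>w clasp n) = 0"
      using to_singles_pads(3)[of "W k" "[]" "clasp n"] by simp
    then have last: "ccap (2 * k + 2) (Suc (2 * k)) \<circ>\<^sub>w (to_singles (W (Suc (Suc k))) \<circ>\<^sub>w clasp n) = 0"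
      by (simp only: W_Suc(2) strands.oC_def) simp
    have "cap_free n (clasp n)"
      unfolding cap_free_def
    proof (intro allI impI)
      fix i assume i: "Suc i < n"
      show "ccap (2 * n - 2) (Suc (2 * i)) \<circ>\<^sub>w (to_singles (W n) \<circ>\<^sub>w clasp n) = 0"
      proof (cases "i = k")
        case True
        then show ?thesis using last 3 by simp
      next
        \<comment> \<open>The new clasp absorbs \<open>Q\<close> on the left, so the caps at earlier
          positions vanish as they do for the previous clasp.\<close>
        case False
        then have "ccap (2 * Suc k) (Suc (2 * i)) \<circ>\<^sub>w (to_singles (W (Suc (Suc k))) \<circ>\<^sub>w Q) = 0"
          unfolding Q_def by (intro cap_free_pad[OF IH(1) Hom_clasp]) (use i 3 in simp)
        then have "ccap (2 * n - 2) (Suc (2 * i)) \<circ>\<^sub>w (to_singles (W n) \<circ>\<^sub>w (Q \<circ>\<^sub>w clasp n)) = 0"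
          using 3 by (simp add: wcomp_assoc[symmetric])
        then show ?thesis by (simp only: Qc)
      qed
    qed
    moreover have "clasp n \<circ>\<^sub>w clasp n = clasp n"
      using cap_free_UX[OF Hn last] by (subst cl) (simp add: comp_linear wcomp_assoc Qc)
    ultimately show ?thesis by blast
  qed
qed

section \<open>Uniqueness of the clasp\<close>

lemma comp_clasp:
  assumes "f \<in> Hom (W n @ v) r"
    and "\<And>i j. i + j + 2 = n \<Longrightarrow> f \<circ>\<^sub>w pad (W i) U2 (W j @ v) = 0"
    and "\<And>i j. i + j + 2 = n \<Longrightarrow> f \<circ>\<^sub>w pad (W i) X2 (W j @ v) = 0"
  shows "f \<circ>\<^sub>w pad [] (clasp n) v = f"
  using assms
proof (induction n arbitrary: v rule: clasp.induct)
  case (1 v)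
  then show ?case by (simp add: comp_id)
next
  case (2 v)
  then show ?case using comp_id[OF 2(1)] by simp
next
  case (3 n)
  \<comment> \<open>The last double strand moves into the context \<open>v\<close>, so the induction
    hypothesis tests \<open>f\<close> against the same local webs on one strand fewer.\<close>
  let ?Q = "pad [] (clasp (Suc n)) (Double # v)"
  have "f \<circ>\<^sub>w ?Q = f"
  proof (rule 3)
    show "f \<in> Hom (W (Suc n) @ Double # v) r" using 3(2) by (simp add: replicate_app_Cons_same)
    fix i j assume "i + j + 2 = Suc n"
    then show "f \<circ>\<^sub>w pad (W i) U2 (W j @ Double # v) = 0" "f \<circ>\<^sub>w pad (W i) X2 (W j @ Double # v) = 0"
      using 3(3)[of i "Suc j"] 3(4)[of i "Suc j"] by (simp_all add: replicate_app_Cons_same)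
  qed
  moreover have "f \<circ>\<^sub>w pad (W n) U2 v = 0" "f \<circ>\<^sub>w pad (W n) X2 v = 0"
    using 3(3)[of n 0] 3(4)[of n 0] by simp_all
  ultimately show ?case
    by (simp add: Let_def pad_linear pad_comp comp_linear wcomp_assoc[symmetric])
qed

text \<open>Removing two double strands takes four steps of the order: (0, m+2), (2, m), (0, m+1),
  (-2, m+2), (0, m). The fourth weight is not dominant.\<close>

lemma weight_lower:
  "i + j + 2 = n \<Longrightarrow> word_weight (W i @ W j) \<prec> word_weight (W n)"
  "i + j + 2 = n \<Longrightarrow> word_weight (W i @ [Single, Single] @ W j) \<prec> word_weight (W n)"
proof -
  assume n: "i + j + 2 = n"
  have c: "count_list (W k) Double = k" "count_list (W k) Single = 0" for k by (induction k) auto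
  have 1: "(2, int i + int j) \<prec> (0, int i + int j + 2)"
    using weight_less.step2[of 0 "int i + int j + 2"] by simp
  have 2: "(0, int i + int j + 1) \<prec> (2, int i + int j)"
    using weight_less.step1[of 2 "int i + int j"] by simp
  have 3: "(- 2, int i + int j + 2) \<prec> (0, int i + int j + 1)"
    using weight_less.step1[of 0 "int i + int j + 1"] by (simp add: add.assoc)
  have 4: "(0, int i + int j) \<prec> (- 2, int i + int j + 2)"
    using weight_less.step2[of "- 2" "int i + int j + 2"] by simp
  have w: "word_weight (W n) = (0, int i + int j + 2)" using n by (auto simp: word_weight_def c)
  show "word_weight (W i @ W j) \<prec> word_weight (W n)"
    using weight_less.trans[OF weight_less.trans[OF weight_less.trans[OF 4 3] 2] 1] w
    by (simp add: word_weight_def c)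
  show "word_weight (W i @ [Single, Single] @ W j) \<prec> word_weight (W n)"
    using 1 w by (simp add: word_weight_def c)
qed

theorem is_clasp_unique:
  assumes "is_clasp (W n) P"
  shows "P = clasp n"
proof -
  have P: "P \<in> Hom (W n) (W n)" "P \<noteq> 0" "P \<circ>\<^sub>w P = P"
    and kill: "\<And>t x. word_weight t \<prec> word_weight (W n) \<Longrightarrow> x \<in> Hom t (W n) \<Longrightarrow> P \<circ>\<^sub>w x = 0"
    using assms unfolding is_clasp_def by blast+
  have "P \<circ>\<^sub>w pad [] (clasp n) [] = P"
  proof (rule comp_clasp)
    show "P \<in> Hom (W n @ []) (W n)" using P(1) by simp
    fix i j assume n: "i + j + 2 = n"
    have Wn: "W n = W i @ [Double, Double] @ W j" using n by (simp add: replicate_add[symmetric] flip: replicate_Suc)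
    have "pad (W i) (cupe Double) (W j) \<in> Hom (W i @ W j) (W n)"
      using Hom_pad[OF Hom_cupe[of Double], of "W i" "W j"] by (simp add: Wn)
    from kill[OF weight_lower(1)[OF n] this] show "P \<circ>\<^sub>w pad (W i) U2 (W j @ []) = 0"
      by (simp add: U2_eval pad_comp wcomp_assoc[symmetric])
    \<comment> \<open>The upper half of the square web. Cutting through the two vertical edges makes
      the web factor through a word with two singles in place of two doubles.\<close>
    define Y where "Y = pad [Double] mrg [] \<circ>\<^sub>w (pad [] mrg [Single, Single] \<circ>\<^sub>w pad [Single] (cupe Single) [Single])"
    have "Y \<in> Hom [Single, Single] [Double, Double]"
      unfolding Y_def using Hom_pad[OF Hom_mrg, of "[Double]" "[]"] Hom_pad[OF Hom_mrg, of "[]" "[Single, Single]"]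
        Hom_pad[OF Hom_cupe[of Single], of "[Single]" "[Single]"] by (auto intro!: Hom_comp)
    then have "pad (W i) Y (W j) \<in> Hom (W i @ [Single, Single] @ W j) (W n)"
      using Hom_pad[of Y "[Single, Single]" "[Double, Double]" "W i" "W j"] by (simp add: Wn)
    from kill[OF weight_lower(2)[OF n] this] have "P \<circ>\<^sub>w pad (W i) Y (W j) = 0" .
    moreover have X2: "X2 = Y \<circ>\<^sub>w (pad [Single] (cape Single) [Single] \<circ>\<^sub>w to_singles [Double, Double])"
      by (simp only: X2_eval Y_def wcomp_assoc)
    ultimately show "P \<circ>\<^sub>w pad (W i) X2 (W j @ []) = 0"
      unfolding X2 append_Nil2 pad_comp by (simp only: wcomp_assoc[symmetric] comp_zero)
  qed
  then have PG: "P \<circ>\<^sub>w clasp n = P" by simp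
  obtain c where "P \<circ>\<^sub>w clasp n = c *\<^sub>K clasp n"
    using Hom_double_scalar[OF Hom_clasp _ P(1)] clasp_props[of n] unfolding cap_free_def by blast
  then have c: "P = c *\<^sub>K clasp n" using PG by simp
  have "(c * c) *\<^sub>K clasp n = c *\<^sub>K clasp n"
    using P(3) clasp_props[of n] unfolding c by simp
  \<comment> \<open>Here \<open>P \<noteq> 0\<close> supplies the nonvanishing of
    \<open>clasp n\<close>.\<close>
  moreover have "clasp n \<noteq> 0" "c \<noteq> 0" using P(2) c by auto
  ultimately have "c = 1" by simp
  then show ?thesis using c by simp
qed

theorem corollary4p5:
  fixes n :: nat and g :: "nat \<Rightarrow> mor"
  assumes "n > 0"
    and "is_clasp (replicate n Double) (g n)"
    and "is_clasp (replicate (n - 1) Double) (g (n - 1))"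
  shows "let Q = g (n - 1) \<otimes>\<^sub>w id_web [Double] in
    g n = Q + (if n = 1 then 0 else
        (qint (2 * int n - 1) * qint (2 * int n - 2) / (qint (2 * int n + 1) * qint (2 * int n))) *\<^sub>K
          (Q \<circ>\<^sub>w (id_web (replicate (n - 2) Double) \<otimes>\<^sub>w U2) \<circ>\<^sub>w Q)
      + (qint (2 * int n - 2) / (qint (2 * int n) * qint 2 * qint 2)) *\<^sub>K
          (Q \<circ>\<^sub>w (id_web (replicate (n - 2) Double) \<otimes>\<^sub>w X2) \<circ>\<^sub>w Q))"
proof -
  have g: "g n = clasp n" "g (n - 1) = clasp (n - 1)"
    using is_clasp_unique assms by blast+
  show ?thesis
  proof (cases n rule: clasp.cases)
    case 1
    then show ?thesis using assms(1) by simp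
  next
    case 2
    then show ?thesis using g by simp
  next
    case (3 k)
    have "coefU n = qint (2 * int n - 1) * qint (2 * int n - 2) / (qint (2 * int n + 1) * qint (2 * int n))"
      "coefX n = qint (2 * int n - 2) / (qint (2 * int n) * qint 2 * qint 2)"
      by (simp_all only: coefU_def coefX_def)
    note c = this[symmetric]
    show ?thesis
      unfolding c g using 3 by (simp add: Let_def pad_def wcomp_assoc)
  qed
qed

end
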